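(* Let $\alpha \in [0,\infty)\cup\{-\tfrac1d : d\in\mathbb{Z}, d\ge 2\}$ and $p\in[0,1]$, and let $R_n^c$ and $B_n^c$ denote the number of red and blue clusters, respectively, in the random preferential attachment tree $\mathcal{T}_n=\mathcal{T}_{\alpha,n}$ with broadcasting induced colouring $\sigma_n$ (with parameter $p$). As $n\to\infty$: (i) $\frac1n(R_n^c,B_n^c)\to\left(\frac{1-p}{2},\frac{1-p}{2}\right)$ almost surely. (ii) If $p<(3-\alpha)/4$, then $$\frac{(R_n^c,B_n^c)-n\left(\frac{1-p}{2},\frac{1-p}{2}\right)}{\sqrt n}\xrightarrow{d}\mathcal{N}(\mathbf{0},\Sigma_I^c),$$ where $$\Sigma_I^c=\frac{1-p}{4(3-\alpha-4p)}\begin{pmatrix}(1-p)(\alpha+4p+1)&3p-4p^2-\alpha p-\alpha-1\\3p-4p^2-\alpha p-\alpha-1&(1-p)(\alpha+4p+1)\end{pmatrix}.$$ (iii) If $p=(3-\alpha)/4$, then $$\frac{(R_n^c,B_n^c)-n\left(\frac{1-p}{2},\frac{1-p}{2}\right)}{\sqrt{n\ln n}}\xrightarrow{d}\mathcal{N}(\mathbf{0},\Sigma_{II}^c),\qquad\Sigma_{II}^c=\frac{\alpha+1}{16}\begin{pmatrix}1&-1\\-1&1\end{pmatrix}.$$ (iv) If $p>(3-\alpha)/4$, then $$\frac{(R_n^c,B_n^c)-n\left(\frac{1-p}{2},\frac{1-p}{2}\right)}{n^{(2p+\alpha-1)/(1+\alpha)}}\xrightarrow{d}\frac{BZ}{2(2p+\alpha-1)}(p-1,\,1-p),$$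 where $Z$ is a real random variable (defined jointly with $B$) with $$\mathbb{E}[Z]=\frac{\Gamma(1/(1+\alpha))}{\Gamma((2p+\alpha)/(1+\alpha))},\qquad \mathbb{E}[Z^2]=\frac{\Gamma(1/(1+\alpha))(1+\alpha)(4p+\alpha-2)}{\Gamma((4p+2\alpha-1)/(1+\alpha))(4p+\alpha-3)},$$ and $Z$ is the same random variable for which the numbers $R_n,B_n$ of red and blue vertices of $\mathcal{T}_n$ satisfy (when $p\ne\frac12$) $\frac{(R_n,B_n)-n(\frac12,\frac12)}{n^{(2p+\alpha-1)/(1+\alpha)}}\xrightarrow{d}\frac{BZ}{2(2p+\alpha-1)}(2p-1,1-2p)$.
   Context: The random (linear) preferential attachment trees $(\mathcal{T}_n)_{n\ge1}=(\mathcal{T}_{\alpha,n})_{n\ge1}$ are rooted trees grown recursively: $\mathcal{T}_1$ is a single vertex $\rho$, the root of all the trees; $\mathcal{T}_n$ is obtained from $\mathcal{T}_{n-1}$ by choosing a vertex $v$ of $\mathcal{T}_{n-1}$ at random with probability $\frac{\alpha\deg^+(v)+1}{\sum_{u\in V(\mathcal{T}_{n-1})}(\alpha\deg^+(u)+1)}$ and adding a new child to $v$, where $\deg^+(u)$ is the number of children of $u$ in $\mathcal{T}_{n-1}$. The broadcasting induced colourings $\sigma_n:V(\mathcal{T}_n)\to\{\text{red},\text{blue}\}$ with parameter $p$ are built along with the trees: the root is red or blue with probability $1/2$ each; every newly added vertex receives the colour of its parent with probability $p$ and the other colour with probability $1-p$, independently of everything else; colours never change, so $\sigma_n$ restricted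 to $V(\mathcal{T}_{n-1})$ equals $\sigma_{n-1}$. A cluster is a maximal monochromatic (connected) subtree of $\mathcal{T}_n$; its colour is the common colour of its vertices. The random variable $B$ equals $1$ if the root is red and $-1$ if the root is blue. $\mathcal{N}(\mathbf{0},\Sigma)$ is the (possibly degenerate) centred multivariate normal law with covariance matrix $\Sigma$. *)

theory Defs
  imports "HOL-Probability.Probability" "Graph_Theory.Digraph_Component"
begin

section \<open>Coloured recursive trees and their clusters\<close>

datatype colour = Red | Blue

text \<open>
  The tree \<open>\<T>\<^sub>n\<close>: vertices are labelled by their time of insertion, so the vertex set is
  \<open>{1..n}\<close> with root \<open>1\<close>, and \<open>\<pi> k\<close> is the parent of \<open>k\<close> for \<open>2 \<le> k\<close>. Arcs point from parent to
  child, hence \<open>out_degree\<close> is the number of children.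
\<close>

definition rec_tree :: "(nat \<Rightarrow> nat) \<Rightarrow> nat \<Rightarrow> (nat, nat \<times> nat) pre_digraph" where
  "rec_tree \<pi> n = \<lparr>verts = {1..n}, arcs = (\<lambda>k. (\<pi> k, k)) ` {2..n}, tail = fst, head = snd\<rparr>"

definition monochromatic :: "(nat \<Rightarrow> colour) \<Rightarrow> colour \<Rightarrow> (nat, nat \<times> nat) pre_digraph \<Rightarrow> bool" where
  "monochromatic \<sigma> c H \<longleftrightarrow> (\<forall>v\<in>verts H. \<sigma> v = c)"

text \<open>
  Connectivity is that of the underlying undirected graph; it includes nonemptiness, so a cluster
  has exactly one colour.
\<close>

definition is_cluster ::
  "(nat, nat \<times> nat) pre_digraph \<Rightarrow> (nat \<Rightarrow> colour) \<Rightarrow> (nat, nat \<times> nat) pre_digraph \<Rightarrow> bool" where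
  "is_cluster T \<sigma> H \<longleftrightarrow>
     pre_digraph.max_subgraph T (\<lambda>H. Digraph_Component.connected H \<and> (\<exists>c. monochromatic \<sigma> c H)) H"

definition num_clusters :: "(nat, nat \<times> nat) pre_digraph \<Rightarrow> (nat \<Rightarrow> colour) \<Rightarrow> colour \<Rightarrow> nat" where
  "num_clusters T \<sigma> c = card {H. is_cluster T \<sigma> H \<and> monochromatic \<sigma> c H}"

definition num_vertices :: "(nat, nat \<times> nat) pre_digraph \<Rightarrow> (nat \<Rightarrow> colour) \<Rightarrow> colour \<Rightarrow> nat" where
  "num_vertices T \<sigma> c = card {v \<in> verts T. \<sigma> v = c}"


section \<open>Preferential attachment trees with broadcasting induced colouring\<close>

definition attach_weight :: "real \<Rightarrow> (nat, nat \<times> nat) pre_digraph \<Rightarrow> nat \<Rightarrow> real" where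
  "attach_weight \<alpha> T v = \<alpha> * real (out_degree T v) + 1"

definition attach_prob :: "real \<Rightarrow> (nat, nat \<times> nat) pre_digraph \<Rightarrow> nat \<Rightarrow> real" where
  "attach_prob \<alpha> T v = attach_weight \<alpha> T v / (\<Sum>u\<in>verts T. attach_weight \<alpha> T u)"

text \<open>
  \<open>par k\<close> and \<open>col k\<close> are the random parent and the random colour of vertex \<open>k\<close>; the values
  \<open>par 0\<close>, \<open>par 1\<close> and \<open>col 0\<close> are irrelevant. The event \<open>history\<close> fixes the coloured tree
  with \<open>n\<close> vertices, and thereby the whole evolution up to time \<open>n\<close>.
\<close>

definition history ::
  "'a measure \<Rightarrow> (nat \<Rightarrow> 'a \<Rightarrow> nat) \<Rightarrow> (nat \<Rightarrow> 'a \<Rightarrow> colour) \<Rightarrow>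
   nat \<Rightarrow> (nat \<Rightarrow> nat) \<Rightarrow> (nat \<Rightarrow> colour) \<Rightarrow> 'a set" where
  "history M par col n \<pi> \<kappa> =
     {\<omega> \<in> space M. (\<forall>k\<in>{2..n}. par k \<omega> = \<pi> k) \<and> (\<forall>k\<in>{1..n}. col k \<omega> = \<kappa> k)}"

text \<open>
  The assumption \<open>step\<close> gives the conditional law of the next step given the past, in product form
  so that histories of probability zero need no special treatment: the parent \<open>v\<close> is chosen by
  preferential attachment and, independently of everything else, the colour of \<open>v\<close> is copied with
  probability \<open>p\<close>.
\<close>

locale pa_broadcast = prob_space M
  for M :: "'a measure" +
  fixes \<alpha> p :: real
    and par :: "nat \<Rightarrow> 'a \<Rightarrow> nat"
    and col :: "nat \<Rightarrow> 'a \<Rightarrow> colour"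
  assumes measurable_par: "\<And>k. k \<ge> 2 \<Longrightarrow> par k \<in> measurable M (count_space UNIV)"
    and measurable_col: "\<And>k. k \<ge> 1 \<Longrightarrow> col k \<in> measurable M (count_space UNIV)"
    and par_range: "\<And>k \<omega>. k \<ge> 2 \<Longrightarrow> \<omega> \<in> space M \<Longrightarrow> par k \<omega> \<in> {1..<k}"
    and root_colour: "\<And>c. prob {\<omega> \<in> space M. col 1 \<omega> = c} = 1 / 2"
    and step: "\<And>n \<pi> \<kappa> v c. n \<ge> 1 \<Longrightarrow> v \<in> {1..n} \<Longrightarrow>
      prob {\<omega> \<in> history M par col n \<pi> \<kappa>. par (n + 1) \<omega> = v \<and> col (n + 1) \<omega> = c} =
        prob (history M par col n \<pi> \<kappa>) *
        (attach_prob \<alpha> (rec_tree \<pi> n) v * (if c = \<kappa> v then p else 1 - p))"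

definition cluster_counts ::
  "(nat \<Rightarrow> 'a \<Rightarrow> nat) \<Rightarrow> (nat \<Rightarrow> 'a \<Rightarrow> colour) \<Rightarrow> nat \<Rightarrow> 'a \<Rightarrow> real^2" where
  "cluster_counts par col n \<omega> =
     (let T = rec_tree (\<lambda>k. par k \<omega>) n; \<sigma> = (\<lambda>k. col k \<omega>)
      in vector [real (num_clusters T \<sigma> Red), real (num_clusters T \<sigma> Blue)])"

definition vertex_counts ::
  "(nat \<Rightarrow> 'a \<Rightarrow> nat) \<Rightarrow> (nat \<Rightarrow> 'a \<Rightarrow> colour) \<Rightarrow> nat \<Rightarrow> 'a \<Rightarrow> real^2" where
  "vertex_counts par col n \<omega> =
     (let T = rec_tree (\<lambda>k. par k \<omega>) n; \<sigma> = (\<lambda>k. col k \<omega>)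
      in vector [real (num_vertices T \<sigma> Red), real (num_vertices T \<sigma> Blue)])"

definition root_sign :: "(nat \<Rightarrow> 'a \<Rightarrow> colour) \<Rightarrow> 'a \<Rightarrow> real" where
  "root_sign col \<omega> = (if col 1 \<omega> = Red then 1 else - 1)"


section \<open>Convergence in distribution and multivariate normal laws\<close>

text \<open>
  The library's \<open>weak_conv_m\<close> is restricted to laws on the real line; this is the usual definition
  by bounded continuous test functions.
\<close>

definition conv_in_distr ::
  "'a measure \<Rightarrow> (nat \<Rightarrow> 'a \<Rightarrow> 'b::metric_space) \<Rightarrow> 'b measure \<Rightarrow> bool" where
  "conv_in_distr M X N \<longleftrightarrow>
     (\<forall>n. X n \<in> borel_measurable M) \<and> prob_space N \<and> sets N = sets borel \<and>
     (\<forall>f :: 'b \<Rightarrow> real. continuous_on UNIV f \<and> bounded (range f) \<longrightarrow>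
        (\<lambda>n. \<integral>\<omega>. f (X n \<omega>) \<partial>M) \<longlonglongrightarrow> (\<integral>x. f x \<partial>N))"

text \<open>The centred normal law on the real line with variance \<open>v \<ge> 0\<close>; the unit mass at 0 if \<open>v = 0\<close>.\<close>

definition normal_law :: "real \<Rightarrow> real measure" where
  "normal_law v =
     (if v = 0 then return borel 0 else density lborel (\<lambda>x. ennreal (normal_density 0 (sqrt v) x)))"

text \<open>
  \<open>N\<close> is the (possibly degenerate) centred multivariate normal law with covariance matrix \<open>S\<close>:
  every linear functional \<open>x \<mapsto> t \<bullet> x\<close> has the centred normal law with variance \<open>t\<^sup>T S t\<close>.
\<close>

definition centred_normal :: "real^'n^'n \<Rightarrow> (real^'n) measure \<Rightarrow> bool" where
  "centred_normal S N \<longleftrightarrow>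
     prob_space N \<and> sets N = sets borel \<and> transpose S = S \<and>
     (\<forall>t. 0 \<le> t \<bullet> (S *v t) \<and> distr N borel (\<lambda>x. t \<bullet> x) = normal_law (t \<bullet> (S *v t)))"

end

theory Submission
  imports Defs
begin

text \<open>
  A cluster is determined by its vertex closest to the root, and a vertex \<open>k > 1\<close> starts a new cluster
  exactly when its colour differs from that of its parent. So everything is a functional of the
  sequence of attachment steps, and of each step only two bits matter: the sign \<open>s\<close> of the parent's
  colour and the indicator \<open>\<eta>\<close> of a colour flip (\<open>num_clusters_process\<close>). The sum of the two cluster
  numbers increases by \<open>\<eta>\<close>, their difference by \<open>- s \<eta>\<close>, the difference of the vertex numbers by
  \<open>s (1 - 2 \<eta>)\<close>, and the difference \<open>D\<close> of the total attachment weights of red and blue vertices by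
  \<open>s (1 + \<alpha> - 2 \<eta>)\<close>. Given the past, \<open>\<eta>\<close> is a Bernoulli variable of mean \<open>1 - p\<close> independent of \<open>s\<close>,
  and \<open>s\<close> has mean \<open>D / w\<close>, where \<open>w = (1 + \<alpha>) n - \<alpha>\<close> is the total weight (\<open>one_step\<close>). Thus \<open>D\<close>
  drives all other quantities. Multiplied by the sign of the root, its mean gains a factor \<open>1 + \<xi> / w\<close>
  in each step, where \<open>\<xi> = 2 p + \<alpha> - 1\<close>, which accumulates to the order of \<open>n\<close> to the power
  \<open>\<beta> = \<xi> / (1 + \<alpha>)\<close>; the three regimes are \<open>\<beta> < 1/2\<close>, \<open>\<beta> = 1/2\<close> and \<open>\<beta> > 1/2\<close>.

  Strong law. Second moments satisfy linear recursions whose solutions for \<open>p < 1\<close> are of smaller order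
  than \<open>n\<^sup>2\<close> (\<open>moments_subquadratic\<close>); for \<open>p = 1\<close> there is a single cluster. Since the increments are bounded, this already gives almost sure
  convergence of the averages (\<open>AE_average_null\<close>).

  Normal limits. For a fixed time horizon \<open>N\<close> a linear combination of the sum and the difference of the
  cluster numbers becomes a martingale after adding a deterministic multiple \<open>c N k\<close> of \<open>D\<close>; the
  coefficients solve a backward recursion that starts from \<open>c N N = 0\<close>. As \<open>s\<^sup>2 = 1\<close>, the conditional
  variances of the increments are deterministic up to multiples of \<open>D / w\<close>, which tends to zero, so the
  characteristic functions telescope (\<open>cf_step\<close>, \<open>clt_criterion\<close>). What remains is to sum the variances:
  in the subcritical case by telescoping \<open>w k * c N k\<close> and \<open>w k * (c N k)\<^sup>2\<close>, in the critical case from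
  the explicit solution of the recursion, where the sum has the order of a harmonic sum
  (\<open>clt_subcritical\<close>, \<open>clt_critical\<close>).

  Supercritical limit. Here \<open>D\<close> divided by its growth factor is a martingale bounded in \<open>L\<^sup>2\<close> and hence
  converges in mean square. Every other difference is a multiple of \<open>D\<close> up to a martingale of
  order \<open>sqrt n\<close>, and \<open>Z\<close> is the limit of \<open>D / n powr \<beta>\<close> times the sign of the root. Its two moments
  are the limits of the explicitly known moments of \<open>D\<close> (\<open>supercritical_limit\<close>).

  Joint convergence in the plane is derived from characteristic functions by a continuity theorem for
  Euclidean spaces (\<open>cf_convergence.conv_in_distr\<close>).
\<close>

section \<open>Clusters and their topmost vertices\<close>

text \<open>
  The third alternative never occurs in a recursive tree; it makes the recursion terminate for an
  arbitrary function \<open>\<pi>\<close>.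
\<close>

fun cluster_top :: "(nat \<Rightarrow> nat) \<Rightarrow> (nat \<Rightarrow> colour) \<Rightarrow> nat \<Rightarrow> nat" where
  "cluster_top \<pi> \<sigma> k =
     (if k \<le> 1 \<or> \<sigma> (\<pi> k) \<noteq> \<sigma> k \<or> k \<le> \<pi> k then k else cluster_top \<pi> \<sigma> (\<pi> k))"

declare cluster_top.simps [simp del]

definition recursive_parents :: "(nat \<Rightarrow> nat) \<Rightarrow> nat \<Rightarrow> bool" where
  "recursive_parents \<pi> n \<longleftrightarrow> (\<forall>k\<in>{2..n}. \<pi> k \<in> {1..<k})"

lemma verts_rec_tree [simp]: "verts (rec_tree \<pi> n) = {1..n}"
  and arcs_rec_tree [simp]: "arcs (rec_tree \<pi> n) = (\<lambda>k. (\<pi> k, k)) ` {2..n}"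
  and tail_rec_tree [simp]: "tail (rec_tree \<pi> n) = fst"
  and head_rec_tree [simp]: "head (rec_tree \<pi> n) = snd"
  by (simp_all add: rec_tree_def)

lemma wf_rec_tree: "recursive_parents \<pi> n \<Longrightarrow> wf_digraph (rec_tree \<pi> n)"
  by unfold_locales (fastforce simp: recursive_parents_def)+

lemma colour_cluster_top: "\<sigma> (cluster_top \<pi> \<sigma> k) = \<sigma> k"
  by (induction \<pi> \<sigma> k rule: cluster_top.induct) (simp add: cluster_top.simps)

lemma cluster_top_idem: "cluster_top \<pi> \<sigma> (cluster_top \<pi> \<sigma> k) = cluster_top \<pi> \<sigma> k"
  by (induction \<pi> \<sigma> k rule: cluster_top.induct) (metis cluster_top.simps)

lemma cluster_top_in:
  assumes "recursive_parents \<pi> n" "k \<in> {1..n}"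
  shows "cluster_top \<pi> \<sigma> k \<in> {1..n}"
  using assms(2)
proof (induction k rule: less_induct)
  case (less k)
  show ?case
  proof (cases "k \<le> 1 \<or> \<sigma> (\<pi> k) \<noteq> \<sigma> k \<or> k \<le> \<pi> k")
    case True
    then show ?thesis using less.prems by (simp add: cluster_top.simps)
  next
    case False
    then have "\<pi> k \<in> {1..n}" "\<pi> k < k"
      using assms(1) less.prems by (auto simp: recursive_parents_def)
    with False less.IH[of "\<pi> k"] show ?thesis by (simp add: cluster_top.simps[of _ _ k])
  qed
qed

definition top_class :: "(nat \<Rightarrow> nat) \<Rightarrow> (nat \<Rightarrow> colour) \<Rightarrow> nat \<Rightarrow> nat \<Rightarrow> nat set" where
  "top_class \<pi> \<sigma> n r = {k \<in> {1..n}. cluster_top \<pi> \<sigma> k = r}"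

text \<open>
  Along an arc between vertices of the same colour the topmost vertex does not change, so it is
  constant on a connected monochromatic subgraph.
\<close>

lemma cluster_top_subgraph:
  assumes \<pi>: "recursive_parents \<pi> n" and sub: "subgraph H (rec_tree \<pi> n)"
    and conn: "Digraph_Component.connected H" and mono: "monochromatic \<sigma> c H"
    and uv: "u \<in> verts H" "v \<in> verts H"
  shows "cluster_top \<pi> \<sigma> u = cluster_top \<pi> \<sigma> v"
proof -
  interpret H: wf_digraph H using sub by (auto simp: subgraph_def)
  interpret S: pair_wf_digraph "mk_symmetric H" ..
  have step: "cluster_top \<pi> \<sigma> a = cluster_top \<pi> \<sigma> b" if "(a, b) \<in> arcs H" for a b
  proof -
    from that sub have "(a, b) \<in> (\<lambda>k. (\<pi> k, k)) ` {2..n}" by (auto simp: subgraph_def)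
    then have b: "a = \<pi> b" "b \<in> {2..n}" by auto
    have "tail H (a, b) = a" "head H (a, b) = b"
      using sub by (auto simp: subgraph_def compatible_def)
    then have "a \<in> verts H" "b \<in> verts H"
      using H.tail_in_verts[OF that] H.head_in_verts[OF that] by auto
    then have "\<sigma> a = \<sigma> b" using mono by (auto simp: monochromatic_def)
    moreover have "\<pi> b < b" using b \<pi> by (simp add: recursive_parents_def)
    ultimately show ?thesis using b by (simp add: cluster_top.simps[of _ _ b])
  qed
  have "u \<rightarrow>\<^sup>*\<^bsub>with_proj (mk_symmetric H)\<^esub> v"
    using conn uv by (auto simp: connected_def strongly_connected_def)
  then show ?thesis
  proof (induction rule: S.reachable_induct)
    case base
    then show ?case by simp
  next
    case (step x y)
    then have "(x, y) \<in> parcs (mk_symmetric H)" by auto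
    then obtain e where e: "e \<in> arcs H" "(x, y) = (tail H e, head H e) \<or> (x, y) = (head H e, tail H e)"
      by (auto simp: parcs_mk_symmetric)
    moreover have "(tail H e, head H e) = e" using sub by (auto simp: subgraph_def compatible_def)
    ultimately have "(x, y) \<in> arcs H \<or> (y, x) \<in> arcs H" by auto
    with \<open>\<And>a b. (a, b) \<in> arcs H \<Longrightarrow> _\<close> step.IH show ?case by metis
  qed
qed

lemma connected_top_class:
  assumes \<pi>: "recursive_parents \<pi> n" and r: "r \<in> top_class \<pi> \<sigma> n r"
  shows "Digraph_Component.connected (rec_tree \<pi> n \<restriction> top_class \<pi> \<sigma> n r)"
proof -
  let ?H = "rec_tree \<pi> n \<restriction> top_class \<pi> \<sigma> n r"
  interpret T: wf_digraph "rec_tree \<pi> n" by (rule wf_rec_tree[OF \<pi>])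
  interpret H: wf_digraph ?H by (rule T.wellformed_induce_subgraph)
  interpret S: pair_wf_digraph "mk_symmetric ?H" ..
  have to_top: "k \<rightarrow>\<^sup>*\<^bsub>with_proj (mk_symmetric ?H)\<^esub> r" if "k \<in> top_class \<pi> \<sigma> n r" for k
    using that
  proof (induction k rule: less_induct)
    case (less k)
    then have k: "k \<in> {1..n}" "cluster_top \<pi> \<sigma> k = r" by (auto simp: top_class_def)
    show ?case
    proof (cases "k \<le> 1 \<or> \<sigma> (\<pi> k) \<noteq> \<sigma> k \<or> k \<le> \<pi> k")
      case True
      with k have "k = r" by (simp add: cluster_top.simps)
      then show ?thesis using r by auto
    next
      case False
      then have pk: "\<pi> k \<in> {1..n}" "\<pi> k < k"
        using \<pi> k by (auto simp: recursive_parents_def)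
      then have cl: "\<pi> k \<in> top_class \<pi> \<sigma> n r"
        using False k by (simp add: top_class_def cluster_top.simps[of _ _ k])
      have "(\<pi> k, k) \<in> arcs ?H" using False k cl less.prems by auto
      then have "(k, \<pi> k) \<in> parcs (mk_symmetric ?H)" by (force simp: parcs_mk_symmetric)
      then have "k \<rightarrow>\<^bsub>with_proj (mk_symmetric ?H)\<^esub> \<pi> k" by simp
      then show ?thesis
        using less.IH[OF pk(2) cl] by (rule wf_digraph.adj_reachable_trans[OF S.wf_digraph])
    qed
  qed
  have "r \<rightarrow>\<^sup>*\<^bsub>with_proj (mk_symmetric ?H)\<^esub> k" if "k \<in> top_class \<pi> \<sigma> n r" for k
    by (rule symmetric_reachable[OF symmetric_mk_symmetric to_top[OF that]])
  with to_top r show ?thesis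
    unfolding connected_def strongly_connected_def by (auto intro: S.reachable_trans)
qed

text \<open>
  The classes of vertices with a common topmost vertex are connected and monochromatic, and every
  connected monochromatic subgraph lies inside one of them; so they induce precisely the clusters.
\<close>

lemma is_cluster_iff:
  assumes \<pi>: "recursive_parents \<pi> n"
  shows "is_cluster (rec_tree \<pi> n) \<sigma> H \<longleftrightarrow>
    (\<exists>r. r \<in> top_class \<pi> \<sigma> n r \<and> H = rec_tree \<pi> n \<restriction> top_class \<pi> \<sigma> n r)"
proof -
  let ?T = "rec_tree \<pi> n"
  let ?C = "top_class \<pi> \<sigma> n"
  let ?P = "\<lambda>H. Digraph_Component.connected H \<and> (\<exists>c. monochromatic \<sigma> c H)"
  interpret T: wf_digraph ?T by (rule wf_rec_tree[OF \<pi>])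
  have below: "\<exists>r. r \<in> ?C r \<and> verts H \<subseteq> ?C r \<and> subgraph H (?T \<restriction> ?C r)"
    if H: "subgraph H ?T" "?P H" for H
  proof -
    from H obtain u where u: "u \<in> verts H" by (auto simp: connected_def strongly_connected_def)
    let ?r = "cluster_top \<pi> \<sigma> u"
    have "verts H \<subseteq> {1..n}" using H by (auto simp: subgraph_def)
    with u have "?r \<in> ?C ?r"
      using cluster_top_in[OF \<pi>, of u \<sigma>] by (auto simp: top_class_def cluster_top_idem)
    moreover have "verts H \<subseteq> ?C ?r"
    proof
      fix v assume v: "v \<in> verts H"
      from H(2) obtain c where c: "Digraph_Component.connected H" "monochromatic \<sigma> c H" by blast
      show "v \<in> ?C ?r"
        using cluster_top_subgraph[OF \<pi> H(1) c v u] v \<open>verts H \<subseteq> {1..n}\<close>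
        by (auto simp: top_class_def)
    qed
    moreover from this have "subgraph H (?T \<restriction> ?C ?r)"
    proof -
      interpret H: wf_digraph H using H(1) by (auto simp: subgraph_def)
      have "arcs H \<subseteq> arcs (?T \<restriction> ?C ?r)"
      proof
        fix e assume e: "e \<in> arcs H"
        have "tail H = tail ?T" "head H = head ?T" using H(1) by (auto simp: subgraph_def compatible_def)
        then have "tail ?T e \<in> verts H" "head ?T e \<in> verts H"
          using H.tail_in_verts[OF e] H.head_in_verts[OF e] by simp_all
        then show "e \<in> arcs (?T \<restriction> ?C ?r)"
          using e H(1) \<open>verts H \<subseteq> ?C ?r\<close> by (auto simp: subgraph_def)
      qed
      then show ?thesis
        using H(1) T.wellformed_induce_subgraph[of "?C ?r"] \<open>verts H \<subseteq> ?C ?r\<close>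
        by (simp add: subgraph_def compatible_def)
    qed
    ultimately show ?thesis by blast
  qed
  have class_sub: "subgraph (?T \<restriction> ?C r) ?T" for r
    by (rule T.subgraph_induce_subgraphI) (auto simp: top_class_def)
  have class_P: "?P (?T \<restriction> ?C r)" if "r \<in> ?C r" for r
  proof
    show "Digraph_Component.connected (?T \<restriction> ?C r)" by (rule connected_top_class[OF \<pi> that])
    have "monochromatic \<sigma> (\<sigma> r) (?T \<restriction> ?C r)"
      using colour_cluster_top[of \<sigma> \<pi>] by (force simp: monochromatic_def top_class_def)
    then show "\<exists>c. monochromatic \<sigma> c (?T \<restriction> ?C r)" ..
  qed
  have anti: "H = H'" if "subgraph H H'" "subgraph H' H" for H H' :: "(nat, nat \<times> nat) pre_digraph"
    using that by (intro pre_digraph.equality) (auto simp: subgraph_def compatible_def)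
  show ?thesis
  proof
    assume cl: "is_cluster ?T \<sigma> H"
    then have H: "subgraph H ?T" "?P H" by (auto simp: is_cluster_def pre_digraph.max_subgraph_def)
    from below[OF this] obtain r where r: "r \<in> ?C r" "subgraph H (?T \<restriction> ?C r)" by blast
    with cl class_sub[of r] class_P[OF r(1)] have "H = ?T \<restriction> ?C r"
      unfolding is_cluster_def pre_digraph.max_subgraph_def by metis
    with r show "\<exists>r. r \<in> ?C r \<and> H = ?T \<restriction> ?C r" by blast
  next
    assume "\<exists>r. r \<in> ?C r \<and> H = ?T \<restriction> ?C r"
    then obtain r where r: "r \<in> ?C r" "H = ?T \<restriction> ?C r" by blast
    have "H' = H" if H': "subgraph H H'" "subgraph H' ?T" "?P H'" for H'
    proof -
      from below[OF H'(2,3)] obtain r' where r': "verts H' \<subseteq> ?C r'" "subgraph H' (?T \<restriction> ?C r')" by blast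
      have "r \<in> verts H'" using H'(1) r by (auto simp: subgraph_def)
      with r' r have "r' = r" by (auto simp: top_class_def)
      with r' r H'(1) show ?thesis by (auto intro: anti)
    qed
    with class_sub[of r] class_P[OF r(1)] r show "is_cluster ?T \<sigma> H"
      unfolding is_cluster_def pre_digraph.max_subgraph_def by blast
  qed
qed

text \<open>
  A cluster is determined by its vertex closest to the root, and a vertex plays that role precisely
  when it is the root or differs in colour from its parent. Counting clusters is therefore counting
  such vertices, which turns the cluster numbers into sums over the attachment steps.
\<close>

lemma num_clusters_eq:
  assumes \<pi>: "recursive_parents \<pi> n"
  shows "num_clusters (rec_tree \<pi> n) \<sigma> c =
    card {k \<in> {1..n}. \<sigma> k = c \<and> (k = 1 \<or> \<sigma> (\<pi> k) \<noteq> c)}"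
proof -
  let ?T = "rec_tree \<pi> n"
  let ?C = "top_class \<pi> \<sigma> n"
  let ?A = "{k \<in> {1..n}. \<sigma> k = c \<and> (k = 1 \<or> \<sigma> (\<pi> k) \<noteq> c)}"
  have top: "k \<in> ?C k \<longleftrightarrow> k \<in> {1..n} \<and> (k = 1 \<or> \<sigma> (\<pi> k) \<noteq> \<sigma> k)" for k
  proof (cases "k \<in> {1..n} \<and> k \<noteq> 1 \<and> \<sigma> (\<pi> k) = \<sigma> k")
    case True
    then have lt: "\<pi> k < k" using \<pi> by (auto simp: recursive_parents_def)
    have le: "cluster_top \<pi> \<sigma> j \<le> j" for j
      by (induction \<pi> \<sigma> j rule: cluster_top.induct) (subst cluster_top.simps, force)
    have "cluster_top \<pi> \<sigma> k \<le> \<pi> k" using True lt le[of "\<pi> k"] by (simp add: cluster_top.simps[of _ _ k])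
    with True lt show ?thesis by (auto simp: top_class_def)
  next
    case False
    then have "cluster_top \<pi> \<sigma> k = k" if "k \<in> {1..n}"
      using that by (subst cluster_top.simps) auto
    with False show ?thesis by (auto simp: top_class_def)
  qed
  have mono: "monochromatic \<sigma> c (?T \<restriction> ?C r) \<longleftrightarrow> \<sigma> r = c" if "r \<in> ?C r" for r
    using that colour_cluster_top[of \<sigma> \<pi>] by (auto simp: monochromatic_def top_class_def)
  have "{H. is_cluster ?T \<sigma> H \<and> monochromatic \<sigma> c H} = (\<lambda>r. ?T \<restriction> ?C r) ` ?A"
    unfolding is_cluster_iff[OF \<pi>] using mono by (auto simp: top)
  moreover have "inj_on (\<lambda>r. ?T \<restriction> ?C r) ?A"
  proof (rule inj_onI)
    fix r r' assume r: "r \<in> ?A" "r' \<in> ?A" "?T \<restriction> ?C r = ?T \<restriction> ?C r'"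
    then have "?C r = ?C r'" by (metis induce_subgraph_verts)
    moreover have "r \<in> ?C r" using r by (auto simp: top)
    ultimately have "r \<in> ?C r'" by blast
    moreover have "cluster_top \<pi> \<sigma> r = r" using \<open>r \<in> ?C r\<close> by (simp add: top_class_def)
    ultimately show "r = r'" by (simp add: top_class_def)
  qed
  ultimately show ?thesis by (simp add: num_clusters_def card_image)
qed

section \<open>Characteristic functions and convergence in distribution in several dimensions\<close>

text \<open>
  These functions form an algebra that separates points, and convergence of characteristic functions
  says that their integrals converge.
\<close>

inductive trig_poly :: "('b::real_inner \<Rightarrow> real) \<Rightarrow> bool" where
  cos: "trig_poly (\<lambda>x. cos (t \<bullet> x))"
| sin: "trig_poly (\<lambda>x. sin (t \<bullet> x))"
| scale: "trig_poly f \<Longrightarrow> trig_poly (\<lambda>x. c * f x)"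
| add: "trig_poly f \<Longrightarrow> trig_poly g \<Longrightarrow> trig_poly (\<lambda>x. f x + g x)"

lemma trig_poly_const: "trig_poly (\<lambda>x. c)"
  using trig_poly.scale[OF trig_poly.cos[of 0], of c] by simp

lemma trig_poly_mult_cos: "trig_poly g \<Longrightarrow> trig_poly (\<lambda>x. cos (t \<bullet> x) * g x)"
proof (induction rule: trig_poly.induct)
  case (cos s)
  have "(\<lambda>x. cos (t \<bullet> x) * cos (s \<bullet> x)) =
      (\<lambda>x. (1/2) * cos ((t - s) \<bullet> x) + (1/2) * cos ((t + s) \<bullet> x))"
    by (rule ext) (simp add: cos_times_cos inner_diff_left inner_add_left add_divide_distrib diff_divide_distrib)
  then show ?case by (simp only: trig_poly.add[OF trig_poly.scale[OF trig_poly.cos] trig_poly.scale[OF trig_poly.cos]])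
next
  case (sin s)
  have "(\<lambda>x. cos (t \<bullet> x) * sin (s \<bullet> x)) =
      (\<lambda>x. (1/2) * sin ((t + s) \<bullet> x) + (-1/2) * sin ((t - s) \<bullet> x))"
    by (rule ext) (simp add: cos_times_sin inner_diff_left inner_add_left add_divide_distrib diff_divide_distrib)
  then show ?case by (simp only: trig_poly.add[OF trig_poly.scale[OF trig_poly.sin] trig_poly.scale[OF trig_poly.sin]])
next
  case (scale f c)
  from trig_poly.scale[OF this(2), of c] show ?case by (simp add: mult.left_commute)
next
  case (add f g)
  from trig_poly.add[OF this(3,4)] show ?case by (simp add: distrib_left)
qed

lemma trig_poly_mult_sin: "trig_poly g \<Longrightarrow> trig_poly (\<lambda>x. sin (t \<bullet> x) * g x)"
proof (induction rule: trig_poly.induct)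
  case (cos s)
  have "(\<lambda>x. sin (t \<bullet> x) * cos (s \<bullet> x)) =
      (\<lambda>x. (1/2) * sin ((t + s) \<bullet> x) + (1/2) * sin ((t - s) \<bullet> x))"
    by (rule ext) (simp add: sin_times_cos inner_diff_left inner_add_left add_divide_distrib diff_divide_distrib)
  then show ?case by (simp only: trig_poly.add[OF trig_poly.scale[OF trig_poly.sin] trig_poly.scale[OF trig_poly.sin]])
next
  case (sin s)
  have "(\<lambda>x. sin (t \<bullet> x) * sin (s \<bullet> x)) =
      (\<lambda>x. (1/2) * cos ((t - s) \<bullet> x) + (-1/2) * cos ((t + s) \<bullet> x))"
    by (rule ext) (simp add: sin_times_sin inner_diff_left inner_add_left add_divide_distrib diff_divide_distrib)
  then show ?case by (simp only: trig_poly.add[OF trig_poly.scale[OF trig_poly.cos] trig_poly.scale[OF trig_poly.cos]])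
next
  case (scale f c)
  from trig_poly.scale[OF this(2), of c] show ?case by (simp add: mult.left_commute)
next
  case (add f g)
  from trig_poly.add[OF this(3,4)] show ?case by (simp add: distrib_left)
qed

lemma trig_poly_mult: "trig_poly f \<Longrightarrow> trig_poly g \<Longrightarrow> trig_poly (\<lambda>x. f x * g x)"
proof (induction rule: trig_poly.induct)
  case (scale f c)
  from trig_poly.scale[OF scale.IH[OF scale.prems], of c] show ?case by (simp add: mult.assoc)
next
  case (add f h)
  have "trig_poly (\<lambda>x. f x * g x + h x * g x)"
    by (rule trig_poly.add[OF add.IH(1)[OF add.prems] add.IH(2)[OF add.prems]])
  then show ?case by (simp only: distrib_right)
next
  case (cos t)
  then show ?case by (rule trig_poly_mult_cos)
next
  case (sin t)
  then show ?case by (rule trig_poly_mult_sin)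
qed

lemma trig_poly_bounded: "trig_poly f \<Longrightarrow> \<exists>B. \<forall>x. \<bar>f x\<bar> \<le> B"
proof (induction rule: trig_poly.induct)
  case (scale f c)
  then obtain B where "\<forall>x. \<bar>f x\<bar> \<le> B" by blast
  then show ?case by (auto simp: abs_mult intro!: exI[of _ "\<bar>c\<bar> * B"] mult_left_mono)
next
  case (add f g)
  then obtain B B' where "\<forall>x. \<bar>f x\<bar> \<le> B" "\<forall>x. \<bar>g x\<bar> \<le> B'" by blast
  then show ?case by (auto intro!: exI[of _ "B + B'"] order_trans[OF abs_triangle_ineq] add_mono)
next
  case (cos t)
  show ?case by (rule exI[of _ 1]) simp
next
  case (sin t)
  show ?case by (rule exI[of _ 1]) simp
qed

lemma trig_poly_continuous: "trig_poly f \<Longrightarrow> continuous_on S f"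
  by (induction rule: trig_poly.induct) (auto intro!: continuous_intros)

lemma trig_poly_compose_polynomial:
  assumes "real_polynomial_function r" "trig_poly q"
  shows "trig_poly (\<lambda>x. r (q x))"
  using assms(1)
proof (induction rule: real_polynomial_function.induct)
  case (linear f)
  have "f (q x) = f 1 * q x" for x
    using linear_simps(5)[OF linear, of "q x" 1] by (simp only: real_scaleR_def mult_1_right mult.commute[of "q x" "f 1"])
  then have "(\<lambda>x. f (q x)) = (\<lambda>x. f 1 * q x)" by (rule ext)
  then show ?case by (simp only: trig_poly.scale[OF assms(2)])
next
  case (const c)
  show ?case by (rule trig_poly_const)
next
  case (add f g)
  from add.IH show ?case by (rule trig_poly.add)
next
  case (mult f g)
  from mult.IH show ?case by (rule trig_poly_mult)
qed

lemma trig_poly_separates: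
  fixes x y :: "'b::real_inner"
  assumes "x \<noteq> y"
  shows "\<exists>f. trig_poly f \<and> f x \<noteq> f y"
proof -
  define d where "d = x - y"
  have d: "d \<bullet> d > 0" using assms by (simp add: d_def)
  \<comment> \<open>At this frequency the phases of the two points differ by a quarter turn.\<close>
  let ?t = "(pi / (2 * (d \<bullet> d))) *\<^sub>R d"
  have a: "?t \<bullet> x = ?t \<bullet> y + pi / 2"
  proof -
    have "?t \<bullet> x - ?t \<bullet> y = pi / (2 * (d \<bullet> d)) * (d \<bullet> d)" by (simp add: d_def inner_diff_right right_diff_distrib)
    then show ?thesis using d by simp
  qed
  show ?thesis
  proof (rule ccontr)
    assume "\<not> ?thesis"
    then have "cos (?t \<bullet> x) = cos (?t \<bullet> y)" "sin (?t \<bullet> x) = sin (?t \<bullet> y)"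
      using trig_poly.cos[of ?t] trig_poly.sin[of ?t] by blast+
    then have "- sin (?t \<bullet> y) = cos (?t \<bullet> y)" "cos (?t \<bullet> y) = sin (?t \<bullet> y)"
      by (simp_all only: a cos_add sin_add cos_pi_half sin_pi_half)
    then show False using sin_cos_squared_add[of "?t \<bullet> y"] by auto
  qed
qed

text \<open>
  The Stone-Weierstrass theorem alone controls the approximating function only on \<open>K\<close>. The bound on
  the whole space comes from composing it with a polynomial that approximates the clipping function
  \<open>max (- B) (min B y)\<close> on its range, which keeps it in the algebra.
\<close>

lemma trig_poly_approx:
  fixes f :: "'b::euclidean_space \<Rightarrow> real"
  assumes f: "continuous_on K f" and K: "compact K" and B: "\<And>x. \<bar>f x\<bar> \<le> B" and \<delta>: "\<delta> > 0"
  obtains g where "trig_poly g" "\<And>x. x \<in> K \<Longrightarrow> \<bar>f x - g x\<bar> < \<delta>" "\<And>x. \<bar>g x\<bar> \<le> B + \<delta>"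
proof -
  interpret function_ring_on "Collect trig_poly" K
    using K trig_poly_separates
    by unfold_locales (auto intro: trig_poly_continuous trig_poly.add trig_poly_mult trig_poly_const)
  from Stone_Weierstrass_basic[OF f, of "\<delta>/2"] \<delta> obtain q
    where q: "trig_poly q" "\<And>x. x \<in> K \<Longrightarrow> \<bar>f x - q x\<bar> < \<delta>/2" by auto
  from trig_poly_bounded[OF q(1)] obtain M where M: "\<And>x. \<bar>q x\<bar> \<le> M" by blast
  define clip where "clip y = max (- B) (min B y)" for y :: real
  have "continuous_on {-M..M} clip" unfolding clip_def by (intro continuous_intros)
  from Stone_Weierstrass_real_polynomial_function[OF _ this, of "\<delta>/2"] \<delta> obtain r
    where r: "real_polynomial_function r" "\<And>y. y \<in> {-M..M} \<Longrightarrow> \<bar>clip y - r y\<bar> < \<delta>/2" by auto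
  have near: "\<bar>clip (q x) - r (q x)\<bar> < \<delta>/2" for x using r(2) M[of x] by (auto simp: abs_le_iff)
  have B0: "0 \<le> B" using B[of 0] by linarith
  show ?thesis
  proof
    show "trig_poly (\<lambda>x. r (q x))" by (rule trig_poly_compose_polynomial[OF r(1) q(1)])
    show "\<bar>f x - r (q x)\<bar> < \<delta>" if "x \<in> K" for x
    proof -
      have "\<bar>f x - clip (q x)\<bar> \<le> \<bar>f x - q x\<bar>" using B[of x] by (auto simp: clip_def)
      then show ?thesis using q(2)[OF that] near[of x] by linarith
    qed
    show "\<bar>r (q x)\<bar> \<le> B + \<delta>" for x
    proof -
      have "\<bar>clip (q x)\<bar> \<le> B" using B0 by (auto simp: clip_def)
      then show ?thesis using near[of x] by linarith
    qed
  qed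
qed

lemma (in prob_space) integrable_cont_bounded:
  fixes f :: "'b::metric_space \<Rightarrow> real"
  assumes "X \<in> borel_measurable M" "continuous_on UNIV f" "\<And>x. \<bar>f x\<bar> \<le> B"
  shows "integrable M (\<lambda>\<omega>. f (X \<omega>))"
  using assms by (intro integrable_const_bound[where B = B])
    (auto intro!: measurable_compose[OF assms(1)] borel_measurable_continuous_onI)

lemma (in prob_space) integrable_cis:
  assumes "X \<in> borel_measurable M"
  shows "integrable M (\<lambda>\<omega>. cis (X \<omega>))"
  using assms by (intro integrable_const_bound[where B = 1])
    (auto intro!: measurable_compose[OF assms] borel_measurable_continuous_onI continuous_intros)

lemma char_distr_cis:
  assumes "f \<in> borel_measurable M"
  shows "char (distr M borel f) s = (\<integral>x. cis (s * f x) \<partial>M)"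
  unfolding char_def cis_conv_exp
  by (subst integral_distr) (use assms in \<open>auto intro!: borel_measurable_continuous_onI continuous_intros\<close>)

locale cf_convergence =
  M: prob_space M + N: prob_space N
  for M :: "'a measure" and N :: "'b::euclidean_space measure" +
  fixes X :: "nat \<Rightarrow> 'a \<Rightarrow> 'b"
  assumes X [measurable]: "\<And>n. X n \<in> borel_measurable M"
    and sets_N [measurable_cong]: "sets N = sets borel"
    and cf: "\<And>t. (\<lambda>n. \<integral>\<omega>. cis (t \<bullet> X n \<omega>) \<partial>M) \<longlonglongrightarrow> (\<integral>x. cis (t \<bullet> x) \<partial>N)"
begin

lemma trig_poly_integral_tendsto:
  assumes "trig_poly f"
  shows "(\<lambda>n. \<integral>\<omega>. f (X n \<omega>) \<partial>M) \<longlonglongrightarrow> (\<integral>x. f x \<partial>N)"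
  using assms
proof (induction rule: trig_poly.induct)
  case (cos t)
  have "(\<integral>\<omega>. cos (t \<bullet> X n \<omega>) \<partial>M) = Re (\<integral>\<omega>. cis (t \<bullet> X n \<omega>) \<partial>M)" for n
    by (subst integral_Re[symmetric]) (auto intro: M.integrable_cis)
  moreover have "(\<integral>x. cos (t \<bullet> x) \<partial>N) = Re (\<integral>x. cis (t \<bullet> x) \<partial>N)"
    by (subst integral_Re[symmetric]) (auto intro: N.integrable_cis)
  ultimately show ?case using tendsto_Re[OF cf] by simp
next
  case (sin t)
  have "(\<integral>\<omega>. sin (t \<bullet> X n \<omega>) \<partial>M) = Im (\<integral>\<omega>. cis (t \<bullet> X n \<omega>) \<partial>M)" for n
    by (subst integral_Im[symmetric]) (auto intro: M.integrable_cis)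
  moreover have "(\<integral>x. sin (t \<bullet> x) \<partial>N) = Im (\<integral>x. cis (t \<bullet> x) \<partial>N)"
    by (subst integral_Im[symmetric]) (auto intro: N.integrable_cis)
  ultimately show ?case using tendsto_Im[OF cf] by simp
next
  case (scale f c)
  then show ?case by (auto intro: tendsto_intros)
next
  case (add f g)
  have "integrable M (\<lambda>\<omega>. h (X n \<omega>))" if "trig_poly h" for h n
    using trig_poly_bounded[OF that] trig_poly_continuous[OF that]
    by (auto intro: M.integrable_cont_bounded[OF X])
  moreover have "integrable N h" if "trig_poly h" for h
    using trig_poly_bounded[OF that] trig_poly_continuous[OF that] N.integrable_cont_bounded[of "\<lambda>x. x" h]
    by auto
  ultimately show ?case using add by (auto intro!: tendsto_add)
qed

lemma linear_functional_integral_tendsto: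
  fixes h :: "real \<Rightarrow> real"
  assumes h: "continuous_on UNIV h" "\<And>y. \<bar>h y\<bar> \<le> B"
  shows "(\<lambda>n. \<integral>\<omega>. h (t \<bullet> X n \<omega>) \<partial>M) \<longlonglongrightarrow> (\<integral>x. h (t \<bullet> x) \<partial>N)"
proof -
  let ?\<mu> = "\<lambda>n. distr M borel (\<lambda>\<omega>. t \<bullet> X n \<omega>)" and ?\<nu> = "distr N borel (\<lambda>x. t \<bullet> x)"
  have [measurable]: "h \<in> borel_measurable borel" using h(1) by (rule borel_measurable_continuous_onI)
  have \<mu>: "real_distribution (?\<mu> n)" for n by (intro M.real_distribution_distr) simp
  have \<nu>: "real_distribution ?\<nu>" by (intro N.real_distribution_distr) simp
  have "weak_conv_m ?\<mu> ?\<nu>"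
  proof (rule levy_continuity[OF \<mu> \<nu>])
    fix s
    show "(\<lambda>n. char (?\<mu> n) s) \<longlonglongrightarrow> char ?\<nu> s"
      using cf[of "s *\<^sub>R t"] by (subst (1 2) char_distr_cis) (auto simp: char_distr_cis)
  qed
  then have "(\<lambda>n. integral\<^sup>L (?\<mu> n) h) \<longlonglongrightarrow> integral\<^sup>L ?\<nu> h"
    using h by (intro weak_conv_imp_integral_bdd_continuous_conv[OF \<mu> \<nu>, where B = B])
      (auto simp: continuous_on_eq_continuous_at)
  then show ?thesis by (subst (asm) (1 2) integral_distr) (auto simp: integral_distr)
qed

text \<open>
  A continuous majorant, built from linear functionals, of the indicator of the complement of a box:
  the one-dimensional continuity theorem applies to it and so yields tightness.
\<close>

definition box_tail :: "real \<Rightarrow> 'b \<Rightarrow> real" where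
  "box_tail R x = (\<Sum>b\<in>Basis. min 1 (\<bar>b \<bullet> x\<bar> / R))"

lemma integrable_box_tail:
  assumes "R > 0"
  shows "integrable M (\<lambda>\<omega>. box_tail R (X n \<omega>))" "integrable N (box_tail R)"
proof -
  have b: "\<bar>min 1 (\<bar>y\<bar> / R)\<bar> \<le> 1" for y using assms by (simp add: min_def)
  show "integrable M (\<lambda>\<omega>. box_tail R (X n \<omega>))" unfolding box_tail_def
    by (intro Bochner_Integration.integrable_sum M.integrable_const_bound[where B = 1]) (use b in auto)
  show "integrable N (box_tail R)" unfolding box_tail_def
    by (intro Bochner_Integration.integrable_sum N.integrable_const_bound[where B = 1]) (use b in auto)
qed

lemma box_tail_integral_tendsto:
  assumes "R > 0"
  shows "(\<lambda>n. \<integral>\<omega>. box_tail R (X n \<omega>) \<partial>M) \<longlonglongrightarrow> (\<integral>x. box_tail R x \<partial>N)"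
proof -
  have b: "\<bar>min 1 (\<bar>y\<bar> / R)\<bar> \<le> 1" for y using assms by (simp add: min_def)
  have "(\<integral>\<omega>. box_tail R (X n \<omega>) \<partial>M) = (\<Sum>b\<in>Basis. \<integral>\<omega>. min 1 (\<bar>b \<bullet> X n \<omega>\<bar> / R) \<partial>M)" for n
    unfolding box_tail_def
    by (intro Bochner_Integration.integral_sum M.integrable_const_bound[where B = 1]) (use b in auto)
  moreover have "(\<integral>x. box_tail R x \<partial>N) = (\<Sum>b\<in>Basis. \<integral>x. min 1 (\<bar>b \<bullet> x\<bar> / R) \<partial>N)"
    unfolding box_tail_def
    by (intro Bochner_Integration.integral_sum N.integrable_const_bound[where B = 1]) (use b in auto)
  moreover have "continuous_on UNIV (\<lambda>y. min 1 (\<bar>y\<bar> / R))" using assms by (auto intro!: continuous_intros)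
  ultimately show ?thesis
    using linear_functional_integral_tendsto[of "\<lambda>y. min 1 (\<bar>y\<bar> / R)" 1] b by (auto intro!: tendsto_sum)
qed

lemma box_tail_small:
  assumes "\<epsilon> > 0"
  obtains R where "R > 0" "(\<integral>x. box_tail R x \<partial>N) < \<epsilon>"
proof -
  have "(\<lambda>k. \<integral>x. box_tail (real (Suc k)) x \<partial>N) \<longlonglongrightarrow> (\<integral>x. 0 \<partial>N)"
  proof (rule integral_dominated_convergence[where w = "\<lambda>_. real DIM('b)"])
    show "AE x in N. (\<lambda>k. box_tail (real (Suc k)) x) \<longlonglongrightarrow> 0"
    proof (rule AE_I2)
      fix x
      have "(\<lambda>k. min 1 (c / real (Suc k))) \<longlonglongrightarrow> 0" for c :: real
      proof -
        have "(\<lambda>k. min 1 (c / real (Suc k))) \<longlonglongrightarrow> min 1 0"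
          by (intro tendsto_intros LIMSEQ_Suc[OF lim_const_over_n])
        then show ?thesis by simp
      qed
      then show "(\<lambda>k. box_tail (real (Suc k)) x) \<longlonglongrightarrow> 0"
        unfolding box_tail_def by (intro tendsto_null_sum) auto
    qed
    show "AE x in N. norm (box_tail (real (Suc k)) x) \<le> real DIM('b)" for k
    proof (rule AE_I2)
      fix x
      have "norm (box_tail (real (Suc k)) x) \<le> (\<Sum>b\<in>(Basis::'b set). 1)"
        unfolding box_tail_def by (rule sum_norm_le) (simp add: min_def)
      then show "norm (box_tail (real (Suc k)) x) \<le> real DIM('b)" by simp
    qed
  qed (auto simp: box_tail_def)
  then have "(\<lambda>k. \<integral>x. box_tail (real (Suc k)) x \<partial>N) \<longlonglongrightarrow> 0" by simp
  from order_tendstoD(2)[OF this assms] obtain k where "(\<integral>x. box_tail (real (Suc k)) x \<partial>N) < \<epsilon>"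
    by (auto simp: eventually_sequentially)
  then show ?thesis by (intro that[of "real (Suc k)"]) auto
qed

lemma box_tail_ge_1:
  assumes "R > 0" "x \<notin> cbox (- R *\<^sub>R One) (R *\<^sub>R One)"
  shows "1 \<le> box_tail R x"
proof -
  obtain b where b: "b \<in> Basis" "\<not> (- R \<le> x \<bullet> b \<and> x \<bullet> b \<le> R)"
    using assms(2) by (auto simp: mem_box)
  then have b: "b \<in> Basis" "\<bar>b \<bullet> x\<bar> > R" by (auto simp: inner_commute)
  have "1 = min 1 (\<bar>b \<bullet> x\<bar> / R)" using b assms by (simp add: min_def field_simps)
  also have "\<dots> \<le> box_tail R x"
    unfolding box_tail_def using assms b(1) by (intro member_le_sum) auto
  finally show ?thesis .
qed

lemma box_tail_nonneg: "R > 0 \<Longrightarrow> 0 \<le> box_tail R x"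
  by (simp add: box_tail_def sum_nonneg)

text \<open>
  Levy's continuity theorem. A bounded continuous function is uniformly close to a trigonometric
  polynomial on a large box, and outside the box both are bounded and the mass is small.
\<close>

theorem conv_in_distr: "conv_in_distr M X N"
  unfolding conv_in_distr_def
proof (intro conjI allI impI)
  fix f :: "'b \<Rightarrow> real"
  assume "continuous_on UNIV f \<and> bounded (range f)"
  then obtain B where f: "continuous_on UNIV f" and B: "\<And>x. \<bar>f x\<bar> \<le> B"
    by (auto simp: bounded_iff)
  have B0: "0 \<le> B" using B[of 0] by linarith
  show "(\<lambda>n. \<integral>\<omega>. f (X n \<omega>) \<partial>M) \<longlonglongrightarrow> (\<integral>x. f x \<partial>N)"
  proof (rule LIMSEQ_I)
    fix \<epsilon> :: real assume \<epsilon>: "\<epsilon> > 0"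
    define \<delta> where "\<delta> = min 1 (\<epsilon> / 8)"
    have \<delta>: "0 < \<delta>" "\<delta> \<le> 1" "\<delta> \<le> \<epsilon> / 8" using \<epsilon> by (auto simp: \<delta>_def)
    define C where "C = 2 * B + 1"
    have C: "C > 0" using B0 by (simp add: C_def)
    from box_tail_small[of "\<epsilon> / (8 * C)"] \<epsilon> C obtain R
      where R: "R > 0" "(\<integral>x. box_tail R x \<partial>N) < \<epsilon> / (8 * C)" by auto
    define K :: "'b set" where "K = cbox (- R *\<^sub>R One) (R *\<^sub>R One)"
    have "continuous_on K f" using f continuous_on_subset by blast
    from trig_poly_approx[OF this _ B \<delta>(1)] obtain g
      where g: "trig_poly g" "\<And>x. x \<in> K \<Longrightarrow> \<bar>f x - g x\<bar> < \<delta>" "\<And>x. \<bar>g x\<bar> \<le> B + \<delta>"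
      unfolding K_def using compact_cbox by blast
    have fg: "\<bar>f x - g x\<bar> \<le> \<delta> + C * box_tail R x" for x
    proof (cases "x \<in> K")
      case True
      then show ?thesis using g(2)[OF True] box_tail_nonneg[OF R(1), of x] C by (smt (verit) mult_nonneg_nonneg)
    next
      case False
      have "\<bar>f x - g x\<bar> \<le> C * 1" using B[of x] g(3)[of x] \<delta> by (simp add: C_def)
      also have "\<dots> \<le> C * box_tail R x"
        using box_tail_ge_1[OF R(1)] False C by (intro mult_left_mono) (auto simp: K_def)
      finally show ?thesis using \<delta> by simp
    qed
    have int_f: "integrable M (\<lambda>\<omega>. f (X n \<omega>))" for n by (rule M.integrable_cont_bounded[OF X f B])
    have int_g: "integrable M (\<lambda>\<omega>. g (X n \<omega>))" for n
      by (rule M.integrable_cont_bounded[OF X trig_poly_continuous[OF g(1)] g(3)])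
    have int_fN: "integrable N f" using N.integrable_cont_bounded[OF _ f B, of "\<lambda>x. x"] by simp
    have int_gN: "integrable N g"
      using N.integrable_cont_bounded[OF _ trig_poly_continuous[OF g(1)] g(3), of "\<lambda>x. x"] by simp
    have 1: "\<bar>(\<integral>\<omega>. f (X n \<omega>) \<partial>M) - (\<integral>\<omega>. g (X n \<omega>) \<partial>M)\<bar> \<le> \<delta> + C * (\<integral>\<omega>. box_tail R (X n \<omega>) \<partial>M)" for n
    proof -
      have "\<bar>(\<integral>\<omega>. f (X n \<omega>) \<partial>M) - (\<integral>\<omega>. g (X n \<omega>) \<partial>M)\<bar> = \<bar>\<integral>\<omega>. f (X n \<omega>) - g (X n \<omega>) \<partial>M\<bar>"
        using int_f int_g by (subst Bochner_Integration.integral_diff) auto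
      also have "\<dots> \<le> (\<integral>\<omega>. \<delta> + C * box_tail R (X n \<omega>) \<partial>M)"
        using fg by (intro order_trans[OF integral_abs_bound] integral_mono Bochner_Integration.integrable_add
            Bochner_Integration.integrable_diff integrable_abs integrable_mult_right
            int_f int_g integrable_box_tail[OF R(1)]) auto
      also have "\<dots> = \<delta> + C * (\<integral>\<omega>. box_tail R (X n \<omega>) \<partial>M)"
        using integrable_box_tail[OF R(1)] by (simp add: M.prob_space)
      finally show ?thesis .
    qed
    have 2: "\<bar>(\<integral>x. f x \<partial>N) - (\<integral>x. g x \<partial>N)\<bar> \<le> \<delta> + C * (\<integral>x. box_tail R x \<partial>N)"
    proof -
      have "\<bar>(\<integral>x. f x \<partial>N) - (\<integral>x. g x \<partial>N)\<bar> = \<bar>\<integral>x. f x - g x \<partial>N\<bar>"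
        using int_fN int_gN by simp
      also have "\<dots> \<le> (\<integral>x. \<delta> + C * box_tail R x \<partial>N)"
        using fg by (intro order_trans[OF integral_abs_bound] integral_mono Bochner_Integration.integrable_add
            Bochner_Integration.integrable_diff integrable_abs integrable_mult_right
            int_fN int_gN integrable_box_tail[OF R(1)]) auto
      also have "\<dots> = \<delta> + C * (\<integral>x. box_tail R x \<partial>N)"
        using integrable_box_tail[OF R(1)] by (simp add: N.prob_space)
      finally show ?thesis .
    qed
    have "eventually (\<lambda>n. \<bar>(\<integral>\<omega>. g (X n \<omega>) \<partial>M) - (\<integral>x. g x \<partial>N)\<bar> < \<epsilon> / 4) sequentially"
      using tendstoD[OF trig_poly_integral_tendsto[OF g(1)], of "\<epsilon>/4"] \<epsilon> by (simp add: dist_real_def)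
    moreover have "eventually (\<lambda>n. (\<integral>\<omega>. box_tail R (X n \<omega>) \<partial>M) < \<epsilon> / (8 * C)) sequentially"
      by (rule order_tendstoD(2)[OF box_tail_integral_tendsto[OF R(1)] R(2)])
    ultimately have "eventually (\<lambda>n. norm ((\<integral>\<omega>. f (X n \<omega>) \<partial>M) - (\<integral>x. f x \<partial>N)) < \<epsilon>) sequentially"
    proof eventually_elim
      case (elim n)
      have "C * (\<integral>\<omega>. box_tail R (X n \<omega>) \<partial>M) < \<epsilon> / 8" "C * (\<integral>x. box_tail R x \<partial>N) < \<epsilon> / 8"
        using elim(2) R(2) C by (simp_all add: field_simps)
      then show ?case using 1[of n] 2 elim(1) \<delta> unfolding real_norm_def by linarith
    qed
    then show "\<exists>no. \<forall>n\<ge>no. norm ((\<integral>\<omega>. f (X n \<omega>) \<partial>M) - (\<integral>x. f x \<partial>N)) < \<epsilon>"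
      by (simp add: eventually_sequentially)
  qed
qed (auto simp: sets_N N.prob_space_axioms)

end

section \<open>Centred normal laws\<close>

lemma prob_space_std_normal: "prob_space std_normal_distribution"
  using real_dist_normal_dist by (simp add: real_distribution_def)

lemma normal_law_eq_distr:
  assumes "v \<ge> 0"
  shows "normal_law v = distr std_normal_distribution borel (\<lambda>x. sqrt v * x)"
proof (cases "v = 0")
  case True
  then show ?thesis
    using prob_space.distr_const[OF prob_space_std_normal, of "0 :: real" borel] by (simp add: normal_law_def)
next
  case False
  interpret prob_space std_normal_distribution by (rule prob_space_std_normal)
  have "distributed std_normal_distribution lborel (\<lambda>x. x) std_normal_density"
    unfolding distributed_def by (auto simp: distr_id2)
  from normal_density_affine[OF this, of "sqrt v" 0] False assms
  have "distributed std_normal_distribution lborel (\<lambda>x. sqrt v * x) (normal_density 0 (sqrt v))"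
    by simp
  then have "distr std_normal_distribution lborel (\<lambda>x. sqrt v * x) = density lborel (normal_density 0 (sqrt v))"
    by (simp add: distributed_def)
  moreover have "distr std_normal_distribution lborel (\<lambda>x. sqrt v * x) = distr std_normal_distribution borel (\<lambda>x. sqrt v * x)"
    by (rule distr_cong) auto
  ultimately show ?thesis using False by (simp add: normal_law_def)
qed

lemma cf_std_normal: "(\<integral>x. cis (s * x) \<partial>std_normal_distribution) = of_real (exp (- s\<^sup>2 / 2))"
  using char_std_normal_distribution by (simp add: char_def cis_conv_exp fun_eq_iff)

lemma char_normal_law:
  assumes "v \<ge> 0"
  shows "char (normal_law v) s = of_real (exp (- v * s\<^sup>2 / 2))"
  using cf_std_normal[of "s * sqrt v"] assms
  by (simp add: normal_law_eq_distr char_distr_cis power_mult_distrib ac_simps)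

lemma real_distribution_normal_law:
  assumes "v \<ge> 0"
  shows "real_distribution (normal_law v)"
  unfolding normal_law_eq_distr[OF assms]
  by (intro prob_space.real_distribution_distr prob_space_std_normal) simp

lemma centred_normal_cf:
  assumes "centred_normal S N"
  shows "(\<integral>x. cis (t \<bullet> x) \<partial>N) = of_real (exp (- (t \<bullet> (S *v t)) / 2))"
proof -
  let ?v = "t \<bullet> (S *v t)"
  have [measurable_cong]: "sets N = sets borel" and v: "?v \<ge> 0"
    and d: "distr N borel (\<lambda>x. t \<bullet> x) = normal_law ?v"
    using assms by (auto simp: centred_normal_def)
  have "(\<integral>x. cis (t \<bullet> x) \<partial>N) = char (distr N borel (\<lambda>x. t \<bullet> x)) 1"
    by (subst char_distr_cis) auto
  then show ?thesis by (simp add: d char_normal_law[OF v])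
qed

lemma inner_real2: "(x :: real^2) \<bullet> y = x $ 1 * y $ 1 + x $ 2 * y $ 2"
  by (simp add: inner_vec_def sum_2)

lemma borel_measurable_vector2:
  fixes f g :: "'a \<Rightarrow> real"
  assumes [measurable]: "f \<in> borel_measurable M" "g \<in> borel_measurable M"
  shows "(\<lambda>x. vector [f x, g x] :: real^2) \<in> borel_measurable M"
proof -
  have "(\<lambda>x. vector [f x, g x] :: real^2) = (\<lambda>x. f x *\<^sub>R vector [1, 0] + g x *\<^sub>R vector [0, 1])"
    by (auto simp: vec_eq_iff forall_2)
  then show ?thesis by simp
qed

text \<open>
  The law of \<open>((K + L) / 2, (K - L) / 2)\<close> for independent centred normal variables \<open>K\<close> and \<open>L\<close>
  with variances \<open>k\<close> and \<open>l\<close>. Every limit covariance below has this form, because the total number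
  of clusters and the difference between the numbers of red and blue clusters are asymptotically
  independent.
\<close>

lemma centred_normal_plane:
  assumes kl: "k \<ge> 0" "l \<ge> 0"
  shows "\<exists>N. centred_normal
    (vector [vector [(k + l) / 4, (k - l) / 4], vector [(k - l) / 4, (k + l) / 4]] :: real^2^2) N"
proof -
  let ?S = "vector [vector [(k + l) / 4, (k - l) / 4], vector [(k - l) / 4, (k + l) / 4]] :: real^2^2"
  let ?G = "std_normal_distribution"
  interpret G: prob_space ?G by (rule prob_space_std_normal)
  interpret P: pair_prob_space ?G ?G ..
  define T where "T z = (vector [(sqrt k * fst z + sqrt l * snd z) / 2, (sqrt k * fst z - sqrt l * snd z) / 2] :: real^2)"
    for z :: "real \<times> real"
  have T [measurable]: "T \<in> borel_measurable (?G \<Otimes>\<^sub>M ?G)"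
    unfolding T_def[abs_def] by (intro borel_measurable_vector2) measurable
  let ?N = "distr (?G \<Otimes>\<^sub>M ?G) borel T"
  interpret N: prob_space ?N by (rule P.prob_space_distr) measurable
  have quad: "t \<bullet> (?S *v t) = k * ((t $ 1 + t $ 2) / 2)\<^sup>2 + l * ((t $ 1 - t $ 2) / 2)\<^sup>2" for t
    by (simp add: inner_real2 matrix_vector_mult_def sum_2 power2_eq_square field_simps)
  have nonneg: "0 \<le> t \<bullet> (?S *v t)" for t unfolding quad using kl by simp
  have law: "distr ?N borel (\<lambda>x. t \<bullet> x) = normal_law (t \<bullet> (?S *v t))" for t
  proof (rule Levy_uniqueness)
    show "real_distribution (distr ?N borel (\<lambda>x. t \<bullet> x))"
      by (rule N.real_distribution_distr) measurable
    show "real_distribution (normal_law (t \<bullet> (?S *v t)))"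
      by (rule real_distribution_normal_law[OF nonneg])
    show "char (distr ?N borel (\<lambda>x. t \<bullet> x)) = char (normal_law (t \<bullet> (?S *v t)))"
    proof
      fix s
      let ?a = "s * (sqrt k * (t $ 1 + t $ 2) / 2)" and ?b = "s * (sqrt l * (t $ 1 - t $ 2) / 2)"
      have [measurable]: "cis \<in> borel_measurable borel"
        by (intro borel_measurable_continuous_onI continuous_intros)
      have lin: "s * (t \<bullet> T z) = ?a * fst z + ?b * snd z" for z
        by (simp add: T_def inner_real2 field_simps)
      have "char (distr ?N borel (\<lambda>x. t \<bullet> x)) s = (\<integral>z. cis (s * (t \<bullet> T z)) \<partial>(?G \<Otimes>\<^sub>M ?G))"
        by (subst char_distr_cis) (auto simp: integral_distr)
      also have "\<dots> = (\<integral>z. (\<lambda>(x, y). cis (?a * x) * cis (?b * y)) z \<partial>(?G \<Otimes>\<^sub>M ?G))"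
        unfolding lin by (auto simp: cis_mult intro!: Bochner_Integration.integral_cong)
      also have "\<dots> = (\<integral>x. (\<integral>y. cis (?a * x) * cis (?b * y) \<partial>?G) \<partial>?G)"
        by (rule P.integral_fst[symmetric], rule P.integrable_const_bound[where B = 1])
          (auto simp: norm_mult split_beta)
      also have "\<dots> = of_real (exp (- ?a\<^sup>2 / 2)) * of_real (exp (- ?b\<^sup>2 / 2))"
        by (simp only: cf_std_normal integral_mult_right_zero integral_mult_left_zero)
      also have "\<dots> = of_real (exp (- ?a\<^sup>2 / 2 + - ?b\<^sup>2 / 2))"
        by (simp only: exp_add of_real_mult)
      also have "- ?a\<^sup>2 / 2 + - ?b\<^sup>2 / 2 = - (t \<bullet> (?S *v t)) * s\<^sup>2 / 2"
      proof -
        have "?a\<^sup>2 = s\<^sup>2 * (k * ((t $ 1 + t $ 2) / 2)\<^sup>2)" "?b\<^sup>2 = s\<^sup>2 * (l * ((t $ 1 - t $ 2) / 2)\<^sup>2)"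
          using kl by (simp_all add: power_mult_distrib power_divide)
        then show ?thesis unfolding quad by (simp only:) (simp add: algebra_simps)
      qed
      also have "of_real (exp \<dots>) = char (normal_law (t \<bullet> (?S *v t))) s"
        by (rule char_normal_law[OF nonneg, symmetric])
      finally show "char (distr ?N borel (\<lambda>x. t \<bullet> x)) s = char (normal_law (t \<bullet> (?S *v t))) s" .
    qed
  qed
  have "transpose ?S = ?S" by (simp add: transpose_def vec_eq_iff forall_2)
  then have "centred_normal ?S ?N"
    unfolding centred_normal_def using law nonneg N.prob_space_axioms by simp
  then show ?thesis by blast
qed

section \<open>The weights of the attachment step\<close>

definition total_weight :: "real \<Rightarrow> nat \<Rightarrow> real" where
  "total_weight \<alpha> n = (1 + \<alpha>) * real n - \<alpha>"

definition colour_sign :: "colour \<Rightarrow> real" where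
  "colour_sign c = (if c = Red then 1 else - 1)"

lemma colour_sign_cases: "colour_sign c = 1 \<or> colour_sign c = - 1"
  by (simp add: colour_sign_def)

lemma out_degree_rec_tree: "out_degree (rec_tree \<pi> n) v = card {k \<in> {2..n}. \<pi> k = v}"
proof -
  have "out_arcs (rec_tree \<pi> n) v = (\<lambda>k. (\<pi> k, k)) ` {k \<in> {2..n}. \<pi> k = v}"
    by (auto simp: out_arcs_def)
  then show ?thesis by (simp add: out_degree_def card_image inj_on_def)
qed

lemma attach_weight_Suc:
  assumes "n \<ge> 1"
  shows "attach_weight \<alpha> (rec_tree \<pi> (Suc n)) v =
    attach_weight \<alpha> (rec_tree \<pi> n) v + (if \<pi> (Suc n) = v then \<alpha> else 0)"
proof -
  have "{k \<in> {2..Suc n}. \<pi> k = v} = {k \<in> {2..n}. \<pi> k = v} \<union> (if \<pi> (Suc n) = v then {Suc n} else {})"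
    using assms by (auto simp: le_Suc_eq)
  then have "out_degree (rec_tree \<pi> (Suc n)) v =
      out_degree (rec_tree \<pi> n) v + (if \<pi> (Suc n) = v then 1 else 0)"
    by (simp add: out_degree_rec_tree)
  then show ?thesis by (simp add: attach_weight_def algebra_simps)
qed

lemma attach_weight_new_leaf:
  assumes "recursive_parents \<pi> n" "n \<le> v"
  shows "attach_weight \<alpha> (rec_tree \<pi> n) v = 1"
proof -
  have "\<pi> k < v" if "k \<in> {2..n}" for k
    using assms(2) bspec[OF assms(1)[unfolded recursive_parents_def] that] that by auto
  then have "{k \<in> {2..n}. \<pi> k = v} = {}" by blast
  then show ?thesis by (simp add: attach_weight_def out_degree_rec_tree)
qed

text \<open>
  Adding a vertex changes a weighted sum over the vertices in two places: the new vertex contributes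
  weight 1, and its parent gains \<open>\<alpha>\<close>.
\<close>

lemma weighted_sum_Suc:
  assumes \<pi>: "recursive_parents \<pi> (Suc n)" and n: "n \<ge> 1"
  shows "(\<Sum>v\<in>{1..Suc n}. f v * attach_weight \<alpha> (rec_tree \<pi> (Suc n)) v) =
    (\<Sum>v\<in>{1..n}. f v * attach_weight \<alpha> (rec_tree \<pi> n) v) + \<alpha> * f (\<pi> (Suc n)) + f (Suc n)"
proof -
  have "\<pi> (Suc n) \<in> {1..<Suc n}"
    by (rule bspec[OF \<pi>[unfolded recursive_parents_def]]) (use n in simp)
  then have par: "\<pi> (Suc n) \<in> {1..n}" by auto
  have "(\<Sum>v\<in>{1..Suc n}. f v * attach_weight \<alpha> (rec_tree \<pi> (Suc n)) v) =
      (\<Sum>v\<in>{1..n}. f v * attach_weight \<alpha> (rec_tree \<pi> (Suc n)) v) + f (Suc n)"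
    using attach_weight_new_leaf[OF \<pi>, of "Suc n"] n by simp
  also have "(\<Sum>v\<in>{1..n}. f v * attach_weight \<alpha> (rec_tree \<pi> (Suc n)) v) =
      (\<Sum>v\<in>{1..n}. f v * attach_weight \<alpha> (rec_tree \<pi> n) v + (if \<pi> (Suc n) = v then f v * \<alpha> else 0))"
    using n by (intro sum.cong) (auto simp: attach_weight_Suc algebra_simps)
  also have "\<dots> = (\<Sum>v\<in>{1..n}. f v * attach_weight \<alpha> (rec_tree \<pi> n) v) + \<alpha> * f (\<pi> (Suc n))"
    using par by (simp add: sum.distrib)
  finally show ?thesis by simp
qed

lemma recursive_parents_mono: "recursive_parents \<pi> n \<Longrightarrow> m \<le> n \<Longrightarrow> recursive_parents \<pi> m"
  by (auto simp: recursive_parents_def)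

lemma sum_attach_weight:
  assumes "n \<ge> 1" "recursive_parents \<pi> n"
  shows "(\<Sum>v\<in>{1..n}. attach_weight \<alpha> (rec_tree \<pi> n) v) = total_weight \<alpha> n"
  using assms
proof (induction n rule: nat_induct_at_least)
  case base
  then show ?case by (simp add: attach_weight_new_leaf total_weight_def)
next
  case (Suc n)
  then show ?case
    using weighted_sum_Suc[of \<pi> n "\<lambda>_. 1" \<alpha>] recursive_parents_mono[of \<pi> "Suc n" n]
    by (simp add: total_weight_def algebra_simps)
qed

section \<open>The process of parent signs and colour flips\<close>

context pa_broadcast
begin

abbreviation tree_at :: "nat \<Rightarrow> 'a \<Rightarrow> (nat, nat \<times> nat) pre_digraph" where
  "tree_at n \<omega> \<equiv> rec_tree (\<lambda>k. par k \<omega>) n"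

lemma recursive_par: "\<omega> \<in> space M \<Longrightarrow> recursive_parents (\<lambda>k. par k \<omega>) n"
  using par_range by (auto simp: recursive_parents_def)

definition parent_sign :: "nat \<Rightarrow> 'a \<Rightarrow> real" where
  "parent_sign n \<omega> = colour_sign (col (par (Suc n) \<omega>) \<omega>)"

definition flip :: "nat \<Rightarrow> 'a \<Rightarrow> real" where
  "flip n \<omega> = of_bool (col (Suc n) \<omega> \<noteq> col (par (Suc n) \<omega>) \<omega>)"

text \<open>
  The value starts from the sign of the root. The weight imbalance is \<open>walk (1 + \<alpha>) (- 2)\<close>, the
  difference between the numbers of red and blue clusters is \<open>walk 0 (- 1)\<close>, and the difference between
  the numbers of red and blue vertices is \<open>walk 1 (- 2)\<close>.
\<close>

definition walk :: "real \<Rightarrow> real \<Rightarrow> nat \<Rightarrow> 'a \<Rightarrow> real" where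
  "walk u v n \<omega> = root_sign col \<omega> + (\<Sum>j\<in>{1..<n}. parent_sign j \<omega> * (u + v * flip j \<omega>))"

lemma walk_1 [simp]: "walk u v (Suc 0) \<omega> = root_sign col \<omega>"
  by (simp add: walk_def)

lemma walk_Suc: "n \<ge> 1 \<Longrightarrow>
  walk u v (Suc n) \<omega> = walk u v n \<omega> + parent_sign n \<omega> * (u + v * flip n \<omega>)"
  by (simp add: walk_def)

abbreviation imbalance :: "nat \<Rightarrow> 'a \<Rightarrow> real" where
  "imbalance \<equiv> walk (1 + \<alpha>) (- 2)"

definition drift :: "nat \<Rightarrow> 'a \<Rightarrow> real" where
  "drift n \<omega> = imbalance n \<omega> / total_weight \<alpha> n"

lemma parent_sign_cases: "parent_sign n \<omega> = 1 \<or> parent_sign n \<omega> = - 1"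
  by (simp add: parent_sign_def colour_sign_cases)

lemma flip_cases: "flip n \<omega> = 0 \<or> flip n \<omega> = 1"
  by (simp add: flip_def)

lemma colour_sign_child: "colour_sign (col (Suc n) \<omega>) = parent_sign n \<omega> * (1 - 2 * flip n \<omega>)"
  by (cases "col (Suc n) \<omega>"; cases "col (par (Suc n) \<omega>) \<omega>")
    (auto simp: colour_sign_def parent_sign_def flip_def)

lemma root_sign_eq: "root_sign col \<omega> = colour_sign (col 1 \<omega>)"
  by (simp add: root_sign_def colour_sign_def)

text \<open>
  A step adds to the signed total weight \<open>\<alpha>\<close> times the sign \<open>s\<close> of the parent and the sign of the child,
  which is \<open>s\<close> without a flip and \<open>- s\<close> with one.
\<close>

lemma imbalance_eq:
  assumes "\<omega> \<in> space M" "n \<ge> 1"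
  shows "imbalance n \<omega> = (\<Sum>v\<in>{1..n}. colour_sign (col v \<omega>) * attach_weight \<alpha> (tree_at n \<omega>) v)"
  using assms(2)
proof (induction n rule: nat_induct_at_least)
  case base
  show ?case
    using attach_weight_new_leaf[OF recursive_par[OF assms(1)], of 1 1 \<alpha>] by (simp add: root_sign_eq)
next
  case (Suc n)
  have "(\<Sum>v\<in>{1..Suc n}. colour_sign (col v \<omega>) * attach_weight \<alpha> (tree_at (Suc n) \<omega>) v) =
      imbalance n \<omega> + \<alpha> * parent_sign n \<omega> + colour_sign (col (Suc n) \<omega>)"
    using weighted_sum_Suc[OF recursive_par[OF assms(1)] Suc.hyps, of "\<lambda>v. colour_sign (col v \<omega>)" \<alpha>]
    by (simp add: Suc.IH parent_sign_def)
  then show ?case using Suc.hyps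
    by (simp add: walk_Suc colour_sign_child algebra_simps)
qed

subsection \<open>Functions of the past\<close>

text \<open>
  A function of the coloured tree with \<open>n\<close> vertices takes finitely many values, so all conditional
  expectations reduce to finite sums over histories and no sigma-algebras are needed.
\<close>

definition same_history :: "nat \<Rightarrow> 'a \<Rightarrow> 'a \<Rightarrow> bool" where
  "same_history n \<omega> \<omega>' \<longleftrightarrow>
     (\<forall>k\<in>{2..n}. par k \<omega> = par k \<omega>') \<and> (\<forall>k\<in>{1..n}. col k \<omega> = col k \<omega>')"

definition adapted :: "nat \<Rightarrow> ('a \<Rightarrow> 'c) \<Rightarrow> bool" where
  "adapted n F \<longleftrightarrow> (\<forall>\<omega>\<in>space M. \<forall>\<omega>'\<in>space M. same_history n \<omega> \<omega>' \<longrightarrow> F \<omega> = F \<omega>')"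

lemma adaptedI:
  "(\<And>\<omega> \<omega>'. \<omega> \<in> space M \<Longrightarrow> \<omega>' \<in> space M \<Longrightarrow> same_history n \<omega> \<omega>' \<Longrightarrow> F \<omega> = F \<omega>') \<Longrightarrow> adapted n F"
  by (simp add: adapted_def)

lemma adaptedD:
  "adapted n F \<Longrightarrow> \<omega> \<in> space M \<Longrightarrow> \<omega>' \<in> space M \<Longrightarrow> same_history n \<omega> \<omega>' \<Longrightarrow> F \<omega> = F \<omega>'"
  by (simp add: adapted_def)

lemma adapted_mono:
  assumes "adapted m F" "m \<le> n"
  shows "adapted n F"
proof (rule adaptedI)
  fix \<omega> \<omega>' assume "\<omega> \<in> space M" "\<omega>' \<in> space M" "same_history n \<omega> \<omega>'"
  moreover from this(3) assms(2) have "same_history m \<omega> \<omega>'" by (auto simp: same_history_def)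
  ultimately show "F \<omega> = F \<omega>'" using assms(1) by (blast dest: adaptedD)
qed

lemma adapted_const [simp]: "adapted n (\<lambda>_. c)"
  by (rule adaptedI) simp

lemma adapted_comp:
  assumes "adapted n F"
  shows "adapted n (\<lambda>\<omega>. h (F \<omega>))"
  by (rule adaptedI, rule arg_cong[where f = h], rule adaptedD[OF assms])

lemma adapted_comp2:
  assumes "adapted n F" "adapted n G"
  shows "adapted n (\<lambda>\<omega>. h (F \<omega>) (G \<omega>))"
  by (rule adaptedI, rule arg_cong2[where f = h]; rule adaptedD[OF assms(1)] adaptedD[OF assms(2)])

lemma adapted_sum:
  assumes "\<And>i. i \<in> I \<Longrightarrow> adapted n (F i)"
  shows "adapted n (\<lambda>\<omega>. \<Sum>i\<in>I. F i \<omega>)"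
  by (rule adaptedI, rule sum.cong[OF refl], rule adaptedD[OF assms])

lemma adapted_col_par:
  assumes "k \<in> {2..n}"
  shows "adapted n (\<lambda>\<omega>. col (par k \<omega>) \<omega>)"
proof (rule adaptedI)
  fix \<omega> \<omega>' assume *: "\<omega> \<in> space M" "\<omega>' \<in> space M" "same_history n \<omega> \<omega>'"
  have "par k \<omega> = par k \<omega>'" using *(3) assms by (simp add: same_history_def)
  moreover have "par k \<omega>' \<in> {1..n}" using par_range[of k \<omega>'] *(2) assms by auto
  ultimately show "col (par k \<omega>) \<omega> = col (par k \<omega>') \<omega>'" using *(3) by (simp add: same_history_def)
qed

lemma adapted_parent_sign: "1 \<le> j \<Longrightarrow> j < n \<Longrightarrow> adapted n (parent_sign j)"
  unfolding parent_sign_def[abs_def]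
  by (rule adapted_comp[of n _ colour_sign], rule adapted_col_par) auto

lemma adapted_flip: "1 \<le> j \<Longrightarrow> j < n \<Longrightarrow> adapted n (flip j)"
proof -
  assume j: "1 \<le> j" "j < n"
  have "adapted n (col (Suc j))" using j by (auto simp: adapted_def same_history_def)
  moreover have "adapted n (\<lambda>\<omega>. col (par (Suc j) \<omega>) \<omega>)" using j by (intro adapted_col_par) auto
  ultimately show ?thesis unfolding flip_def[abs_def] by (rule adapted_comp2[where h = "\<lambda>a b. of_bool (a \<noteq> b)"])
qed

lemma adapted_root_sign: "1 \<le> n \<Longrightarrow> adapted n (root_sign col)"
  by (auto simp: adapted_def same_history_def root_sign_def)

lemma adapted_walk: "1 \<le> n \<Longrightarrow> adapted n (walk u v n)"
  unfolding walk_def[abs_def]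
  by (intro adapted_comp2[where h = "(+)"] adapted_comp2[where h = "(*)"] adapted_sum adapted_const
      adapted_root_sign adapted_parent_sign adapted_flip) auto

lemma adapted_drift: "1 \<le> n \<Longrightarrow> adapted n (drift n)"
  unfolding drift_def[abs_def] by (rule adapted_comp[OF adapted_walk])

definition hist :: "nat \<Rightarrow> 'a \<Rightarrow> (nat \<Rightarrow> nat) \<times> (nat \<Rightarrow> colour)" where
  "hist n \<omega> = (restrict (\<lambda>k. par k \<omega>) {2..n}, restrict (\<lambda>k. col k \<omega>) {1..n})"

definition hists :: "nat \<Rightarrow> ((nat \<Rightarrow> nat) \<times> (nat \<Rightarrow> colour)) set" where
  "hists n = PiE {2..n} (\<lambda>k. {1..<k}) \<times> PiE {1..n} (\<lambda>_. UNIV)"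

lemma UNIV_colour: "UNIV = {Red, Blue}"
  using colour.exhaust by blast

lemma finite_UNIV_colour: "finite (UNIV :: colour set)"
  by (simp add: UNIV_colour)

lemma finite_hists: "finite (hists n)"
  unfolding hists_def by (intro finite_cartesian_product finite_PiE finite_UNIV_colour) auto

lemma hist_in_hists: "\<omega> \<in> space M \<Longrightarrow> hist n \<omega> \<in> hists n"
  using par_range by (auto simp: hist_def hists_def PiE_iff)

lemma restrict_eq_restrict_iff: "restrict f A = restrict g A \<longleftrightarrow> (\<forall>k\<in>A. f k = g k)"
  by (metis restrict_apply' restrict_ext)

lemma same_history_iff_hist: "same_history n \<omega> \<omega>' \<longleftrightarrow> hist n \<omega> = hist n \<omega>'"
  by (simp add: same_history_def hist_def restrict_eq_restrict_iff)

lemma history_eq_hist: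
  assumes "h \<in> hists n"
  shows "history M par col n (fst h) (snd h) = {\<omega> \<in> space M. hist n \<omega> = h}"
proof -
  have h: "h = (restrict (fst h) {2..n}, restrict (snd h) {1..n})"
    using assms by (auto simp: hists_def PiE_restrict)
  have "hist n \<omega> = h \<longleftrightarrow> (\<forall>k\<in>{2..n}. par k \<omega> = fst h k) \<and> (\<forall>k\<in>{1..n}. col k \<omega> = snd h k)" for \<omega>
    by (subst h) (simp add: hist_def restrict_eq_restrict_iff)
  then show ?thesis by (simp add: history_def)
qed

lemma history_sets [measurable]: "history M par col n \<pi> \<kappa> \<in> sets M"
proof -
  have [measurable]: "{\<omega> \<in> space M. par k \<omega> = i} \<in> sets M" if "k \<in> {2..n}" for k i
    using measurable_sets[OF measurable_par, of k "{i}"] that by (simp add: vimage_def Int_def conj_commute)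
  have [measurable]: "{\<omega> \<in> space M. col k \<omega> = c} \<in> sets M" if "k \<in> {1..n}" for k c
    using measurable_sets[OF measurable_col, of k "{c}"] that by (simp add: vimage_def Int_def conj_commute)
  show ?thesis unfolding history_def
    by (intro sets.sets_Collect_conj sets.sets_Collect_finite_All) auto
qed

lemma hist_measurable: "hist n \<in> measurable M (count_space (hists n))"
proof (subst measurable_count_space_eq2[OF finite_hists], intro conjI ballI)
  show "hist n \<in> space M \<rightarrow> hists n" using hist_in_hists by auto
  fix h assume "h \<in> hists n"
  then have "hist n -` {h} \<inter> space M = history M par col n (fst h) (snd h)"
    by (auto simp: history_eq_hist)
  then show "hist n -` {h} \<inter> space M \<in> sets M" by simp
qed

lemma adapted_factor:
  assumes "adapted n F"
  obtains \<Phi> where "\<And>\<omega>. \<omega> \<in> space M \<Longrightarrow> F \<omega> = \<Phi> (hist n \<omega>)"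
proof
  fix \<omega> assume \<omega>: "\<omega> \<in> space M"
  let ?\<omega>' = "SOME \<omega>'. \<omega>' \<in> space M \<and> hist n \<omega>' = hist n \<omega>"
  have "?\<omega>' \<in> space M \<and> hist n ?\<omega>' = hist n \<omega>"
    by (rule someI[of _ \<omega>]) (simp add: \<omega>)
  then show "F \<omega> = (\<lambda>h. F (SOME \<omega>'. \<omega>' \<in> space M \<and> hist n \<omega>' = h)) (hist n \<omega>)"
    using \<omega> by (intro adaptedD[OF assms]) (simp_all add: same_history_iff_hist)
qed

lemma adapted_measurable:
  assumes "adapted n F"
  shows "F \<in> borel_measurable M"
proof -
  obtain \<Phi> where "\<And>\<omega>. \<omega> \<in> space M \<Longrightarrow> F \<omega> = \<Phi> (hist n \<omega>)"
    using adapted_factor[OF assms] by blast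
  then have "F \<in> borel_measurable M \<longleftrightarrow> (\<lambda>\<omega>. \<Phi> (hist n \<omega>)) \<in> borel_measurable M"
    by (rule measurable_cong)
  moreover have "(\<lambda>\<omega>. \<Phi> (hist n \<omega>)) \<in> borel_measurable M"
    by (rule measurable_compose[OF hist_measurable]) simp
  ultimately show ?thesis by simp
qed

lemma adapted_bounded:
  fixes F :: "'a \<Rightarrow> 'c::real_normed_vector"
  assumes "adapted n F"
  obtains B where "\<And>\<omega>. \<omega> \<in> space M \<Longrightarrow> norm (F \<omega>) \<le> B"
proof -
  obtain \<Phi> where "\<And>\<omega>. \<omega> \<in> space M \<Longrightarrow> F \<omega> = \<Phi> (hist n \<omega>)"
    using adapted_factor[OF assms] by blast
  then have "F ` space M \<subseteq> \<Phi> ` hists n" using hist_in_hists by auto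
  then have "bounded (F ` space M)"
    by (rule finite_imp_bounded[OF finite_subset[OF _ finite_imageI[OF finite_hists]]])
  then obtain B where "\<forall>x\<in>F ` space M. norm x \<le> B" unfolding bounded_iff by blast
  then show ?thesis by (intro that[of B]) blast
qed

lemma integrable_adapted:
  fixes F :: "'a \<Rightarrow> 'c::{banach, second_countable_topology}"
  assumes "adapted n F"
  shows "integrable M F"
proof -
  obtain B where "\<And>\<omega>. \<omega> \<in> space M \<Longrightarrow> norm (F \<omega>) \<le> B" using adapted_bounded[OF assms] by blast
  then show ?thesis by (intro integrable_const_bound[where B = B] adapted_measurable[OF assms]) auto
qed

lemma integral_by_hist:
  fixes F :: "'a \<Rightarrow> 'c::{banach, second_countable_topology}"
  assumes "adapted n F"
    and rep: "\<And>h \<omega>. h \<in> hists n \<Longrightarrow> \<omega> \<in> space M \<Longrightarrow> hist n \<omega> = h \<Longrightarrow> F \<omega> = \<Phi> h"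
  shows "(\<integral>\<omega>. F \<omega> \<partial>M) = (\<Sum>h\<in>hists n. prob (history M par col n (fst h) (snd h)) *\<^sub>R \<Phi> h)"
proof -
  have "(\<integral>\<omega>. F \<omega> \<partial>M) = (\<integral>\<omega>. (\<Sum>h\<in>hists n. indicator (history M par col n (fst h) (snd h)) \<omega> *\<^sub>R \<Phi> h) \<partial>M)"
  proof (rule Bochner_Integration.integral_cong[OF refl])
    fix \<omega> assume \<omega>: "\<omega> \<in> space M"
    have "(\<Sum>h\<in>hists n. indicator (history M par col n (fst h) (snd h)) \<omega> *\<^sub>R \<Phi> h) =
        (\<Sum>h\<in>hists n. if h = hist n \<omega> then \<Phi> h else 0)"
      using \<omega> by (intro sum.cong) (auto simp: history_eq_hist indicator_def)
    also have "\<dots> = F \<omega>" using hist_in_hists[OF \<omega>, of n] rep \<omega> by (simp add: finite_hists)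
    finally show "F \<omega> = (\<Sum>h\<in>hists n. indicator (history M par col n (fst h) (snd h)) \<omega> *\<^sub>R \<Phi> h)" ..
  qed
  also have "\<dots> = (\<Sum>h\<in>hists n. prob (history M par col n (fst h) (snd h)) *\<^sub>R \<Phi> h)"
    by (subst Bochner_Integration.integral_sum)
      (auto intro!: integrable_scaleR_left integrable_real_indicator simp: emeasure_eq_measure)
  finally show ?thesis .
qed

subsection \<open>The law of the next step given the past\<close>

text \<open>
  The conditional expectation of \<open>G s \<eta>\<close> given the past, where \<open>s\<close> is the sign of the next parent and
  \<open>\<eta>\<close> indicates the next flip.
\<close>

definition step_mean :: "nat \<Rightarrow> (real \<Rightarrow> real \<Rightarrow> 'a \<Rightarrow> 'c) \<Rightarrow> 'a \<Rightarrow> 'c::real_vector" where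
  "step_mean n G \<omega> =
     ((1 + drift n \<omega>) / 2) *\<^sub>R (p *\<^sub>R G 1 0 \<omega> + (1 - p) *\<^sub>R G 1 1 \<omega>) +
     ((1 - drift n \<omega>) / 2) *\<^sub>R (p *\<^sub>R G (- 1) 0 \<omega> + (1 - p) *\<^sub>R G (- 1) 1 \<omega>)"

lemma adapted_step_mean:
  assumes "n \<ge> 1" "\<And>\<sigma> e. adapted n (G \<sigma> e)"
  shows "adapted n (step_mean n G)"
  unfolding step_mean_def[abs_def]
  by (intro adapted_comp2[where h = "(+)"] adapted_comp2[where h = scaleR] adapted_const
      adapted_comp[where h = "\<lambda>x. (1 + x) / 2"] adapted_comp[where h = "\<lambda>x. (1 - x) / 2"]
      adapted_drift assms)

lemma rec_tree_hist: "rec_tree (fst (hist n \<omega>)) n = tree_at n \<omega>"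
  by (auto simp: rec_tree_def hist_def)

text \<open>
  A function on \<open>{1, - 1}\<close> is affine, so its average over the attachment probabilities depends only on
  the average sign, which is the drift.
\<close>

lemma attach_average:
  fixes g :: "real \<Rightarrow> 'c::real_vector"
  assumes \<omega>: "\<omega> \<in> space M" and n: "n \<ge> 1" and \<alpha>: "\<alpha> > - 1"
  shows "(\<Sum>v\<in>{1..n}. attach_prob \<alpha> (tree_at n \<omega>) v *\<^sub>R g (colour_sign (col v \<omega>))) =
    ((1 + drift n \<omega>) / 2) *\<^sub>R g 1 + ((1 - drift n \<omega>) / 2) *\<^sub>R g (- 1)"
proof -
  let ?a = "attach_prob \<alpha> (tree_at n \<omega>)"
  have w: "(\<Sum>v\<in>{1..n}. attach_weight \<alpha> (tree_at n \<omega>) v) = total_weight \<alpha> n"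
    by (rule sum_attach_weight[OF n recursive_par[OF \<omega>]])
  have "total_weight \<alpha> n = (1 + \<alpha>) * (real n - 1) + 1" by (simp add: total_weight_def algebra_simps)
  then have w0: "total_weight \<alpha> n > 0" using \<alpha> n by (simp add: add_nonneg_pos)
  have a: "?a v = attach_weight \<alpha> (tree_at n \<omega>) v / total_weight \<alpha> n" for v
    using w by (simp add: attach_prob_def)
  have 1: "(\<Sum>v\<in>{1..n}. ?a v) = 1"
    unfolding a sum_divide_distrib[symmetric] w using w0 by simp
  have 2: "(\<Sum>v\<in>{1..n}. ?a v * colour_sign (col v \<omega>)) = drift n \<omega>"
    unfolding drift_def imbalance_eq[OF \<omega> n] a sum_divide_distrib by (intro sum.cong) auto
  have "?a v *\<^sub>R g (colour_sign (col v \<omega>)) =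
      ?a v *\<^sub>R ((1/2) *\<^sub>R (g 1 + g (- 1))) + (?a v * colour_sign (col v \<omega>)) *\<^sub>R ((1/2) *\<^sub>R (g 1 - g (- 1)))" for v
  proof -
    have "g x = (1/2) *\<^sub>R (g 1 + g (- 1)) + x *\<^sub>R ((1/2) *\<^sub>R (g 1 - g (- 1)))" if "x = 1 \<or> x = - 1" for x :: real
    proof -
      have half: "y = (1/2) *\<^sub>R y + (1/2) *\<^sub>R y" for y :: 'c
        by (metis field_sum_of_halves scaleR_left.add scaleR_one)
      from that show ?thesis using half[of "g 1"] half[of "g (- 1)"] by (auto simp: algebra_simps)
    qed
    from this[OF colour_sign_cases, of "col v \<omega>"] show ?thesis
      by (metis scaleR_add_right scaleR_scaleR)
  qed
  then have "(\<Sum>v\<in>{1..n}. ?a v *\<^sub>R g (colour_sign (col v \<omega>))) =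
      (\<Sum>v\<in>{1..n}. ?a v) *\<^sub>R ((1/2) *\<^sub>R (g 1 + g (- 1))) +
      (\<Sum>v\<in>{1..n}. ?a v * colour_sign (col v \<omega>)) *\<^sub>R ((1/2) *\<^sub>R (g 1 - g (- 1)))"
    by (simp only: sum.distrib scaleR_sum_left)
  also have "\<dots> = ((1 + drift n \<omega>) / 2) *\<^sub>R g 1 + ((1 - drift n \<omega>) / 2) *\<^sub>R g (- 1)"
    unfolding 1 2 by (simp add: scaleR_add_right scaleR_diff_right scaleR_add_left scaleR_diff_left
        add_divide_distrib diff_divide_distrib)
  finally show ?thesis .
qed

text \<open>
  The only place where the law of the attachment step is used: summing the assumption \<open>step\<close> over all
  histories, parents and colours.
\<close>

lemma one_step:
  fixes G :: "real \<Rightarrow> real \<Rightarrow> 'a \<Rightarrow> 'c::{banach, second_countable_topology}"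
  assumes n: "n \<ge> 1" and \<alpha>: "\<alpha> > - 1" and G: "\<And>\<sigma> e. adapted n (G \<sigma> e)"
  shows "(\<integral>\<omega>. G (parent_sign n \<omega>) (flip n \<omega>) \<omega> \<partial>M) = (\<integral>\<omega>. step_mean n G \<omega> \<partial>M)"
proof -
  define rep where "rep h = (SOME \<omega>. \<omega> \<in> space M \<and> hist n \<omega> = h)" for h
  have rep: "rep (hist n \<omega>) \<in> space M \<and> hist n (rep (hist n \<omega>)) = hist n \<omega>" if "\<omega> \<in> space M" for \<omega>
    unfolding rep_def by (rule someI[of _ \<omega>]) (simp add: that)
  have via_rep: "F (rep (hist n \<omega>)) = F \<omega>" if "\<omega> \<in> space M" "adapted n F" for F :: "'a \<Rightarrow> 'c" and \<omega>
    using rep[OF that(1)] that by (intro adaptedD[OF that(2)]) (simp_all add: same_history_iff_hist)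
  define E where "E h v c = {\<omega> \<in> history M par col n (fst h) (snd h). par (n + 1) \<omega> = v \<and> col (n + 1) \<omega> = c}"
    for h v c
  define g where "g h v c = G (colour_sign (snd h v)) (of_bool (c \<noteq> snd h v)) (rep h)" for h v c
  have [measurable]: "E h v c \<in> sets M" for h v c
  proof -
    have "par (n + 1) -` {v} \<inter> space M \<in> sets M" "col (n + 1) -` {c} \<inter> space M \<in> sets M"
      using n by (auto intro!: measurable_sets[OF measurable_par] measurable_sets[OF measurable_col])
    moreover have "E h v c = history M par col n (fst h) (snd h) \<inter> (par (n + 1) -` {v} \<inter> space M) \<inter> (col (n + 1) -` {c} \<inter> space M)"
      by (auto simp: E_def history_def)
    ultimately show ?thesis by (simp add: sets.Int)
  qed
  have "(\<integral>\<omega>. G (parent_sign n \<omega>) (flip n \<omega>) \<omega> \<partial>M) =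
      (\<integral>\<omega>. (\<Sum>h\<in>hists n. \<Sum>v\<in>{1..n}. \<Sum>c\<in>UNIV. indicator (E h v c) \<omega> *\<^sub>R g h v c) \<partial>M)"
  proof (rule Bochner_Integration.integral_cong[OF refl])
    fix \<omega> assume \<omega>: "\<omega> \<in> space M"
    let ?h = "hist n \<omega>" and ?v = "par (n + 1) \<omega>" and ?c = "col (n + 1) \<omega>"
    have v: "?v \<in> {1..n}" using par_range[of "n + 1" \<omega>] \<omega> n by auto
    have ind: "indicator (E h v c) \<omega> *\<^sub>R g h v c =
        (if h = ?h then if v = ?v then if c = ?c then g ?h ?v ?c else 0 else 0 else 0)" if "h \<in> hists n" for h v c
      using \<omega> that by (auto simp: E_def history_eq_hist indicator_def)
    have "(\<Sum>c\<in>UNIV. indicator (E h v c) \<omega> *\<^sub>R g h v c) =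
        (if h = ?h then if v = ?v then g ?h ?v ?c else 0 else 0)" if "h \<in> hists n" for h v
      unfolding ind[OF that] by (cases "h = ?h"; cases "v = ?v") (simp_all add: finite_UNIV_colour)
    then have "(\<Sum>v\<in>{1..n}. \<Sum>c\<in>UNIV. indicator (E h v c) \<omega> *\<^sub>R g h v c) =
        (if h = ?h then g ?h ?v ?c else 0)" if "h \<in> hists n" for h
      using v that by (cases "h = ?h") simp_all
    then have "(\<Sum>h\<in>hists n. \<Sum>v\<in>{1..n}. \<Sum>c\<in>UNIV. indicator (E h v c) \<omega> *\<^sub>R g h v c) = g ?h ?v ?c"
      using hist_in_hists[OF \<omega>, of n] by (simp add: finite_hists)
    also have "\<dots> = G (parent_sign n \<omega>) (flip n \<omega>) \<omega>"
    proof -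
      have "snd ?h ?v = col ?v \<omega>" using v by (simp add: hist_def)
      then show ?thesis
        using via_rep[OF \<omega> G] by (simp add: g_def parent_sign_def flip_def)
    qed
    finally show "G (parent_sign n \<omega>) (flip n \<omega>) \<omega> =
        (\<Sum>h\<in>hists n. \<Sum>v\<in>{1..n}. \<Sum>c\<in>UNIV. indicator (E h v c) \<omega> *\<^sub>R g h v c)" ..
  qed
  also have "\<dots> = (\<Sum>h\<in>hists n. \<Sum>v\<in>{1..n}. \<Sum>c\<in>UNIV. prob (E h v c) *\<^sub>R g h v c)"
    by (simp add: Bochner_Integration.integral_sum integrable_scaleR_left emeasure_eq_measure)
  also have "\<dots> = (\<Sum>h\<in>hists n. prob (history M par col n (fst h) (snd h)) *\<^sub>R step_mean n G (rep h))"
  proof (rule sum.cong[OF refl])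
    fix h assume h: "h \<in> hists n"
    let ?P = "prob (history M par col n (fst h) (snd h))"
    have E: "prob (E h v c) = ?P * (attach_prob \<alpha> (rec_tree (fst h) n) v * (if c = snd h v then p else 1 - p))"
      if "v \<in> {1..n}" for v c
      unfolding E_def using step[OF n that] by simp
    show "(\<Sum>v\<in>{1..n}. \<Sum>c\<in>UNIV. prob (E h v c) *\<^sub>R g h v c) = ?P *\<^sub>R step_mean n G (rep h)"
    proof (cases "\<exists>\<omega>\<in>space M. hist n \<omega> = h")
      case False
      then have "history M par col n (fst h) (snd h) = {}" using history_eq_hist[OF h] by auto
      then have "?P = 0" by simp
      then show ?thesis using E by simp
    next
      case True
      then have r: "rep h \<in> space M" "hist n (rep h) = h" using rep by blast+
      let ?g = "\<lambda>\<sigma>. p *\<^sub>R G \<sigma> 0 (rep h) + (1 - p) *\<^sub>R G \<sigma> 1 (rep h)"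
      have tree: "rec_tree (fst h) n = tree_at n (rep h)" using rec_tree_hist[of n "rep h"] r(2) by simp
      have "(\<Sum>v\<in>{1..n}. \<Sum>c\<in>UNIV. prob (E h v c) *\<^sub>R g h v c) =
          (\<Sum>v\<in>{1..n}. ?P *\<^sub>R (attach_prob \<alpha> (tree_at n (rep h)) v *\<^sub>R ?g (colour_sign (col v (rep h)))))"
      proof (rule sum.cong[OF refl])
        fix v assume v: "v \<in> {1..n}"
        have col: "snd h v = col v (rep h)"
        proof -
          have "snd (hist n (rep h)) v = col v (rep h)" using v by (simp add: hist_def)
          then show ?thesis by (simp only: r(2))
        qed
        show "(\<Sum>c\<in>UNIV. prob (E h v c) *\<^sub>R g h v c) =
            ?P *\<^sub>R (attach_prob \<alpha> (tree_at n (rep h)) v *\<^sub>R ?g (colour_sign (col v (rep h))))"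
          unfolding E[OF v] tree g_def col
          by (cases "col v (rep h)") (simp_all add: UNIV_colour scaleR_add_right mult.assoc add.commute)
      qed
      also have "\<dots> = ?P *\<^sub>R step_mean n G (rep h)"
        unfolding scaleR_sum_right[symmetric] attach_average[OF r(1) n \<alpha>, of ?g] step_mean_def ..
      finally show ?thesis .
    qed
  qed
  also have "\<dots> = (\<integral>\<omega>. step_mean n G \<omega> \<partial>M)"
  proof (rule integral_by_hist[symmetric])
    show "adapted n (step_mean n G)" by (rule adapted_step_mean[OF n G])
    fix h \<omega> assume "\<omega> \<in> space M" "hist n \<omega> = h"
    then show "step_mean n G \<omega> = step_mean n G (rep h)"
      using via_rep[OF _ adapted_step_mean[where G = G, OF n G], of \<omega>] by simp
  qed
  finally show ?thesis .
qed

end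

section \<open>Cluster and vertex counts as functionals of the process\<close>

context pa_broadcast
begin

definition flips :: "nat \<Rightarrow> 'a \<Rightarrow> real" where
  "flips n \<omega> = (\<Sum>j\<in>{1..<n}. flip j \<omega>)"

lemma flips_1 [simp]: "flips (Suc 0) \<omega> = 0"
  by (simp add: flips_def)

lemma flips_Suc: "n \<ge> 1 \<Longrightarrow> flips (Suc n) \<omega> = flips n \<omega> + flip n \<omega>"
  by (simp add: flips_def)

lemma adapted_flips: "1 \<le> n \<Longrightarrow> adapted n (flips n)"
  unfolding flips_def[abs_def] by (intro adapted_sum adapted_flip) auto

lemma card_Collect_Suc:
  "card {k \<in> {1..Suc n}. P k} = card {k \<in> {1..n}. P k} + of_bool (P (Suc n))"
proof -
  have "{k \<in> {1..Suc n}. P k} = {k \<in> {1..n}. P k} \<union> (if P (Suc n) then {Suc n} else {})"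
    by (auto simp: le_Suc_eq)
  then show ?thesis by simp
qed

lemma num_clusters_process:
  assumes \<omega>: "\<omega> \<in> space M" and n: "n \<ge> 1"
  shows "real (num_clusters (tree_at n \<omega>) (\<lambda>k. col k \<omega>) c) =
    (1 + flips n \<omega> + colour_sign c * walk 0 (- 1) n \<omega>) / 2"
proof -
  let ?top = "\<lambda>k. col k \<omega> = c \<and> (k = 1 \<or> col (par k \<omega>) \<omega> \<noteq> c)"
  have "real (card {k \<in> {1..n}. ?top k}) = (1 + flips n \<omega> + colour_sign c * walk 0 (- 1) n \<omega>) / 2"
    using n
  proof (induction n rule: nat_induct_at_least)
    case base
    have "{k. k = 1 \<and> ?top k} = (if col 1 \<omega> = c then {1} else {})" by auto
    then have "{k \<in> {1..1}. ?top k} = (if col 1 \<omega> = c then {1} else {})" by auto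
    then show ?case
      by (cases c; cases "col 1 \<omega>") (simp_all add: root_sign_eq colour_sign_def)
  next
    case (Suc n)
    have "real (of_bool (?top (Suc n))) = flip n \<omega> * (1 - colour_sign c * parent_sign n \<omega>) / 2"
      using Suc.hyps
      by (cases c; cases "col (Suc n) \<omega>"; cases "col (par (Suc n) \<omega>) \<omega>")
        (simp_all add: flip_def parent_sign_def colour_sign_def)
    then show ?case
      using Suc by (simp only: card_Collect_Suc of_nat_add flips_Suc walk_Suc) (simp add: field_simps)
  qed
  then show ?thesis by (simp add: num_clusters_eq[OF recursive_par[OF \<omega>]])
qed

lemma num_vertices_process:
  assumes n: "n \<ge> 1"
  shows "real (num_vertices (tree_at n \<omega>) (\<lambda>k. col k \<omega>) c) =
    (real n + colour_sign c * walk 1 (- 2) n \<omega>) / 2"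
  using n
proof (induction n rule: nat_induct_at_least)
  case base
  have "{v. v = Suc 0 \<and> col v \<omega> = c} = (if col 1 \<omega> = c then {1} else {})" by auto
  then show ?case
    by (cases c; cases "col 1 \<omega>") (simp_all add: num_vertices_def root_sign_eq colour_sign_def)
next
  case (Suc n)
  have "real (of_bool (col (Suc n) \<omega> = c)) = (1 + colour_sign c * colour_sign (col (Suc n) \<omega>)) / 2"
    by (cases c; cases "col (Suc n) \<omega>") (simp_all add: colour_sign_def)
  then show ?case
    using Suc
    by (simp only: num_vertices_def verts_rec_tree card_Collect_Suc of_nat_add walk_Suc colour_sign_child)
      (simp add: field_simps)
qed

lemma cluster_counts_process:
  assumes "\<omega> \<in> space M" "n \<ge> 1"
  shows "cluster_counts par col n \<omega> =
    vector [(1 + flips n \<omega> + walk 0 (- 1) n \<omega>) / 2, (1 + flips n \<omega> - walk 0 (- 1) n \<omega>) / 2]"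
  by (simp add: cluster_counts_def num_clusters_process[OF assms] colour_sign_def)

lemma vertex_counts_process:
  assumes "n \<ge> 1"
  shows "vertex_counts par col n \<omega> =
    vector [(real n + walk 1 (- 2) n \<omega>) / 2, (real n - walk 1 (- 2) n \<omega>) / 2]"
  by (simp add: vertex_counts_def num_vertices_process[OF assms] colour_sign_def)

lemma cluster_counts_measurable: "cluster_counts par col n \<in> borel_measurable M"
proof (rule adapted_measurable, rule adaptedI)
  fix \<omega> \<omega>' assume *: "\<omega> \<in> space M" "\<omega>' \<in> space M" "same_history n \<omega> \<omega>'"
  have t: "tree_at n \<omega> = tree_at n \<omega>'"
    using *(3) by (auto simp: rec_tree_def same_history_def)
  have "{k \<in> {1..n}. col k \<omega> = c \<and> (k = 1 \<or> col (par k \<omega>) \<omega> \<noteq> c)} =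
      {k \<in> {1..n}. col k \<omega>' = c \<and> (k = 1 \<or> col (par k \<omega>') \<omega>' \<noteq> c)}" for c
  proof -
    have "col k \<omega> = col k \<omega>'" if "k \<in> {1..n}" for k using *(3) that by (simp add: same_history_def)
    moreover have "col (par k \<omega>) \<omega> = col (par k \<omega>') \<omega>'" if "k \<in> {1..n}" "k \<noteq> 1" for k
      using adaptedD[OF adapted_col_par *, of k] that by auto
    ultimately show ?thesis by (intro Collect_cong) metis
  qed
  then show "cluster_counts par col n \<omega> = cluster_counts par col n \<omega>'"
    by (simp add: cluster_counts_def num_clusters_eq[OF recursive_par] *)
qed

lemma vertex_counts_measurable: "vertex_counts par col n \<in> borel_measurable M"
proof (rule adapted_measurable, rule adaptedI)
  fix \<omega> \<omega>' assume *: "\<omega> \<in> space M" "\<omega>' \<in> space M" "same_history n \<omega> \<omega>'"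
  have "{v \<in> {1..n}. col v \<omega> = c} = {v \<in> {1..n}. col v \<omega>' = c}" for c
    using *(3) by (auto simp: same_history_def)
  then show "vertex_counts par col n \<omega> = vertex_counts par col n \<omega>'"
    by (simp add: vertex_counts_def num_vertices_def)
qed

end

section \<open>Second moments\<close>

text \<open>
  The solution of \<open>h (n + 1) = h n * (1 + y / w n)\<close> with \<open>h 1 = 1\<close>.
\<close>

definition growth :: "real \<Rightarrow> real \<Rightarrow> nat \<Rightarrow> real" where
  "growth \<alpha> y n = (\<Prod>j\<in>{1..<n}. 1 + y / total_weight \<alpha> j)"

lemma growth_1 [simp]: "growth \<alpha> y (Suc 0) = 1"
  by (simp add: growth_def)

lemma growth_Suc: "n \<ge> 1 \<Longrightarrow> growth \<alpha> y (Suc n) = growth \<alpha> y n * (1 + y / total_weight \<alpha> n)"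
  by (simp add: growth_def)

lemma total_weight_Suc: "total_weight \<alpha> (Suc n) = total_weight \<alpha> n + (1 + \<alpha>)"
  by (simp add: total_weight_def algebra_simps)

lemma total_weight_1 [simp]: "total_weight \<alpha> (Suc 0) = 1"
  by (simp add: total_weight_def)

lemma total_weight_ge_1: "\<alpha> > - 1 \<Longrightarrow> n \<ge> 1 \<Longrightarrow> total_weight \<alpha> n \<ge> 1"
proof -
  assume "\<alpha> > - 1" "n \<ge> 1"
  then have "(1 + \<alpha>) * (real n - 1) \<ge> 0" by simp
  then show ?thesis by (simp add: total_weight_def algebra_simps)
qed

lemma growth_ge_1:
  assumes "\<alpha> > - 1" "y \<ge> 0"
  shows "growth \<alpha> y n \<ge> 1"
  unfolding growth_def
proof (rule prod_ge_1)
  fix j assume "j \<in> {1..<n}"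
  then have "total_weight \<alpha> j \<ge> 1" using total_weight_ge_1[OF assms(1), of j] by simp
  then show "1 \<le> 1 + y / total_weight \<alpha> j" using assms(2) by simp
qed

lemma growth_eq_pochhammer:
  assumes "\<alpha> > - 1"
  shows "growth \<alpha> y (Suc n) = pochhammer ((1 + y) / (1 + \<alpha>)) n / pochhammer (1 / (1 + \<alpha>)) n"
proof (induction n)
  case 0
  then show ?case by simp
next
  case (Suc n)
  have "1 + y / (1 + g * real n) = ((1 + y) / g + real n) / (1 / g + real n)" if "g > 0" for g
  proof -
    have "1 + g * real n > 0" using that by (simp add: add_pos_nonneg)
    moreover have "((1 + y) / g + real n) / (1 / g + real n) = (1 + y + g * real n) / (1 + g * real n)"
    proof -
      have "(1 + y) / g + real n = (1 + y + g * real n) / g" "1 / g + real n = (1 + g * real n) / g"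
        using that by (simp_all add: add_divide_distrib)
      then show ?thesis using that by simp
    qed
    ultimately show ?thesis by (simp add: add_divide_distrib[symmetric] field_simps)
  qed
  from this[of "1 + \<alpha>"] assms
  have "1 + y / total_weight \<alpha> (Suc n) = ((1 + y) / (1 + \<alpha>) + real n) / (1 / (1 + \<alpha>) + real n)"
    by (simp add: total_weight_def algebra_simps)
  then show ?case by (simp add: growth_Suc[of "Suc n"] Suc pochhammer_Suc)
qed

text \<open>
  The products that solve the moment recursions are ratios of Pochhammer symbols, so Gauss' formula
  for the Gamma function gives both their order of growth and the constant in front.
\<close>

lemma growth_asymptotics:
  assumes \<alpha>: "\<alpha> > - 1"
  shows "(\<lambda>n. growth \<alpha> y n / real n powr (y / (1 + \<alpha>))) \<longlonglongrightarrow>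
    Gamma (1 / (1 + \<alpha>)) * rGamma ((1 + y) / (1 + \<alpha>))"
proof -
  let ?a = "(1 + y) / (1 + \<alpha>)" and ?b = "1 / (1 + \<alpha>)" and ?r = "y / (1 + \<alpha>)"
  have ab: "?a - ?b = ?r" by (simp add: diff_divide_distrib[symmetric])
  have b: "?b > 0" using \<alpha> by simp
  then have rG: "rGamma ?b \<noteq> 0" 
    using Gamma_real_pos[OF b] unfolding rGamma_inverse_Gamma by (intro nonzero_imp_inverse_nonzero) linarith
  have "(\<lambda>n. rGamma_series ?a n / rGamma_series ?b n) \<longlonglongrightarrow> rGamma ?a / rGamma ?b"
    by (intro tendsto_divide rGamma_series_LIMSEQ rG)
  then have 1: "(\<lambda>n. rGamma_series ?a n / rGamma_series ?b n * (real n / real (n + 2)) powr ?r) \<longlonglongrightarrow>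
      rGamma ?a / rGamma ?b * 1"
  proof (rule tendsto_mult)
    have "(\<lambda>n. (real n / real (n + 2)) powr ?r) \<longlonglongrightarrow> 1 powr ?r"
    proof (rule tendsto_powr)
      show "(\<lambda>n. real n / real (n + 2)) \<longlonglongrightarrow> 1" by real_asymp
    qed auto
    then show "(\<lambda>n. (real n / real (n + 2)) powr ?r) \<longlonglongrightarrow> 1" by simp
  qed
  have "eventually (\<lambda>n. rGamma_series ?a n / rGamma_series ?b n * (real n / real (n + 2)) powr ?r =
      growth \<alpha> y (n + 2) / real (n + 2) powr ?r) sequentially"
    using eventually_gt_at_top[of 0]
  proof eventually_elim
    case (elim n)
    have e: "exp (z * ln (real n)) = real n powr z" for z using elim by (simp add: powr_def)
    have "rGamma_series ?a n / rGamma_series ?b n =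
        (pochhammer ?a (n + 1) / pochhammer ?b (n + 1)) * (real n powr ?b / real n powr ?a)"
      unfolding rGamma_series_def of_real_eq_id id_apply e by simp
    also have "real n powr ?b / real n powr ?a = 1 / real n powr ?r"
      unfolding ab[symmetric] powr_diff by simp
    also have "pochhammer ?a (n + 1) / pochhammer ?b (n + 1) = growth \<alpha> y (n + 2)"
      using growth_eq_pochhammer[OF \<alpha>, of y "n + 1"] by simp
    finally show ?case using elim by (simp add: powr_divide)
  qed
  from Lim_transform_eventually[OF 1 this]
  have "(\<lambda>n. growth \<alpha> y (n + 2) / real (n + 2) powr ?r) \<longlonglongrightarrow> rGamma ?a / rGamma ?b" by simp
  moreover have "rGamma ?a / rGamma ?b = Gamma ?b * rGamma ?a"
    unfolding rGamma_inverse_Gamma[of ?b] by (simp only: divide_inverse inverse_inverse_eq mult.commute)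
  ultimately show ?thesis using LIMSEQ_offset[of "\<lambda>n. growth \<alpha> y n / real n powr ?r" 2] by simp
qed

lemma growth_bound:
  assumes \<alpha>: "\<alpha> > - 1" and y: "y \<ge> 0"
  obtains C where "C > 0" "\<And>n. n \<ge> 1 \<Longrightarrow> growth \<alpha> y n \<le> C * real n powr (y / (1 + \<alpha>))"
proof -
  from convergentI[OF growth_asymptotics[OF \<alpha>, of y]] have "Bseq (\<lambda>n. growth \<alpha> y n / real n powr (y / (1 + \<alpha>)))"
    by (rule convergent_imp_Bseq)
  then obtain C where C: "C > 0" "\<And>n. norm (growth \<alpha> y n / real n powr (y / (1 + \<alpha>))) \<le> C"
    by (auto elim: BseqE)
  show ?thesis
  proof (rule that[OF C(1)])
    fix n :: nat assume "n \<ge> 1"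
    then have "real n powr (y / (1 + \<alpha>)) > 0" by simp
    with C(2)[of n] show "growth \<alpha> y n \<le> C * real n powr (y / (1 + \<alpha>))"
      by (simp add: abs_le_iff field_simps)
  qed
qed

locale pa_process = pa_broadcast +
  assumes alpha_gt: "\<alpha> > - 1" and p_nonneg: "0 \<le> p" and p_le_1: "p \<le> 1"
begin

abbreviation w :: "nat \<Rightarrow> real" where
  "w \<equiv> total_weight \<alpha>"

definition \<xi> :: real where
  "\<xi> = 2 * p + \<alpha> - 1"

definition step_var :: real where
  "step_var = \<alpha>\<^sup>2 + 1 + 2 * \<alpha> * (2 * p - 1)"

lemma w_ge_1: "n \<ge> 1 \<Longrightarrow> w n \<ge> 1"
  by (rule total_weight_ge_1[OF alpha_gt])

text \<open>
  Almost surely the drift is the mean of a sign: for negative \<open>\<alpha>\<close> individual weights can be negative,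
  but the probability that the next parent has a given colour is nonnegative on every history of
  positive probability.
\<close>

lemma AE_drift_le_1:
  assumes "n \<ge> 1"
  shows "AE \<omega> in M. \<bar>drift n \<omega>\<bar> \<le> 1"
proof -
  have "AE \<omega> in M. 0 \<le> 1 + \<tau> * drift n \<omega>" if \<tau>: "\<tau> = 1 \<or> \<tau> = - 1" for \<tau>
  proof -
    define F where "F \<omega> = (of_bool (1 + \<tau> * drift n \<omega> < 0) :: real)" for \<omega>
    have F: "adapted n F" unfolding F_def[abs_def]
      by (rule adapted_comp[OF adapted_drift[OF assms], of "\<lambda>x. of_bool (1 + \<tau> * x < 0)"])
    define N where "N \<omega> = - (1 + \<tau> * drift n \<omega>) * F \<omega>" for \<omega>
    have N: "adapted n N" unfolding N_def[abs_def]
      by (rule adapted_comp2[OF adapted_drift[OF assms] F, of "\<lambda>x y. - (1 + \<tau> * x) * y"])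
    have N0: "N \<omega> \<ge> 0" for \<omega> by (auto simp: N_def F_def)
    have "(\<integral>\<omega>. (\<lambda>\<sigma> e \<omega>. if \<sigma> = \<tau> then F \<omega> else 0) (parent_sign n \<omega>) (flip n \<omega>) \<omega> \<partial>M) =
        (\<integral>\<omega>. step_mean n (\<lambda>\<sigma> e \<omega>. if \<sigma> = \<tau> then F \<omega> else 0) \<omega> \<partial>M)"
      by (intro one_step[OF assms alpha_gt] adapted_comp[OF F])
    also have "step_mean n (\<lambda>\<sigma> e \<omega>. if \<sigma> = \<tau> then F \<omega> else 0) = (\<lambda>\<omega>. - (1/2) * N \<omega>)"
      using \<tau> by (auto simp: step_mean_def N_def fun_eq_iff field_simps)
    finally have "(\<integral>\<omega>. (if parent_sign n \<omega> = \<tau> then F \<omega> else 0) \<partial>M) = - (1/2) * (\<integral>\<omega>. N \<omega> \<partial>M)"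
      by simp
    moreover have "(\<integral>\<omega>. (if parent_sign n \<omega> = \<tau> then F \<omega> else 0) \<partial>M) \<ge> 0"
      by (rule Bochner_Integration.integral_nonneg) (simp add: F_def)
    moreover have "(\<integral>\<omega>. N \<omega> \<partial>M) \<ge> 0" by (rule Bochner_Integration.integral_nonneg) (rule N0)
    ultimately have "(\<integral>\<omega>. N \<omega> \<partial>M) = 0" by linarith
    then have "AE \<omega> in M. N \<omega> = 0"
      using integral_nonneg_eq_0_iff_AE[OF integrable_adapted[OF N]] N0 by simp
    then show ?thesis by eventually_elim (auto simp: N_def F_def)
  qed
  from this[of 1, simplified] this[of "- 1", simplified] show ?thesis by eventually_elim auto
qed

text \<open>
  The sign of the parent has conditional mean \<open>drift\<close> but square 1, and the flip is independent of it;
  so the conditional variance of a step does not depend on the past, up to the square of the drift.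
\<close>

lemma second_moment_step:
  assumes n: "n \<ge> 1" and F: "adapted n F"
  shows "(\<integral>\<omega>. (F \<omega> + parent_sign n \<omega> * (u + v * flip n \<omega>))\<^sup>2 \<partial>M) =
    (\<integral>\<omega>. (F \<omega>)\<^sup>2 \<partial>M) + 2 * (u + v * (1 - p)) * (\<integral>\<omega>. F \<omega> * drift n \<omega> \<partial>M)
      + (p * u\<^sup>2 + (1 - p) * (u + v)\<^sup>2)"
proof -
  have F2: "adapted n (\<lambda>\<omega>. (F \<omega>)\<^sup>2)" by (rule adapted_comp[OF F])
  have Fd: "adapted n (\<lambda>\<omega>. F \<omega> * drift n \<omega>)" by (rule adapted_comp2[OF F adapted_drift[OF n]])
  have "(\<integral>\<omega>. (\<lambda>\<sigma> e \<omega>. (F \<omega> + \<sigma> * (u + v * e))\<^sup>2) (parent_sign n \<omega>) (flip n \<omega>) \<omega> \<partial>M) =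
      (\<integral>\<omega>. step_mean n (\<lambda>\<sigma> e \<omega>. (F \<omega> + \<sigma> * (u + v * e))\<^sup>2) \<omega> \<partial>M)"
    by (intro one_step[OF n alpha_gt] adapted_comp[OF F])
  also have "step_mean n (\<lambda>\<sigma> e \<omega>. (F \<omega> + \<sigma> * (u + v * e))\<^sup>2) =
      (\<lambda>\<omega>. (F \<omega>)\<^sup>2 + 2 * (u + v * (1 - p)) * (F \<omega> * drift n \<omega>) + (p * u\<^sup>2 + (1 - p) * (u + v)\<^sup>2))"
    unfolding step_mean_def real_scaleR_def by (rule ext) (simp add: power2_eq_square field_simps)
  also have "(\<integral>\<omega>. \<dots> \<omega> \<partial>M) = (\<integral>\<omega>. (F \<omega>)\<^sup>2 \<partial>M) + 2 * (u + v * (1 - p)) * (\<integral>\<omega>. F \<omega> * drift n \<omega> \<partial>M)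
      + (p * u\<^sup>2 + (1 - p) * (u + v)\<^sup>2)"
    using integrable_adapted[OF F2] integrable_adapted[OF Fd] by (simp add: prob_space)
  finally show ?thesis by simp
qed

lemma mean_step:
  assumes n: "n \<ge> 1" and F: "adapted n F"
  shows "(\<integral>\<omega>. F \<omega> * (parent_sign n \<omega> * (u + v * flip n \<omega>)) \<partial>M) =
    (u + v * (1 - p)) * (\<integral>\<omega>. F \<omega> * drift n \<omega> \<partial>M)"
proof -
  have Fd: "adapted n (\<lambda>\<omega>. F \<omega> * drift n \<omega>)" by (rule adapted_comp2[OF F adapted_drift[OF n]])
  have "(\<integral>\<omega>. (\<lambda>\<sigma> e \<omega>. F \<omega> * (\<sigma> * (u + v * e))) (parent_sign n \<omega>) (flip n \<omega>) \<omega> \<partial>M) =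
      (\<integral>\<omega>. step_mean n (\<lambda>\<sigma> e \<omega>. F \<omega> * (\<sigma> * (u + v * e))) \<omega> \<partial>M)"
    by (intro one_step[OF n alpha_gt] adapted_comp[OF F])
  also have "step_mean n (\<lambda>\<sigma> e \<omega>. F \<omega> * (\<sigma> * (u + v * e))) =
      (\<lambda>\<omega>. (u + v * (1 - p)) * (F \<omega> * drift n \<omega>))"
    unfolding step_mean_def real_scaleR_def by (rule ext) (simp add: field_simps)
  finally show ?thesis by simp
qed

lemma second_moment_flip_step:
  assumes n: "n \<ge> 1" and F: "adapted n F"
  shows "(\<integral>\<omega>. (F \<omega> + (flip n \<omega> - (1 - p)))\<^sup>2 \<partial>M) = (\<integral>\<omega>. (F \<omega>)\<^sup>2 \<partial>M) + p * (1 - p)"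
proof -
  have F2: "adapted n (\<lambda>\<omega>. (F \<omega>)\<^sup>2)" by (rule adapted_comp[OF F])
  have "(\<integral>\<omega>. (\<lambda>\<sigma> e \<omega>. (F \<omega> + (e - (1 - p)))\<^sup>2) (parent_sign n \<omega>) (flip n \<omega>) \<omega> \<partial>M) =
      (\<integral>\<omega>. step_mean n (\<lambda>\<sigma> e \<omega>. (F \<omega> + (e - (1 - p)))\<^sup>2) \<omega> \<partial>M)"
    by (intro one_step[OF n alpha_gt] adapted_comp[OF F])
  also have "step_mean n (\<lambda>\<sigma> e \<omega>. (F \<omega> + (e - (1 - p)))\<^sup>2) = (\<lambda>\<omega>. (F \<omega>)\<^sup>2 + p * (1 - p))"
    unfolding step_mean_def real_scaleR_def by (rule ext) (simp add: power2_eq_square field_simps)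
  finally show ?thesis using integrable_adapted[OF F2] by (simp add: prob_space)
qed

definition imbalance_sq :: "nat \<Rightarrow> real" where
  "imbalance_sq n = (\<integral>\<omega>. (imbalance n \<omega>)\<^sup>2 \<partial>M)"

lemma root_sign_power2 [simp]: "(root_sign col \<omega>)\<^sup>2 = 1"
  by (simp add: root_sign_def)

lemma imbalance_sq_1 [simp]: "imbalance_sq (Suc 0) = 1"
  by (simp add: imbalance_sq_def prob_space)

lemma imbalance_sq_Suc:
  assumes n: "n \<ge> 1"
  shows "imbalance_sq (Suc n) = imbalance_sq n * (1 + 2 * \<xi> / w n) + step_var"
proof -
  have "(\<integral>\<omega>. imbalance n \<omega> * drift n \<omega> \<partial>M) = imbalance_sq n / w n"
    by (simp add: imbalance_sq_def drift_def power2_eq_square)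
  then show ?thesis
    using second_moment_step[OF n adapted_walk[OF n], of "1 + \<alpha>" "- 2" "1 + \<alpha>" "- 2"] n
    by (simp add: imbalance_sq_def walk_Suc \<xi>_def step_var_def power2_eq_square algebra_simps add_divide_distrib diff_divide_distrib)
qed

text \<open>
  If \<open>u + v * (1 - p) = 0\<close>, the step has conditional mean zero and the second moment grows by a fixed
  amount.
\<close>

lemma martingale_second_moment:
  assumes n: "n \<ge> 1" and uv: "u + v * (1 - p) = 0"
    and F: "\<And>k. k \<ge> 1 \<Longrightarrow> adapted k (F k)"
    and step: "\<And>k \<omega>. k \<ge> 1 \<Longrightarrow> F (Suc k) \<omega> = F k \<omega> + parent_sign k \<omega> * (u + v * flip k \<omega>)"
  shows "(\<integral>\<omega>. (F n \<omega>)\<^sup>2 \<partial>M) = (\<integral>\<omega>. (F 1 \<omega>)\<^sup>2 \<partial>M) + (p * u\<^sup>2 + (1 - p) * (u + v)\<^sup>2) * (real n - 1)"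
  using n
proof (induction n rule: nat_induct_at_least)
  case base
  then show ?case by simp
next
  case (Suc n)
  have "(\<integral>\<omega>. (F (Suc n) \<omega>)\<^sup>2 \<partial>M) = (\<integral>\<omega>. (F n \<omega>)\<^sup>2 \<partial>M) + (p * u\<^sup>2 + (1 - p) * (u + v)\<^sup>2)"
    unfolding step[OF Suc.hyps] second_moment_step[OF Suc.hyps F[OF Suc.hyps], of u v] uv by simp
  then show ?case using Suc.IH by (simp add: algebra_simps)
qed

lemma flips_variance:
  assumes n: "n \<ge> 1"
  shows "(\<integral>\<omega>. (1 + flips n \<omega> - (1 - p) * real n)\<^sup>2 \<partial>M) = p\<^sup>2 + p * (1 - p) * (real n - 1)"
  using n
proof (induction n rule: nat_induct_at_least)
  case base
  then show ?case by (simp add: prob_space)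
next
  case (Suc n)
  have "adapted n (\<lambda>\<omega>. 1 + flips n \<omega> - (1 - p) * real n)"
    by (rule adapted_comp[OF adapted_flips[OF Suc.hyps]])
  from second_moment_flip_step[OF Suc.hyps this] Suc.IH show ?case
    by (simp add: flips_Suc[OF Suc.hyps] algebra_simps)
qed

end

section \<open>The strong law\<close>

text \<open>
  For bounded increments of \<open>x\<close> the cubes \<open>(x n / n)\<^sup>3\<close> have summable increments, since the derivative of
  the cube produces the factor \<open>(x n / n)\<^sup>2\<close>. Hence the cubes converge, and a nonzero limit would
  contradict the divergence of the harmonic series.
\<close>

lemma average_null_if_summable_squares:
  fixes x :: "nat \<Rightarrow> real"
  assumes lip: "\<And>n. n \<ge> 1 \<Longrightarrow> \<bar>x (Suc n) - x n\<bar> \<le> c"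
    and sq: "summable (\<lambda>n. (x n)\<^sup>2 / real n ^ 3)"
  shows "(\<lambda>n. x n / real n) \<longlonglongrightarrow> 0"
proof -
  have c0: "0 \<le> c" using lip[of 1] by linarith
  define z where "z n = x n / real n" for n
  define Z where "Z = \<bar>x 1\<bar> + c"
  define A where "A = c + Z"
  have Z0: "0 \<le> Z" "0 \<le> A" using c0 by (auto simp: Z_def A_def)
  have zZ: "\<bar>z n\<bar> \<le> Z" if "n \<ge> 1" for n
  proof -
    have "\<bar>x n\<bar> \<le> \<bar>x 1\<bar> + c * (real n - 1)" using that
    proof (induction n rule: nat_induct_at_least)
      case (Suc n)
      then show ?case using lip[of n] by (simp add: algebra_simps)
    qed simp
    also have "\<dots> \<le> \<bar>x 1\<bar> * real n + c * real n"
      using that c0 by (intro add_mono mult_left_mono) (auto simp: mult_le_cancel_left1)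
    finally show ?thesis using that by (simp add: z_def Z_def field_simps)
  qed
  have step: "\<bar>z (Suc n) ^ 3 - z n ^ 3\<bar> \<le>
      3 * A * ((x n)\<^sup>2 / real n ^ 3) + (3 * Z * A\<^sup>2 + A ^ 3) * inverse (real n ^ 2)" if n: "n \<ge> 1" for n
  proof -
    define d where "d = z (Suc n) - z n"
    have "d = ((x (Suc n) - x n) - z n) / real (Suc n)"
      using n by (simp add: d_def z_def field_simps)
    then have "\<bar>d\<bar> = \<bar>(x (Suc n) - x n) - z n\<bar> / real (Suc n)" by (simp add: abs_divide)
    also have "\<dots> \<le> A / real n"
    proof (rule frac_le)
      show "\<bar>x (Suc n) - x n - z n\<bar> \<le> A" using lip[OF n] zZ[OF n] by (simp add: A_def)
    qed (use n Z0 in auto)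
    finally have d: "\<bar>d\<bar> \<le> A / real n" .
    have d2: "d\<^sup>2 \<le> (A / real n)\<^sup>2" using power_mono[OF d, of 2] by simp
    have d3: "\<bar>d\<bar> ^ 3 \<le> (A / real n) ^ 3" using power_mono[OF d, of 3] by simp
    have "z (Suc n) ^ 3 - z n ^ 3 = 3 * (z n)\<^sup>2 * d + 3 * z n * d\<^sup>2 + d ^ 3"
      by (simp add: d_def power2_eq_square power3_eq_cube algebra_simps)
    then have "\<bar>z (Suc n) ^ 3 - z n ^ 3\<bar> \<le> \<bar>3 * (z n)\<^sup>2 * d\<bar> + \<bar>3 * z n * d\<^sup>2\<bar> + \<bar>d ^ 3\<bar>" by linarith
    also have "\<dots> = 3 * (z n)\<^sup>2 * \<bar>d\<bar> + 3 * \<bar>z n\<bar> * d\<^sup>2 + \<bar>d\<bar> ^ 3" by (simp add: abs_mult power_abs)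
    also have "\<dots> \<le> 3 * (z n)\<^sup>2 * (A / real n) + 3 * Z * (A / real n)\<^sup>2 + (A / real n) ^ 3"
      using d d2 d3 zZ[OF n] by (intro add_mono mult_mono mult_left_mono) auto
    also have "(A / real n) ^ 3 \<le> A ^ 3 * inverse (real n ^ 2)"
    proof -
      have "inverse (real n ^ 3) \<le> inverse (real n ^ 2)"
        using n by (intro le_imp_inverse_le power_increasing) auto
      then have "A ^ 3 * inverse (real n ^ 3) \<le> A ^ 3 * inverse (real n ^ 2)"
        using Z0 by (intro mult_left_mono) auto
      then show ?thesis by (simp only: power_divide divide_inverse[of "A ^ 3"])
    qed
    also have "3 * (z n)\<^sup>2 * (A / real n) = 3 * A * ((x n)\<^sup>2 / real n ^ 3)"
      by (simp add: z_def power_divide power2_eq_square power3_eq_cube)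
    also have "3 * Z * (A / real n)\<^sup>2 = 3 * Z * A\<^sup>2 * inverse (real n ^ 2)"
      by (simp only: power_divide divide_inverse[of "A\<^sup>2"] mult.assoc)
    finally show ?thesis by (simp only: distrib_right add.assoc)
  qed
  have "summable (\<lambda>n. 3 * A * ((x n)\<^sup>2 / real n ^ 3) + (3 * Z * A\<^sup>2 + A ^ 3) * inverse (real n ^ 2))"
    by (intro summable_add summable_mult sq inverse_power_summable) auto
  then have "summable (\<lambda>n. z (Suc n) ^ 3 - z n ^ 3)"
    by (rule summable_comparison_test_ev[rotated]) (use step in \<open>auto simp: eventually_at_top_linorder\<close>)
  then have "convergent (\<lambda>n. \<Sum>k<n. z (Suc k) ^ 3 - z k ^ 3)" by (simp add: summable_iff_convergent)
  then have "convergent (\<lambda>n. z n ^ 3 - z 0 ^ 3)"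
    by (simp only: sum_lessThan_telescope[of "\<lambda>n. z n ^ 3"])
  then obtain l where "(\<lambda>n. z n ^ 3 - z 0 ^ 3) \<longlonglongrightarrow> l" by (auto simp: convergent_def)
  from tendsto_add[OF this tendsto_const[of "z 0 ^ 3"]] obtain l where l: "(\<lambda>n. z n ^ 3) \<longlonglongrightarrow> l" by auto
  have "l = 0"
  proof (rule ccontr)
    assume "l \<noteq> 0"
    then have l0: "\<bar>l\<bar> / 2 < \<bar>l\<bar>" "0 < \<bar>l\<bar>" by auto
    have "eventually (\<lambda>n. \<bar>l\<bar> / 2 < \<bar>z n ^ 3\<bar>) sequentially"
      by (rule order_tendstoD(1)[OF tendsto_rabs[OF l] l0(1)])
    then have ev: "eventually (\<lambda>n. norm (\<bar>l\<bar> / (2 * (Z + 1)) * inverse (real n)) \<le> (x n)\<^sup>2 / real n ^ 3) sequentially"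
      using eventually_ge_at_top[of 1]
    proof eventually_elim
      case (elim n)
      have "\<bar>z n ^ 3\<bar> = (z n)\<^sup>2 * \<bar>z n\<bar>" by (simp add: abs_mult power2_eq_square power3_eq_cube)
      also have "\<dots> \<le> (z n)\<^sup>2 * (Z + 1)" using zZ[OF elim(2)] by (intro mult_left_mono) auto
      finally have "\<bar>l\<bar> / 2 \<le> (z n)\<^sup>2 * (Z + 1)" using elim(1) by linarith
      then have "\<bar>l\<bar> / (2 * (Z + 1)) \<le> (z n)\<^sup>2" using Z0 by (simp add: field_simps)
      then have "\<bar>l\<bar> / (2 * (Z + 1)) * inverse (real n) \<le> (z n)\<^sup>2 * inverse (real n)"
        by (rule mult_right_mono) simp
      also have "\<dots> = (x n)\<^sup>2 / real n ^ 3"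
        by (simp add: z_def power_divide power2_eq_square power3_eq_cube divide_inverse)
      finally show ?case using Z0 by simp
    qed
    have "summable (\<lambda>n. \<bar>l\<bar> / (2 * (Z + 1)) * inverse (real n))"
      by (rule summable_comparison_test_ev[OF ev sq])
    then have "summable (\<lambda>n. inverse (real n))" using l0 Z0 by (subst (asm) summable_cmult_iff) auto
    then show False using not_summable_harmonic[where ?'a = real] by simp
  qed
  have "z \<longlonglongrightarrow> 0"
  proof (rule LIMSEQ_I)
    fix \<epsilon> :: real assume \<epsilon>: "\<epsilon> > 0"
    from LIMSEQ_D[OF l[unfolded \<open>l = 0\<close>], of "\<epsilon> ^ 3"] \<epsilon> obtain N where N: "\<And>n. n \<ge> N \<Longrightarrow> \<bar>z n\<bar> ^ 3 < \<epsilon> ^ 3"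
      by (auto simp: power_abs)
    have "norm (z n - 0) < \<epsilon>" if "n \<ge> N" for n
      using power_less_imp_less_base[OF N[OF that]] \<epsilon> by simp
    then show "\<exists>N. \<forall>n\<ge>N. norm (z n - 0) < \<epsilon>" by blast
  qed
  then show ?thesis by (simp add: z_def[abs_def])
qed

lemma (in prob_space) AE_average_null:
  assumes meas [measurable]: "\<And>n. X n \<in> borel_measurable M"
    and int: "\<And>n. n \<ge> 1 \<Longrightarrow> integrable M (\<lambda>\<omega>. (X n \<omega>)\<^sup>2)"
    and lip: "\<And>n \<omega>. n \<ge> 1 \<Longrightarrow> \<omega> \<in> space M \<Longrightarrow> \<bar>X (Suc n) \<omega> - X n \<omega>\<bar> \<le> c"
    and moment: "\<And>n. n \<ge> 1 \<Longrightarrow> (\<integral>\<omega>. (X n \<omega>)\<^sup>2 \<partial>M) \<le> C * real n powr \<kappa>" and \<kappa>: "\<kappa> < 2"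
  shows "AE \<omega> in M. (\<lambda>n. X n \<omega> / real n) \<longlonglongrightarrow> (0::real)"
proof -
  define f where "f n \<omega> = (X n \<omega>)\<^sup>2 / real n ^ 3" for n \<omega>
  have f0: "0 \<le> f n \<omega>" for n \<omega> by (simp add: f_def)
  have [measurable]: "f n \<in> borel_measurable M" for n unfolding f_def[abs_def] by measurable
  have intf: "integrable M (f n)" for n
    by (cases "n = 0") (auto simp: f_def[abs_def] int)
  have s: "summable (\<lambda>n. \<integral>\<omega>. f n \<omega> \<partial>M)"
  proof (rule summable_comparison_test_ev)
    show "summable (\<lambda>n. C * real n powr (\<kappa> - 3))"
      using \<kappa> by (intro summable_mult) (simp add: summable_real_powr_iff)
    show "eventually (\<lambda>n. norm (\<integral>\<omega>. f n \<omega> \<partial>M) \<le> C * real n powr (\<kappa> - 3)) sequentially"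
      using eventually_ge_at_top[of 1]
    proof eventually_elim
      case (elim n)
      have "norm (\<integral>\<omega>. f n \<omega> \<partial>M) = (\<integral>\<omega>. (X n \<omega>)\<^sup>2 \<partial>M) / real n ^ 3"
        by (simp add: f_def)
      also have "\<dots> \<le> C * real n powr \<kappa> / real n ^ 3" using moment[OF elim] by (rule divide_right_mono) simp
      also have "\<dots> = C * real n powr (\<kappa> - 3)" using elim by (simp add: powr_diff powr_numeral)
      finally show ?case .
    qed
  qed
  have "(\<integral>\<^sup>+\<omega>. (\<Sum>n. ennreal (f n \<omega>)) \<partial>M) = (\<Sum>n. \<integral>\<^sup>+\<omega>. ennreal (f n \<omega>) \<partial>M)"
    by (rule nn_integral_suminf) measurable
  also have "\<dots> = (\<Sum>n. ennreal (\<integral>\<omega>. f n \<omega> \<partial>M))"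
    using f0 intf by (intro suminf_cong nn_integral_eq_integral) auto
  also have "\<dots> \<noteq> \<infinity>"
  proof -
    have "0 \<le> (\<integral>\<omega>. f n \<omega> \<partial>M)" for n by (rule Bochner_Integration.integral_nonneg) (rule f0)
    then have "(\<Sum>n. ennreal (\<integral>\<omega>. f n \<omega> \<partial>M)) = ennreal (\<Sum>n. \<integral>\<omega>. f n \<omega> \<partial>M)"
      by (rule suminf_ennreal2[OF _ s])
    then show ?thesis by simp
  qed
  finally have "AE \<omega> in M. (\<Sum>n. ennreal (f n \<omega>)) \<noteq> \<infinity>"
    by (intro nn_integral_PInf_AE) auto
  then show ?thesis
    using AE_space
  proof eventually_elim
    case (elim \<omega>)
    have "summable (\<lambda>n. f n \<omega>)" using elim(1) f0 by (intro summable_suminf_not_top) auto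
    then show ?case
      using lip[OF _ elim(2)] by (intro average_null_if_summable_squares[of "\<lambda>n. X n \<omega>" c]) (auto simp: f_def)
  qed
qed

context pa_process
begin

text \<open>
  Adding a suitable multiple of the total weight to \<open>h\<close> absorbs the constant \<open>c\<close>.
\<close>

lemma growth_comparison:
  assumes rec: "\<And>n. n \<ge> 1 \<Longrightarrow> h (Suc n) \<le> h n * (1 + y / w n) + c"
    and y: "y > 1 + \<alpha>" and c: "c \<ge> 0" and n: "n \<ge> 1"
  shows "h n \<le> (h 1 + c / (y - (1 + \<alpha>))) * growth \<alpha> y n"
proof -
  define k where "k = c / (y - (1 + \<alpha>))"
  have k0: "k \<ge> 0" and "k * (y - (1 + \<alpha>)) = c" using y c by (simp_all add: k_def)
  then have k: "k \<ge> 0" "c = k * y - k * (1 + \<alpha>)" by (simp_all add: right_diff_distrib)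
  have "h n + k * w n \<le> (h 1 + k) * growth \<alpha> y n"
    using n
  proof (induction n rule: nat_induct_at_least)
    case base
    show ?case by simp
  next
    case (Suc n)
    have w: "w n \<ge> 1" by (rule w_ge_1[OF Suc.hyps])
    have "h (Suc n) + k * w (Suc n) \<le> (h n + k * w n) * (1 + y / w n)"
      using rec[OF Suc.hyps] w unfolding total_weight_Suc by (simp add: k(2) field_simps)
    also have "\<dots> \<le> (h 1 + k) * growth \<alpha> y n * (1 + y / w n)"
      using Suc.IH w y alpha_gt by (intro mult_right_mono) auto
    finally show ?case by (simp add: growth_Suc[OF Suc.hyps] mult.assoc)
  qed
  moreover have "0 \<le> k * w n" using k w_ge_1[OF n] by simp
  ultimately show ?thesis unfolding k_def by linarith
qed

definition cluster_diff_sq :: "nat \<Rightarrow> real" where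
  "cluster_diff_sq n = (\<integral>\<omega>. (walk 0 (- 1) n \<omega>)\<^sup>2 \<partial>M)"

lemma cluster_diff_sq_Suc:
  assumes n: "n \<ge> 1"
  shows "cluster_diff_sq (Suc n) =
    cluster_diff_sq n - 2 * (1 - p) * (\<integral>\<omega>. walk 0 (- 1) n \<omega> * drift n \<omega> \<partial>M) + (1 - p)"
  unfolding cluster_diff_sq_def walk_Suc[OF n] second_moment_step[OF n adapted_walk[OF n]]
  by (simp add: algebra_simps)

lemma step_var_eq: "step_var = p * (1 + \<alpha>)\<^sup>2 + (1 - p) * (\<alpha> - 1)\<^sup>2"
  by (simp add: step_var_def power2_eq_square algebra_simps)

lemma step_var_nonneg: "step_var \<ge> 0"
  unfolding step_var_eq using p_nonneg p_le_1 by simp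

text \<open>
  Below the degenerate value \<open>p = 1\<close> the drift of the walks is too weak for growth of order \<open>n\<close>.
  The two second moments are bounded together, because their recursions involve the mixed moment.
\<close>

lemma moments_subquadratic:
  assumes p1: "p < 1"
  obtains C \<kappa> where "\<kappa> < 2"
    "\<And>n. n \<ge> 1 \<Longrightarrow> imbalance_sq n \<le> C * real n powr \<kappa>"
    "\<And>n. n \<ge> 1 \<Longrightarrow> cluster_diff_sq n \<le> C * real n powr \<kappa>"
proof -
  \<comment> \<open>The rate \<open>y\<close> exceeds the rate \<open>2 \<xi>\<close> of the homogeneous recursion and the rate \<open>1 + \<alpha>\<close> of the total
    weight, but stays below the rate \<open>2 (1 + \<alpha>)\<close> of its square.\<close>
  define y where "y = (1 + \<alpha>) + max \<xi> ((1 + \<alpha>) / 2)"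
  have y: "y > 1 + \<alpha>" "y > 2 * \<xi>" "y < 2 * (1 + \<alpha>)" "y > 0"
  proof -
    define z where "z = max \<xi> ((1 + \<alpha>) / 2)"
    have z: "\<xi> \<le> z" "(1 + \<alpha>) / 2 \<le> z" by (auto simp: z_def)
    have "\<xi> < 1 + \<alpha>" using p1 by (simp add: \<xi>_def)
    then have z': "z < 1 + \<alpha>" using alpha_gt by (simp add: z_def)
    have y: "y = (1 + \<alpha>) + z" by (simp add: y_def z_def)
    show "y > 1 + \<alpha>" using y z alpha_gt by argo
    show "y > 2 * \<xi>" using y z \<open>\<xi> < 1 + \<alpha>\<close> by linarith
    show "y < 2 * (1 + \<alpha>)" using y z' by argo
    show "y > 0" using y z alpha_gt by argo
  qed
  \<comment> \<open>With this weight the gap between the rates \<open>2 \<xi>\<close> and \<open>y\<close> absorbs the share \<open>1 / y\<close> of the mixed moment.\<close>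
  define \<theta> where "\<theta> = 1 / (y * (y - 2 * \<xi>))"
  have \<theta>: "\<theta> > 0" using y by (simp add: \<theta>_def)
  define h where "h n = cluster_diff_sq n + \<theta> * imbalance_sq n" for n
  define c where "c = (1 - p) + \<theta> * step_var"
  have c: "c \<ge> 0" using p1 \<theta> step_var_nonneg by (simp add: c_def)
  have rec: "h (Suc n) \<le> h n * (1 + y / w n) + c" if n: "n \<ge> 1" for n
  proof -
    have w: "w n \<ge> 1" by (rule w_ge_1[OF n])
    let ?L = "walk 0 (- 1) n" and ?D = "imbalance n"
    have sq: "adapted n (\<lambda>\<omega>. (walk u v n \<omega>)\<^sup>2)" for u v by (rule adapted_comp[OF adapted_walk[OF n]])
    have mix: "adapted n (\<lambda>\<omega>. ?L \<omega> * drift n \<omega>)" by (rule adapted_comp2[OF adapted_walk[OF n] adapted_drift[OF n]])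
    have "(\<integral>\<omega>. - 2 * (1 - p) * (?L \<omega> * drift n \<omega>) \<partial>M) \<le> (\<integral>\<omega>. (y * (?L \<omega>)\<^sup>2 + 1 / y * (?D \<omega>)\<^sup>2) / w n \<partial>M)"
    proof (rule integral_mono)
      show "integrable M (\<lambda>\<omega>. - 2 * (1 - p) * (?L \<omega> * drift n \<omega>))"
        by (intro integrable_mult_right integrable_adapted[OF mix])
      show "integrable M (\<lambda>\<omega>. (y * (?L \<omega>)\<^sup>2 + 1 / y * (?D \<omega>)\<^sup>2) / w n)"
        by (intro integrable_divide Bochner_Integration.integrable_add integrable_mult_right integrable_adapted[OF sq])
      fix \<omega>
      have "0 \<le> y * (?L \<omega> + (1 - p) * ?D \<omega> / y)\<^sup>2" using y by simp
      also have "\<dots> = y * (?L \<omega>)\<^sup>2 + 2 * (1 - p) * (?L \<omega> * ?D \<omega>) + (1 - p)\<^sup>2 / y * (?D \<omega>)\<^sup>2"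
        using y by (simp add: power2_eq_square field_simps)
      also have "(1 - p)\<^sup>2 / y * (?D \<omega>)\<^sup>2 \<le> 1 / y * (?D \<omega>)\<^sup>2"
        using y p_nonneg p_le_1 by (intro mult_right_mono divide_right_mono) (auto simp: power_le_one)
      finally have "- 2 * (1 - p) * (?L \<omega> * ?D \<omega>) \<le> y * (?L \<omega>)\<^sup>2 + 1 / y * (?D \<omega>)\<^sup>2" by linarith
      then have "- 2 * (1 - p) * (?L \<omega> * ?D \<omega>) / w n \<le> (y * (?L \<omega>)\<^sup>2 + 1 / y * (?D \<omega>)\<^sup>2) / w n"
        using w by (intro divide_right_mono) auto
      then show "- 2 * (1 - p) * (?L \<omega> * drift n \<omega>) \<le> (y * (?L \<omega>)\<^sup>2 + 1 / y * (?D \<omega>)\<^sup>2) / w n"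
        by (simp add: drift_def)
    qed
    also have "\<dots> = (y * cluster_diff_sq n + 1 / y * imbalance_sq n) / w n"
      using integrable_adapted[OF sq] by (simp add: cluster_diff_sq_def imbalance_sq_def)
    finally have "- 2 * (1 - p) * (\<integral>\<omega>. ?L \<omega> * drift n \<omega> \<partial>M) \<le> (y * cluster_diff_sq n + 1 / y * imbalance_sq n) / w n"
      by simp
    then have "h (Suc n) \<le> cluster_diff_sq n + (y * cluster_diff_sq n + 1 / y * imbalance_sq n) / w n
        + (1 - p) + \<theta> * (imbalance_sq n * (1 + 2 * \<xi> / w n) + step_var)"
      unfolding h_def cluster_diff_sq_Suc[OF n] imbalance_sq_Suc[OF n] by linarith
    also have "1 / y = \<theta> * (y - 2 * \<xi>)" using y by (simp add: \<theta>_def)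
    also have "cluster_diff_sq n + (y * cluster_diff_sq n + \<theta> * (y - 2 * \<xi>) * imbalance_sq n) / w n
        + (1 - p) + \<theta> * (imbalance_sq n * (1 + 2 * \<xi> / w n) + step_var) = h n * (1 + y / w n) + c"
      using w by (simp add: h_def c_def field_simps)
    finally show ?thesis .
  qed
  obtain G where G: "G > 0" "\<And>n. n \<ge> 1 \<Longrightarrow> growth \<alpha> y n \<le> G * real n powr (y / (1 + \<alpha>))"
    using growth_bound[OF alpha_gt, of y] y by auto
  define K where "K = h 1 + c / (y - (1 + \<alpha>))"
  have nonneg: "imbalance_sq n \<ge> 0" "cluster_diff_sq n \<ge> 0" for n
    by (auto simp: imbalance_sq_def cluster_diff_sq_def)
  have K: "K \<ge> 0" using nonneg c y \<theta> by (simp add: K_def h_def)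
  have h: "h n \<le> K * G * real n powr (y / (1 + \<alpha>))" if n: "n \<ge> 1" for n
  proof -
    have "h n \<le> K * growth \<alpha> y n" unfolding K_def by (rule growth_comparison[OF rec y(1) c n])
    also have "\<dots> \<le> K * (G * real n powr (y / (1 + \<alpha>)))" by (intro mult_left_mono G(2) n K)
    finally show ?thesis by simp
  qed
  show ?thesis
  proof (rule that)
    show "y / (1 + \<alpha>) < 2" using y alpha_gt by (simp add: field_simps)
    fix n :: nat assume n: "n \<ge> 1"
    let ?P = "real n powr (y / (1 + \<alpha>))"
    have P: "0 \<le> K * G * ?P" using K G by simp
    have "\<theta> * imbalance_sq n \<le> K * G * ?P" using h[OF n] nonneg(2)[of n] by (simp add: h_def)
    then have "imbalance_sq n \<le> K * G * ?P / \<theta>" using \<theta> by (simp add: field_simps)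
    also have "\<dots> \<le> K * G * (1 + 1 / \<theta>) * ?P" using P by (simp add: field_simps)
    finally show "imbalance_sq n \<le> K * G * (1 + 1 / \<theta>) * ?P" .
    have "cluster_diff_sq n \<le> K * G * ?P"
      using h[OF n] mult_nonneg_nonneg[OF less_imp_le[OF \<theta>] nonneg(1)[of n]] by (simp add: h_def)
    also have "\<dots> \<le> K * G * (1 + 1 / \<theta>) * ?P" using P \<theta> by (simp add: field_simps)
    finally show "cluster_diff_sq n \<le> K * G * (1 + 1 / \<theta>) * ?P" .
  qed
qed

lemma cluster_diff_sq_subquadratic:
  obtains C \<kappa> where "\<kappa> < 2" "\<And>n. n \<ge> 1 \<Longrightarrow> cluster_diff_sq n \<le> C * real n powr \<kappa>"
proof (cases "p = 1")
  case True
  have "cluster_diff_sq n = 1" if "n \<ge> 1" for n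
    using that
  proof (induction n rule: nat_induct_at_least)
    case base
    show ?case by (simp add: cluster_diff_sq_def prob_space)
  next
    case (Suc n)
    then show ?case using True by (simp add: cluster_diff_sq_Suc)
  qed
  then show ?thesis by (intro that[of 0 1]) auto
next
  case False
  then show ?thesis using moments_subquadratic p_le_1 that by (metis order_le_less)
qed

text \<open>
  The number of flips and the difference of the cluster numbers have bounded increments, so their
  averages are controlled by second moments.
\<close>

theorem strong_law:
  "AE \<omega> in M. (\<lambda>n. (1 / real n) *\<^sub>R cluster_counts par col n \<omega>) \<longlonglongrightarrow> vector [(1 - p) / 2, (1 - p) / 2]"
proof -
  define X where "X n \<omega> = (if n = 0 then 0 else walk 0 (- 1) n \<omega>)" for n \<omega>
  define Y where "Y n \<omega> = (if n = 0 then 0 else 1 + flips n \<omega> - (1 - p) * real n)" for n \<omega>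
  have X: "X n = walk 0 (- 1) n" if "n \<ge> 1" for n using that by (auto simp: X_def)
  have Y: "Y n = (\<lambda>\<omega>. 1 + flips n \<omega> - (1 - p) * real n)" if "n \<ge> 1" for n using that by (auto simp: Y_def)
  have aX: "adapted n (X n)" for n by (cases "n = 0") (auto simp: X_def[abs_def] adapted_walk)
  have aY: "adapted n (Y n)" for n
    by (cases "n = 0") (auto simp: Y_def[abs_def] intro: adapted_comp[OF adapted_flips])
  have b: "\<bar>parent_sign n \<omega> * flip n \<omega>\<bar> \<le> 1" for n \<omega>
    using parent_sign_cases[of n \<omega>] flip_cases[of n \<omega>] by auto
  obtain C \<kappa> where \<kappa>: "\<kappa> < 2" "\<And>n. n \<ge> 1 \<Longrightarrow> cluster_diff_sq n \<le> C * real n powr \<kappa>"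
    using cluster_diff_sq_subquadratic by blast
  have 1: "AE \<omega> in M. (\<lambda>n. X n \<omega> / real n) \<longlonglongrightarrow> 0"
  proof (rule AE_average_null[where c = 1 and C = C and \<kappa> = \<kappa>])
    show "(\<integral>\<omega>. (X n \<omega>)\<^sup>2 \<partial>M) \<le> C * real n powr \<kappa>" if "n \<ge> 1" for n
      using \<kappa>(2)[OF that] by (simp add: X[OF that] cluster_diff_sq_def)
    show "\<bar>X (Suc n) \<omega> - X n \<omega>\<bar> \<le> 1" if "n \<ge> 1" for n \<omega>
      using that b[of n \<omega>] by (simp add: X walk_Suc)
    show "X n \<in> borel_measurable M" for n by (rule adapted_measurable[OF aX])
    show "integrable M (\<lambda>\<omega>. (X n \<omega>)\<^sup>2)" for n by (rule integrable_adapted[OF adapted_comp[OF aX]])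
  qed (rule \<kappa>(1))
  have 2: "AE \<omega> in M. (\<lambda>n. Y n \<omega> / real n) \<longlonglongrightarrow> 0"
  proof (rule AE_average_null[where c = 1 and C = 1 and \<kappa> = 1])
    show "(\<integral>\<omega>. (Y n \<omega>)\<^sup>2 \<partial>M) \<le> 1 * real n powr 1" if "n \<ge> 1" for n
    proof -
      have "p\<^sup>2 \<le> 1" "p * (1 - p) \<le> 1" using p_nonneg p_le_1 by (auto intro: power_le_one mult_le_one)
      then have "p\<^sup>2 + p * (1 - p) * (real n - 1) \<le> 1 + 1 * (real n - 1)"
        using that by (intro add_mono mult_right_mono) auto
      then show ?thesis using that by (simp add: Y flips_variance)
    qed
    show "\<bar>Y (Suc n) \<omega> - Y n \<omega>\<bar> \<le> 1" if "n \<ge> 1" for n \<omega>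
      using that flip_cases[of n \<omega>] p_nonneg p_le_1 by (auto simp: Y flips_Suc algebra_simps)
    show "Y n \<in> borel_measurable M" for n by (rule adapted_measurable[OF aY])
    show "integrable M (\<lambda>\<omega>. (Y n \<omega>)\<^sup>2)" for n by (rule integrable_adapted[OF adapted_comp[OF aY]])
  qed simp
  from 1 2 AE_space show ?thesis
  proof eventually_elim
    case (elim \<omega>)
    let ?q = "(1 - p) / 2"
    have plus: "(\<lambda>n. ?q + (Y n \<omega> / real n + X n \<omega> / real n) / 2) \<longlonglongrightarrow> ?q + (0 + 0) / 2"
      and minus: "(\<lambda>n. ?q + (Y n \<omega> / real n - X n \<omega> / real n) / 2) \<longlonglongrightarrow> ?q + (0 - 0) / 2"
      by (intro tendsto_intros elim(1,2); simp)+
    have plus': "(\<lambda>n. ?q + (Y n \<omega> / real n + X n \<omega> / real n) / 2) \<longlonglongrightarrow> ?q"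
      using plus by (simp only: add_0_right div_0)
    have minus': "(\<lambda>n. ?q + (Y n \<omega> / real n - X n \<omega> / real n) / 2) \<longlonglongrightarrow> ?q"
      using minus by (simp only: add_0_right diff_self div_0)
    have ev: "eventually (\<lambda>n. (1 / real n) *\<^sub>R cluster_counts par col n \<omega> =
        vector [?q + (Y n \<omega> / real n + X n \<omega> / real n) / 2, ?q + (Y n \<omega> / real n - X n \<omega> / real n) / 2]) sequentially"
      using eventually_ge_at_top[of 1]
    proof eventually_elim
      case (elim n)
      then show ?case
        using \<open>\<omega> \<in> space M\<close>
        by (simp add: cluster_counts_process X Y vec_eq_iff forall_2 field_simps)
    qed
    have "(\<lambda>n. vector [?q + (Y n \<omega> / real n + X n \<omega> / real n) / 2, ?q + (Y n \<omega> / real n - X n \<omega> / real n) / 2] :: real^2)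
        \<longlonglongrightarrow> vector [?q, ?q]"
    proof (rule vec_tendstoI)
      fix i :: 2
      show "(\<lambda>n. (vector [?q + (Y n \<omega> / real n + X n \<omega> / real n) / 2,
          ?q + (Y n \<omega> / real n - X n \<omega> / real n) / 2] :: real^2) $ i) \<longlonglongrightarrow> (vector [?q, ?q] :: real^2) $ i"
        using exhaust_2[of i] plus' minus' by (elim disjE) (simp_all only: vector_2)
    qed
    then show ?case by (rule tendsto_cong[THEN iffD2, OF ev])
  qed
qed

end

section \<open>A central limit theorem by telescoping characteristic functions\<close>

text \<open>
  Silverman-Toeplitz: weighted averages of a null sequence tend to zero when each single weight
  becomes negligible.
\<close>

lemma toeplitz_null:
  fixes A :: "nat \<Rightarrow> nat \<Rightarrow> real"
  assumes nonneg: "\<And>N k. 0 \<le> A N k" and col: "\<And>k. (\<lambda>N. A N k) \<longlonglongrightarrow> 0"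
    and row: "eventually (\<lambda>N. (\<Sum>k\<in>{1..<N}. A N k) \<le> S) sequentially" and r: "r \<longlonglongrightarrow> 0"
  shows "(\<lambda>N. \<Sum>k\<in>{1..<N}. A N k * r k) \<longlonglongrightarrow> 0"
proof (rule tendstoI)
  fix \<epsilon> :: real assume \<epsilon>: "\<epsilon> > 0"
  define \<delta> where "\<delta> = \<epsilon> / (2 * (\<bar>S\<bar> + 1))"
  have \<delta>: "\<delta> > 0" using \<epsilon> by (simp add: \<delta>_def)
  from LIMSEQ_D[OF r \<delta>] obtain m where m: "\<And>k. k \<ge> m \<Longrightarrow> \<bar>r k\<bar> < \<delta>" by auto
  have "(\<lambda>N. \<Sum>k\<in>{1..<m}. A N k * \<bar>r k\<bar>) \<longlonglongrightarrow> 0"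
    by (rule tendsto_null_sum) (rule tendsto_mult_left_zero[OF col])
  then have "eventually (\<lambda>N. (\<Sum>k\<in>{1..<m}. A N k * \<bar>r k\<bar>) < \<epsilon> / 2) sequentially"
    using \<epsilon> by (intro order_tendstoD(2)) auto
  then show "eventually (\<lambda>N. dist (\<Sum>k\<in>{1..<N}. A N k * r k) 0 < \<epsilon>) sequentially"
    using row eventually_ge_at_top[of m]
  proof eventually_elim
    case (elim N)
    have "\<bar>\<Sum>k\<in>{1..<N}. A N k * r k\<bar> \<le> (\<Sum>k\<in>{1..<N}. A N k * \<bar>r k\<bar>)"
      by (rule order_trans[OF sum_abs]) (simp add: abs_mult nonneg)
    also have "\<dots> \<le> (\<Sum>k\<in>{1..<N}. (if k < m then A N k * \<bar>r k\<bar> else 0) + \<delta> * A N k)"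
    proof (rule sum_mono)
      fix k
      show "A N k * \<bar>r k\<bar> \<le> (if k < m then A N k * \<bar>r k\<bar> else 0) + \<delta> * A N k"
        using nonneg[of N k] \<delta> mult_left_mono[OF less_imp_le[OF m[of k]] nonneg[of N k]]
        by (auto simp: mult.commute)
    qed
    also have "\<dots> = (\<Sum>k\<in>{1..<N}. if k < m then A N k * \<bar>r k\<bar> else 0) + \<delta> * (\<Sum>k\<in>{1..<N}. A N k)"
      by (simp add: sum.distrib sum_distrib_left)
    also have "(\<Sum>k\<in>{1..<N}. if k < m then A N k * \<bar>r k\<bar> else 0) = (\<Sum>k\<in>{1..<m}. A N k * \<bar>r k\<bar>)"
      using elim(3) by (intro sum.mono_neutral_cong_right) auto
    also have "\<delta> * (\<Sum>k\<in>{1..<N}. A N k) \<le> \<delta> * (\<bar>S\<bar> + 1)"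
      using elim(2) \<delta> by (intro mult_left_mono) auto
    also have "\<delta> * (\<bar>S\<bar> + 1) = \<epsilon> / 2"
    proof -
      have "\<epsilon> / (2 * T) * T = \<epsilon> / 2" if "T \<noteq> 0" for T :: real using that by simp
      from this[of "\<bar>S\<bar> + 1"] show ?thesis unfolding \<delta>_def by linarith
    qed
    finally show ?case using elim(1) by (simp add: dist_real_def)
  qed
qed

lemma exp_minus_approx:
  fixes x :: real
  assumes "x \<ge> 0"
  shows "\<bar>exp (- x) - (1 - x)\<bar> \<le> x\<^sup>2 / 2"
proof -
  have "exp (- x) * (1 + x + x\<^sup>2 / 2) \<le> exp (- x) * exp x"
    using exp_lower_Taylor_quadratic[OF assms] by (intro mult_left_mono) auto
  also have "\<dots> = 1" by (simp add: exp_minus)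
  also have "1 \<le> 1 + (x\<^sup>2)\<^sup>2 / 4" by simp
  \<comment> \<open>The second factor is a lower bound of \<open>exp x\<close> and cancels.\<close>
  also have "\<dots> = (1 - x + x\<^sup>2 / 2) * (1 + x + x\<^sup>2 / 2)"
    by (simp add: power2_eq_square algebra_simps)
  finally have "exp (- x) \<le> 1 - x + x\<^sup>2 / 2"
    using assms by (simp add: add_nonneg_pos add_pos_nonneg)
  moreover have "1 - x \<le> exp (- x)" using exp_ge_add_one_self[of "- x"] by simp
  ultimately show ?thesis by (simp add: abs_le_iff)
qed

lemma cis_approx: "cmod (cis x - (1 + \<i> * x - x\<^sup>2 / 2)) \<le> \<bar>x\<bar> ^ 3 / 6"
proof -
  have "(\<Sum>k\<le>2. (\<i> * x) ^ k / fact k) = 1 + \<i> * x - x\<^sup>2 / 2"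
    by (simp add: numeral_2_eq_2 power_mult_distrib)
  then show ?thesis using iexp_approx1[of x 2] by (simp add: cis_conv_exp numeral_3_eq_3)
qed

text \<open>
  As the factors \<open>exp (- q k)\<close> are at most 1, the errors of the single steps simply add up.
\<close>

lemma telescoping_product_bound:
  fixes z :: "nat \<Rightarrow> complex"
  assumes step: "\<And>k. 1 \<le> k \<Longrightarrow> k < N \<Longrightarrow> cmod (z (Suc k) - of_real (exp (- q k)) * z k) \<le> err k"
    and q: "\<And>k. 1 \<le> k \<Longrightarrow> k < N \<Longrightarrow> 0 \<le> q k" and n: "1 \<le> n" "n \<le> N"
  shows "cmod (z n - of_real (exp (- (\<Sum>k\<in>{1..<n}. q k))) * z 1) \<le> (\<Sum>k\<in>{1..<n}. err k)"
  using n
proof (induction n rule: nat_induct_at_least)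
  case base
  show ?case by simp
next
  case (Suc n)
  then have n: "1 \<le> n" "n < N" by auto
  let ?E = "\<lambda>n. complex_of_real (exp (- (\<Sum>k\<in>{1..<n}. q k)))"
  have E: "?E (Suc n) = of_real (exp (- q n)) * ?E n"
    using n by (simp add: exp_add[symmetric] of_real_mult[symmetric] del: of_real_mult)
  have "cmod (z (Suc n) - ?E (Suc n) * z 1) =
      cmod ((z (Suc n) - of_real (exp (- q n)) * z n) + of_real (exp (- q n)) * (z n - ?E n * z 1))"
    unfolding E by (simp add: algebra_simps)
  also have "\<dots> \<le> err n + 1 * (\<Sum>k\<in>{1..<n}. err k)"
  proof (rule norm_triangle_le[OF add_mono[OF step[OF n]]])
    have "cmod (of_real (exp (- q n)) * (z n - ?E n * z 1)) = exp (- q n) * cmod (z n - ?E n * z 1)"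
      by (simp add: norm_mult)
    also have "\<dots> \<le> 1 * (\<Sum>k\<in>{1..<n}. err k)" using q[OF n] Suc n by (intro mult_mono) auto
    finally show "cmod (of_real (exp (- q n)) * (z n - ?E n * z 1)) \<le> 1 * (\<Sum>k\<in>{1..<n}. err k)" .
  qed
  finally show ?case using n by simp
qed

context pa_process
begin

text \<open>
  Conditionally on the past, \<open>exp (i \<theta> \<Delta>)\<close> for a centred step \<open>\<Delta>\<close> has almost the deterministic mean
  \<open>exp (- \<theta>\<^sup>2 V / 2)\<close>, where \<open>V\<close> is the variance that the step would have if the drift vanished.
\<close>

lemma cf_step:
  assumes n: "n \<ge> 1" and F: "adapted n F"
    and \<delta>: "\<delta> = u + v * (1 - p)" and J: "\<bar>u\<bar> + \<bar>v\<bar> + \<bar>b\<bar> + \<bar>\<delta>\<bar> \<le> J" and \<theta>: "\<theta> \<ge> 0"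
    and V: "V = p * u\<^sup>2 + (1 - p) * (u + v)\<^sup>2 + b\<^sup>2 * (p * (1 - p))"
  shows "cmod ((\<integral>\<omega>. cis (\<theta> * (F \<omega> + (parent_sign n \<omega> * (u + v * flip n \<omega>) + b * (flip n \<omega> - (1 - p)) - \<delta> * drift n \<omega>))) \<partial>M)
      - of_real (exp (- (\<theta>\<^sup>2 * V / 2))) * (\<integral>\<omega>. cis (\<theta> * F \<omega>) \<partial>M))
    \<le> (\<theta> * J) ^ 3 + (\<theta> * J)\<^sup>2 * (\<integral>\<omega>. \<bar>drift n \<omega>\<bar> \<partial>M) + (\<theta> * J) ^ 4"
proof -
  define \<rho> where "\<rho> = drift n"
  define I where "I \<sigma> e \<omega> = \<sigma> * (u + v * e) + b * (e - (1 - p)) - \<delta> * \<rho> \<omega>" for \<sigma> e \<omega>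
  define \<Psi> where "\<Psi> = step_mean n (\<lambda>\<sigma> e \<omega>. cis (\<theta> * I \<sigma> e \<omega>))"
  define E where "E = complex_of_real (exp (- (\<theta>\<^sup>2 * V / 2)))"
  have \<rho>: "adapted n \<rho>" unfolding \<rho>_def by (rule adapted_drift[OF n])
  have I: "adapted n (I \<sigma> e)" for \<sigma> e
    unfolding I_def[abs_def]
    by (rule adapted_comp[OF \<rho>, where h = "\<lambda>x. \<sigma> * (u + v * e) + b * (e - (1 - p)) - \<delta> * x"])
  have \<Psi>: "adapted n \<Psi>"
    unfolding \<Psi>_def
    by (rule adapted_step_mean[OF n]) (rule adapted_comp[OF I, where h = "\<lambda>x. cis (\<theta> * x)"])
  have cF: "adapted n (\<lambda>\<omega>. cis (\<theta> * F \<omega>))" by (rule adapted_comp[OF F, where h = "\<lambda>x. cis (\<theta> * x)"])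
  have c\<Psi>: "adapted n (\<lambda>\<omega>. cis (\<theta> * F \<omega>) * \<Psi> \<omega>)" by (rule adapted_comp2[OF cF \<Psi>, where h = "(*)"])
  have "(\<integral>\<omega>. (\<lambda>\<sigma> e \<omega>. cis (\<theta> * F \<omega>) * cis (\<theta> * I \<sigma> e \<omega>)) (parent_sign n \<omega>) (flip n \<omega>) \<omega> \<partial>M) =
      (\<integral>\<omega>. step_mean n (\<lambda>\<sigma> e \<omega>. cis (\<theta> * F \<omega>) * cis (\<theta> * I \<sigma> e \<omega>)) \<omega> \<partial>M)"
    by (intro one_step[OF n alpha_gt] adapted_comp2[OF cF, where h = "(*)"]
        adapted_comp[OF I, where h = "\<lambda>x. cis (\<theta> * x)"])
  also have "step_mean n (\<lambda>\<sigma> e \<omega>. cis (\<theta> * F \<omega>) * cis (\<theta> * I \<sigma> e \<omega>)) = (\<lambda>\<omega>. cis (\<theta> * F \<omega>) * \<Psi> \<omega>)"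
    unfolding \<Psi>_def step_mean_def by (rule ext) (simp only: mult_scaleR_right distrib_left)
  finally have eq: "(\<integral>\<omega>. cis (\<theta> * (F \<omega> + (parent_sign n \<omega> * (u + v * flip n \<omega>) + b * (flip n \<omega> - (1 - p)) - \<delta> * drift n \<omega>))) \<partial>M) =
      (\<integral>\<omega>. cis (\<theta> * F \<omega>) * \<Psi> \<omega> \<partial>M)"
    by (simp only: cis_mult distrib_left I_def \<rho>_def)
  have p: "0 \<le> p" "0 \<le> 1 - p" using p_nonneg p_le_1 by auto
  have close: "cmod (\<Psi> \<omega> - E) \<le> (\<theta> * J) ^ 3 + (\<theta> * J)\<^sup>2 * \<bar>\<rho> \<omega>\<bar> + (\<theta> * J) ^ 4"
    if \<rho>1: "\<bar>\<rho> \<omega>\<bar> \<le> 1" for \<omega>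
  proof -
    define r where "r = \<rho> \<omega>"
    have r: "\<bar>r\<bar> \<le> 1" using that by (simp add: r_def)
    define Q where "Q x = 1 + \<i> * complex_of_real x - (complex_of_real x)\<^sup>2 / 2" for x
    define rem where "rem \<sigma> e = cis (\<theta> * I \<sigma> e \<omega>) - Q (\<theta> * I \<sigma> e \<omega>)" for \<sigma> e
    have Ib: "\<bar>I \<sigma> e \<omega>\<bar> \<le> J" if "\<sigma> \<in> {1, -1}" "e \<in> {0, 1}" for \<sigma> e
    proof -
      have "\<bar>I \<sigma> e \<omega>\<bar> \<le> \<bar>\<sigma> * (u + v * e)\<bar> + \<bar>b * (e - (1 - p))\<bar> + \<bar>\<delta> * r\<bar>"
        unfolding I_def r_def by linarith
      also have "\<bar>\<sigma> * (u + v * e)\<bar> \<le> \<bar>u\<bar> + \<bar>v\<bar>" using that by auto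
      also have "\<bar>b * (e - (1 - p))\<bar> \<le> \<bar>b\<bar>"
        unfolding abs_mult using that p by (intro mult_left_le) auto
      also have "\<bar>\<delta> * r\<bar> \<le> \<bar>\<delta>\<bar>" unfolding abs_mult using r by (intro mult_left_le) auto
      finally show ?thesis using J by linarith
    qed
    have rem: "cmod (rem \<sigma> e) \<le> (\<theta> * J) ^ 3" if "\<sigma> \<in> {1, -1}" "e \<in> {0, 1}" for \<sigma> e
    proof -
      have "cmod (rem \<sigma> e) \<le> \<bar>\<theta> * I \<sigma> e \<omega>\<bar> ^ 3 / 6"
        unfolding rem_def Q_def using cis_approx[of "\<theta> * I \<sigma> e \<omega>"] by simp
      also have "\<dots> \<le> \<bar>\<theta> * I \<sigma> e \<omega>\<bar> ^ 3" by simp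
      also have "\<dots> \<le> (\<theta> * J) ^ 3"
        using Ib[OF that] \<theta> by (intro power_mono) (auto simp: abs_mult mult_left_mono)
      finally show ?thesis .
    qed
    define avg where "avg G = ((1 + r) / 2) *\<^sub>R (p *\<^sub>R G 1 0 + (1 - p) *\<^sub>R G 1 1) +
        ((1 - r) / 2) *\<^sub>R (p *\<^sub>R G (- 1) 0 + (1 - p) *\<^sub>R G (- 1) 1)" for G :: "real \<Rightarrow> real \<Rightarrow> complex"
    have "\<Psi> \<omega> = avg (\<lambda>\<sigma> e. rem \<sigma> e + Q (\<theta> * I \<sigma> e \<omega>))"
      by (simp add: \<Psi>_def step_mean_def avg_def rem_def r_def \<rho>_def)
    also have "\<dots> = avg rem + avg (\<lambda>\<sigma> e. Q (\<theta> * I \<sigma> e \<omega>))"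
      by (simp add: avg_def scaleR_add_right algebra_simps)
    also have "avg (\<lambda>\<sigma> e. Q (\<theta> * I \<sigma> e \<omega>)) = of_real (1 - \<theta>\<^sup>2 * (V + (2 * b * r * v * (p * (1 - p)) - \<delta>\<^sup>2 * r\<^sup>2)) / 2)"
      unfolding avg_def Q_def I_def r_def[symmetric] V \<delta>
      by (simp add: complex_eq_iff power2_eq_square) (simp add: field_simps)
    finally have split: "\<Psi> \<omega> - E = avg rem + of_real ((1 - \<theta>\<^sup>2 * V / 2) - exp (- (\<theta>\<^sup>2 * V / 2))
        - \<theta>\<^sup>2 * (2 * b * r * v * (p * (1 - p)) - \<delta>\<^sup>2 * r\<^sup>2) / 2)"
      by (simp add: E_def algebra_simps diff_divide_distrib add_divide_distrib)
    have 1: "cmod (avg rem) \<le> (\<theta> * J) ^ 3"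
    proof -
      have inner: "cmod (p *\<^sub>R rem \<sigma> 0 + (1 - p) *\<^sub>R rem \<sigma> 1) \<le> (\<theta> * J) ^ 3" if "\<sigma> \<in> {1, -1}" for \<sigma>
      proof -
        have "cmod (p *\<^sub>R rem \<sigma> 0 + (1 - p) *\<^sub>R rem \<sigma> 1) \<le> p * (\<theta> * J) ^ 3 + (1 - p) * (\<theta> * J) ^ 3"
          using rem[OF that, of 0] rem[OF that, of 1] p
          by (intro norm_triangle_le add_mono) (auto intro: mult_left_mono)
        then show ?thesis by (simp add: algebra_simps)
      qed
      have "cmod (avg rem) \<le> (1 + r) / 2 * (\<theta> * J) ^ 3 + (1 - r) / 2 * (\<theta> * J) ^ 3"
        unfolding avg_def using inner[of 1] inner[of "- 1"] r
        by (intro norm_triangle_le add_mono) (auto intro!: mult_left_mono simp: abs_le_iff)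
      then show ?thesis by (simp add: field_simps)
    qed
    have V0: "V \<ge> 0" unfolding V using p by simp
    have VJ: "V \<le> J\<^sup>2"
    proof -
      have uv: "u\<^sup>2 \<le> (\<bar>u\<bar> + \<bar>v\<bar>)\<^sup>2" "(u + v)\<^sup>2 \<le> (\<bar>u\<bar> + \<bar>v\<bar>)\<^sup>2"
        by (intro power2_le_iff_abs_le[THEN iffD2]; simp)+
      have "p * (1 - p) \<le> 1" using p by (intro mult_le_one) auto
      then have "V \<le> p * (\<bar>u\<bar> + \<bar>v\<bar>)\<^sup>2 + (1 - p) * (\<bar>u\<bar> + \<bar>v\<bar>)\<^sup>2 + b\<^sup>2 * 1"
        unfolding V using p uv by (intro add_mono mult_left_mono) auto
      also have "\<dots> = (\<bar>u\<bar> + \<bar>v\<bar>)\<^sup>2 + \<bar>b\<bar>\<^sup>2" by (simp add: algebra_simps)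
      also have "\<dots> \<le> (\<bar>u\<bar> + \<bar>v\<bar> + \<bar>b\<bar>)\<^sup>2" by (simp add: power2_eq_square algebra_simps)
      also have "\<dots> \<le> J\<^sup>2" using J by (intro power_mono) auto
      finally show ?thesis .
    qed
    have 2: "\<bar>(1 - \<theta>\<^sup>2 * V / 2) - exp (- (\<theta>\<^sup>2 * V / 2))\<bar> \<le> (\<theta> * J) ^ 4"
    proof -
      have "\<bar>(1 - \<theta>\<^sup>2 * V / 2) - exp (- (\<theta>\<^sup>2 * V / 2))\<bar> \<le> (\<theta>\<^sup>2 * V / 2)\<^sup>2 / 2"
        using exp_minus_approx[of "\<theta>\<^sup>2 * V / 2"] V0 by (simp add: abs_minus_commute)
      also have "\<dots> \<le> (\<theta>\<^sup>2 * V)\<^sup>2" by (simp add: power_divide)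
      also have "\<dots> \<le> (\<theta>\<^sup>2 * J\<^sup>2)\<^sup>2" using V0 VJ by (intro power_mono mult_left_mono) auto
      finally show ?thesis by (simp add: power_mult_distrib)
    qed
    have 3: "\<bar>\<theta>\<^sup>2 * (2 * b * r * v * (p * (1 - p)) - \<delta>\<^sup>2 * r\<^sup>2) / 2\<bar> \<le> (\<theta> * J)\<^sup>2 * \<bar>r\<bar>"
    proof -
      have "\<bar>2 * b * r * v * (p * (1 - p))\<bar> = 2 * \<bar>b\<bar> * \<bar>v\<bar> * \<bar>r\<bar> * (p * (1 - p))"
        using p by (simp add: abs_mult)
      also have "\<dots> \<le> 2 * \<bar>b\<bar> * \<bar>v\<bar> * \<bar>r\<bar>"
        using p by (intro mult_left_le mult_le_one) auto
      finally have x: "\<bar>2 * b * r * v * (p * (1 - p))\<bar> \<le> 2 * \<bar>b\<bar> * \<bar>v\<bar> * \<bar>r\<bar>" .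
      have "\<delta>\<^sup>2 * r\<^sup>2 = \<delta>\<^sup>2 * (\<bar>r\<bar> * \<bar>r\<bar>)" by (simp add: power2_eq_square[of r])
      also have "\<dots> \<le> \<delta>\<^sup>2 * \<bar>r\<bar>" using r by (intro mult_left_mono mult_left_le) simp_all
      finally have "\<bar>2 * b * r * v * (p * (1 - p)) - \<delta>\<^sup>2 * r\<^sup>2\<bar> \<le> 2 * \<bar>b\<bar> * \<bar>v\<bar> * \<bar>r\<bar> + \<delta>\<^sup>2 * \<bar>r\<bar>"
        using x by (intro order_trans[OF abs_triangle_ineq4] add_mono) auto
      also have "\<dots> = (2 * \<bar>b\<bar> * \<bar>v\<bar> + \<bar>\<delta>\<bar>\<^sup>2) * \<bar>r\<bar>" by (simp add: algebra_simps)
      also have "\<dots> \<le> J\<^sup>2 * \<bar>r\<bar>"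
      proof (rule mult_right_mono)
        have "2 * \<bar>b\<bar> * \<bar>v\<bar> + \<bar>\<delta>\<bar>\<^sup>2 \<le> (\<bar>v\<bar> + \<bar>b\<bar> + \<bar>\<delta>\<bar>)\<^sup>2"
          by (simp add: power2_eq_square algebra_simps)
        also have "\<dots> \<le> J\<^sup>2" using J by (intro power_mono) auto
        finally show "2 * \<bar>b\<bar> * \<bar>v\<bar> + \<bar>\<delta>\<bar>\<^sup>2 \<le> J\<^sup>2" .
      qed simp
      finally have "\<theta>\<^sup>2 * \<bar>2 * b * r * v * (p * (1 - p)) - \<delta>\<^sup>2 * r\<^sup>2\<bar> \<le> \<theta>\<^sup>2 * (J\<^sup>2 * \<bar>r\<bar>)"
        by (rule mult_left_mono) simp
      moreover have "0 \<le> \<theta>\<^sup>2 * (J\<^sup>2 * \<bar>r\<bar>)" by simp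
      ultimately have "\<theta>\<^sup>2 * \<bar>2 * b * r * v * (p * (1 - p)) - \<delta>\<^sup>2 * r\<^sup>2\<bar> / 2 \<le> \<theta>\<^sup>2 * (J\<^sup>2 * \<bar>r\<bar>)"
        by linarith
      then show ?thesis by (simp add: abs_mult power_mult_distrib mult.assoc)
    qed
    show ?thesis
      unfolding split using 1 2 3 norm_triangle_ineq[of "avg rem"]
      by (intro order_trans[OF norm_triangle_ineq]) (simp add: norm_of_real r_def[symmetric] del: of_real_diff)
  qed
  have "(\<integral>\<omega>. cis (\<theta> * F \<omega>) * \<Psi> \<omega> \<partial>M) - E * (\<integral>\<omega>. cis (\<theta> * F \<omega>) \<partial>M) =
      (\<integral>\<omega>. cis (\<theta> * F \<omega>) * (\<Psi> \<omega> - E) \<partial>M)"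
  proof -
    have "(\<integral>\<omega>. cis (\<theta> * F \<omega>) * (\<Psi> \<omega> - E) \<partial>M) = (\<integral>\<omega>. cis (\<theta> * F \<omega>) * \<Psi> \<omega> - E * cis (\<theta> * F \<omega>) \<partial>M)"
      by (rule Bochner_Integration.integral_cong) (simp_all add: algebra_simps)
    also have "\<dots> = (\<integral>\<omega>. cis (\<theta> * F \<omega>) * \<Psi> \<omega> \<partial>M) - (\<integral>\<omega>. E * cis (\<theta> * F \<omega>) \<partial>M)"
      by (intro Bochner_Integration.integral_diff integrable_adapted[OF c\<Psi>] integrable_mult_right integrable_adapted[OF cF])
    finally show ?thesis by simp
  qed
  also have "cmod \<dots> \<le> (\<integral>\<omega>. cmod (cis (\<theta> * F \<omega>) * (\<Psi> \<omega> - E)) \<partial>M)"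
    by (rule integral_norm_bound)
  also have "\<dots> \<le> (\<integral>\<omega>. (\<theta> * J) ^ 3 + (\<theta> * J)\<^sup>2 * \<bar>\<rho> \<omega>\<bar> + (\<theta> * J) ^ 4 \<partial>M)"
  proof (rule integral_mono_AE)
    show "integrable M (\<lambda>\<omega>. cmod (cis (\<theta> * F \<omega>) * (\<Psi> \<omega> - E)))"
      
      by (rule integrable_adapted[OF adapted_comp2[OF cF \<Psi>, where h = "\<lambda>x y. cmod (x * (y - E))"]])
    show "integrable M (\<lambda>\<omega>. (\<theta> * J) ^ 3 + (\<theta> * J)\<^sup>2 * \<bar>\<rho> \<omega>\<bar> + (\<theta> * J) ^ 4)"
      by (rule integrable_adapted[OF adapted_comp[OF \<rho>, where h = "\<lambda>x. (\<theta> * J) ^ 3 + (\<theta> * J)\<^sup>2 * \<bar>x\<bar> + (\<theta> * J) ^ 4"]])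
    show "AE \<omega> in M. cmod (cis (\<theta> * F \<omega>) * (\<Psi> \<omega> - E)) \<le> (\<theta> * J) ^ 3 + (\<theta> * J)\<^sup>2 * \<bar>\<rho> \<omega>\<bar> + (\<theta> * J) ^ 4"
      using AE_drift_le_1[OF n]
    proof eventually_elim
      case (elim \<omega>)
      then show ?case using close[of \<omega>] by (simp add: norm_mult \<rho>_def)
    qed
  qed
  also have "\<dots> = (\<theta> * J) ^ 3 + (\<theta> * J)\<^sup>2 * (\<integral>\<omega>. \<bar>\<rho> \<omega>\<bar> \<partial>M) + (\<theta> * J) ^ 4"
    using integrable_adapted[OF adapted_comp[OF \<rho>, where h = abs]] by (simp add: prob_space)
  finally show ?thesis unfolding eq by (simp add: E_def \<rho>_def)
qed

text \<open>
  The variance of the increment of the compensated process in the step after which the compensating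
  coefficient is \<open>c\<close>, computed as if the drift were zero.
\<close>

definition step_variance :: "real \<Rightarrow> real \<Rightarrow> real \<Rightarrow> real" where
  "step_variance a b c =
     p * (c * (1 + \<alpha>))\<^sup>2 + (1 - p) * (c * (1 + \<alpha>) + (- a - 2 * c))\<^sup>2 + b\<^sup>2 * (p * (1 - p))"

lemma step_variance_nonneg: "0 \<le> step_variance a b c"
  using p_nonneg p_le_1 by (simp add: step_variance_def)

text \<open>
  By the Cauchy-Schwarz inequality it suffices that the second moment of the imbalance is of smaller
  order than the square of the total weight.
\<close>

lemma mean_abs_drift_null:
  assumes p1: "p < 1"
  shows "(\<lambda>n. \<integral>\<omega>. \<bar>drift n \<omega>\<bar> \<partial>M) \<longlonglongrightarrow> 0"
proof -
  obtain C \<kappa> where \<kappa>: "\<kappa> < 2" "\<And>n. n \<ge> 1 \<Longrightarrow> imbalance_sq n \<le> C * real n powr \<kappa>"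
    using moments_subquadratic[OF p1] by metis
  define g where "g = min 1 (1 + \<alpha>)"
  have g: "g > 0" using alpha_gt by (simp add: g_def)
  have wg: "w n \<ge> g * real n" if n: "n \<ge> 1" for n
  proof -
    have "g * (real n - 1) \<le> (1 + \<alpha>) * (real n - 1)" using n by (intro mult_right_mono) (auto simp: g_def)
    moreover have "g \<le> 1" by (simp add: g_def)
    moreover have "w n = (1 + \<alpha>) * (real n - 1) + 1" by (simp add: total_weight_def algebra_simps)
    ultimately show ?thesis by (simp add: algebra_simps)
  qed
  have sq: "(\<integral>\<omega>. \<bar>drift n \<omega>\<bar> \<partial>M)\<^sup>2 \<le> \<bar>C\<bar> / g\<^sup>2 * real n powr (\<kappa> - 2)" if n: "n \<ge> 1" for n
  proof -
    have int: "integrable M (\<lambda>\<omega>. \<bar>drift n \<omega>\<bar>)" "integrable M (\<lambda>\<omega>. \<bar>drift n \<omega>\<bar>\<^sup>2)"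
      using integrable_adapted[OF adapted_comp[OF adapted_drift[OF n], where h = abs]]
        integrable_adapted[OF adapted_comp[OF adapted_drift[OF n], where h = "\<lambda>x. \<bar>x\<bar>\<^sup>2"]] by auto
    have "(\<integral>\<omega>. \<bar>drift n \<omega>\<bar> \<partial>M)\<^sup>2 \<le> (\<integral>\<omega>. \<bar>drift n \<omega>\<bar>\<^sup>2 \<partial>M)"
      using variance_eq[OF int] variance_positive[of "\<lambda>\<omega>. \<bar>drift n \<omega>\<bar>"] by linarith
    also have "\<dots> = imbalance_sq n / (w n)\<^sup>2" by (simp add: drift_def imbalance_sq_def power_divide)
    also have "\<dots> \<le> (\<bar>C\<bar> * real n powr \<kappa>) / (g * real n)\<^sup>2"
    proof (rule frac_le)
      show "imbalance_sq n \<le> \<bar>C\<bar> * real n powr \<kappa>"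
        using \<kappa>(2)[OF n] mult_right_mono[OF abs_ge_self[of C], of "real n powr \<kappa>"] by simp
      show "(g * real n)\<^sup>2 \<le> (w n)\<^sup>2" using wg[OF n] g by (intro power_mono) auto
    qed (use g n in auto)
    also have "\<dots> = \<bar>C\<bar> / g\<^sup>2 * real n powr (\<kappa> - 2)"
      using n by (simp add: powr_diff power_mult_distrib)
    finally show ?thesis .
  qed
  have "(\<lambda>n. \<bar>C\<bar> / g\<^sup>2 * real n powr (\<kappa> - 2)) \<longlonglongrightarrow> \<bar>C\<bar> / g\<^sup>2 * 0"
    using \<kappa>(1) by (intro tendsto_mult_left tendsto_neg_powr filterlim_real_sequentially) auto
  then have lim: "(\<lambda>n. \<bar>C\<bar> / g\<^sup>2 * real n powr (\<kappa> - 2)) \<longlonglongrightarrow> 0" by (simp only: mult_zero_right)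
  have "(\<lambda>n. (\<integral>\<omega>. \<bar>drift n \<omega>\<bar> \<partial>M)\<^sup>2) \<longlonglongrightarrow> 0"
  proof (rule tendsto_sandwich[OF _ _ tendsto_const lim])
    show "eventually (\<lambda>n. 0 \<le> (\<integral>\<omega>. \<bar>drift n \<omega>\<bar> \<partial>M)\<^sup>2) sequentially" by simp
    show "eventually (\<lambda>n. (\<integral>\<omega>. \<bar>drift n \<omega>\<bar> \<partial>M)\<^sup>2 \<le> \<bar>C\<bar> / g\<^sup>2 * real n powr (\<kappa> - 2)) sequentially"
      using eventually_ge_at_top[of 1] by eventually_elim (rule sq)
  qed
  from tendsto_real_sqrt[OF this] show ?thesis by simp
qed

text \<open>
  Adding \<open>c N k\<close> times the imbalance to the quantity of interest turns it, up to time \<open>N\<close>, into a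
  martingale: the recursion for \<open>c N\<close>, solved backwards from \<open>c N N = 0\<close>, cancels the drift. The
  conditional variances of the increments are then deterministic up to errors of the order of the
  drift, which is why characteristic functions telescope without a random normalisation.
\<close>

lemma clt_criterion:
  fixes c :: "nat \<Rightarrow> nat \<Rightarrow> real" and \<beta> \<mu> :: "nat \<Rightarrow> real"
  assumes p1: "p < 1"
    and last: "\<And>N. c N N = 0"
    and rec: "\<And>N k. 1 \<le> k \<Longrightarrow> k < N \<Longrightarrow> c N k = c N (Suc k) + (\<xi> * c N (Suc k) - a * (1 - p)) / w k"
    and \<beta>: "\<And>N. N \<ge> 2 \<Longrightarrow> \<beta> N > 0"
    and \<mu>: "\<And>N k. N \<ge> 2 \<Longrightarrow> 1 \<le> k \<Longrightarrow> k \<le> N \<Longrightarrow> 1 + \<bar>c N k\<bar> \<le> \<mu> N * \<beta> N" "\<mu> \<longlonglongrightarrow> 0"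
    and S: "\<And>N. N \<ge> 2 \<Longrightarrow> (\<Sum>k\<in>{1..<N}. (1 + \<bar>c N (Suc k)\<bar>)\<^sup>2) \<le> S * (\<beta> N)\<^sup>2"
    and V: "(\<lambda>N. (\<Sum>k\<in>{1..<N}. step_variance a b (c N (Suc k))) / (\<beta> N)\<^sup>2) \<longlonglongrightarrow> V"
  shows "(\<lambda>N. \<integral>\<omega>. cis ((a * walk 0 (- 1) N \<omega> + b * (1 + flips N \<omega> - (1 - p) * real N)) / \<beta> N) \<partial>M)
    \<longlonglongrightarrow> of_real (exp (- V / 2))"
proof -
  define r where "r k = (\<integral>\<omega>. \<bar>drift k \<omega>\<bar> \<partial>M)" for k
  \<comment> \<open>The increment from \<open>k\<close> to \<open>k + 1\<close> of the compensated sum \<open>Y\<close> is at most \<open>\<kappa> * (1 + \<bar>c N (k + 1)\<bar>)\<close>.\<close>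
  define \<kappa> where "\<kappa> = 3 + \<alpha> + \<bar>\<xi>\<bar> + 2 * \<bar>a\<bar> + \<bar>b\<bar>"
  have \<kappa>: "\<kappa> > 0" using alpha_gt by (simp add: \<kappa>_def add_pos_nonneg)
  define X where "X N k = (1 + \<bar>c N (Suc k)\<bar>) / \<beta> N" for N k
  define A where "A N k = (if N \<ge> 2 \<and> k < N then (X N k)\<^sup>2 else 0)" for N k
  define Q where "Q N = (\<Sum>k\<in>{1..<N}. (1 / \<beta> N)\<^sup>2 * step_variance a b (c N (Suc k)) / 2)" for N
  define EB where "EB N = \<kappa> ^ 3 * \<mu> N * S + \<kappa>\<^sup>2 * (\<Sum>k\<in>{1..<N}. A N k * r k) + \<kappa> ^ 4 * (\<mu> N)\<^sup>2 * S
      + (\<bar>a\<bar> + \<bar>b\<bar> + 1) * \<mu> N" for N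
  let ?z = "\<lambda>N. \<integral>\<omega>. cis ((a * walk 0 (- 1) N \<omega> + b * (1 + flips N \<omega> - (1 - p) * real N)) / \<beta> N) \<partial>M"
  have A0: "0 \<le> A N k" for N k by (simp add: A_def)
  have Xmu: "0 \<le> X N k" "X N k \<le> \<mu> N" if "N \<ge> 2" "1 \<le> Suc k" "k < N" for N k
    using \<mu>(1)[OF that(1), of "Suc k"] \<beta>[OF that(1)] that by (auto simp: X_def field_simps)
  have A_row: "(\<Sum>k\<in>{1..<N}. A N k) \<le> S" if N: "N \<ge> 2" for N
  proof -
    have "(\<Sum>k\<in>{1..<N}. A N k) = (\<Sum>k\<in>{1..<N}. (1 + \<bar>c N (Suc k)\<bar>)\<^sup>2) / (\<beta> N)\<^sup>2"
      unfolding sum_divide_distrib using N by (intro sum.cong) (auto simp: A_def X_def power_divide)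
    also have "\<dots> \<le> S" using S[OF N] \<beta>[OF N] by (simp add: divide_le_eq)
    finally show ?thesis .
  qed
  have bound: "cmod (?z N - of_real (exp (- Q N))) \<le> EB N" if N: "N \<ge> 2" for N
  proof -
    define \<theta> where "\<theta> = 1 / \<beta> N"
    have \<theta>: "\<theta> > 0" using \<beta>[OF N] by (simp add: \<theta>_def)
    define Y where "Y k \<omega> = a * walk 0 (- 1) k \<omega> + b * (1 + flips k \<omega> - (1 - p) * real k) + c N k * imbalance k \<omega>"
      for k \<omega>
    have Y: "adapted k (Y k)" if k: "k \<ge> 1" for k
      unfolding Y_def[abs_def]
      by (intro adapted_comp2[where h = "(+)"] adapted_comp[OF adapted_walk[OF k], where h = "\<lambda>x. a * x"]
          adapted_comp[OF adapted_walk[OF k], where h = "\<lambda>x. c N k * x"]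
          adapted_comp[OF adapted_flips[OF k], where h = "\<lambda>x. b * (1 + x - (1 - p) * real k)"])
    define u v \<delta> where "u k = c N (Suc k) * (1 + \<alpha>)" and "v k = - a - 2 * c N (Suc k)"
      and "\<delta> k = \<xi> * c N (Suc k) - a * (1 - p)" for k
    have YSuc: "Y (Suc k) \<omega> = Y k \<omega> + (parent_sign k \<omega> * (u k + v k * flip k \<omega>) + b * (flip k \<omega> - (1 - p)) - \<delta> k * drift k \<omega>)"
      if k: "1 \<le> k" "k < N" for k \<omega>
    proof -
      have "c N (Suc k) - c N k = - (\<delta> k / w k)" unfolding rec[OF k] \<delta>_def by simp
      then have "(c N (Suc k) - c N k) * imbalance k \<omega> = - \<delta> k * drift k \<omega>"
        by (simp add: drift_def)
      then show ?thesis
        unfolding Y_def walk_Suc[OF k(1)] flips_Suc[OF k(1)] u_def v_def by (simp add: algebra_simps)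
    qed
    define err where "err k = (\<theta> * (\<kappa> * (1 + \<bar>c N (Suc k)\<bar>))) ^ 3 + (\<theta> * (\<kappa> * (1 + \<bar>c N (Suc k)\<bar>)))\<^sup>2 * r k
        + (\<theta> * (\<kappa> * (1 + \<bar>c N (Suc k)\<bar>))) ^ 4" for k
    have step: "cmod ((\<integral>\<omega>. cis (\<theta> * Y (Suc k) \<omega>) \<partial>M) -
        of_real (exp (- (\<theta>\<^sup>2 * step_variance a b (c N (Suc k)) / 2))) * (\<integral>\<omega>. cis (\<theta> * Y k \<omega>) \<partial>M)) \<le> err k"
      if k: "1 \<le> k" "k < N" for k
      unfolding YSuc[OF k] err_def r_def
    proof (rule cf_step[OF k(1) Y[OF k(1)]])
      show "\<delta> k = u k + v k * (1 - p)" by (simp add: \<delta>_def u_def v_def \<xi>_def algebra_simps)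
      show "\<theta> \<ge> 0" using \<theta> by simp
      show "step_variance a b (c N (Suc k)) = p * (u k)\<^sup>2 + (1 - p) * (u k + v k)\<^sup>2 + b\<^sup>2 * (p * (1 - p))"
        by (simp add: step_variance_def u_def v_def)
      let ?C = "\<bar>c N (Suc k)\<bar>"
      have "\<bar>u k\<bar> = (1 + \<alpha>) * ?C" using alpha_gt by (simp add: u_def abs_mult)
      moreover have "\<bar>v k\<bar> \<le> \<bar>a\<bar> + 2 * ?C" by (simp add: v_def)
      moreover have "\<bar>\<delta> k\<bar> \<le> \<bar>\<xi>\<bar> * ?C + \<bar>a\<bar>"
      proof -
        have "\<bar>\<delta> k\<bar> \<le> \<bar>\<xi> * c N (Suc k)\<bar> + \<bar>a * (1 - p)\<bar>" unfolding \<delta>_def by (rule abs_triangle_ineq4)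
        also have "\<bar>a * (1 - p)\<bar> \<le> \<bar>a\<bar>" unfolding abs_mult using p_nonneg p_le_1 by (intro mult_left_le) auto
        finally show ?thesis by (simp add: abs_mult)
      qed
      moreover have "(1 + \<alpha>) * ?C + (\<bar>a\<bar> + 2 * ?C) + \<bar>b\<bar> + (\<bar>\<xi>\<bar> * ?C + \<bar>a\<bar>) \<le> \<kappa> * (1 + ?C)"
      proof -
        have "\<kappa> * (1 + ?C) - ((1 + \<alpha>) * ?C + (\<bar>a\<bar> + 2 * ?C) + \<bar>b\<bar> + (\<bar>\<xi>\<bar> * ?C + \<bar>a\<bar>)) =
            (3 + \<alpha>) + \<bar>\<xi>\<bar> + (2 * \<bar>a\<bar> + \<bar>b\<bar>) * ?C" by (simp add: \<kappa>_def algebra_simps)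
        also have "0 \<le> \<dots>"
          by (intro add_nonneg_nonneg[of _ "(2 * \<bar>a\<bar> + \<bar>b\<bar>) * ?C"] add_nonneg_nonneg[of "3 + \<alpha>"])
            (use alpha_gt in simp_all)
        finally show ?thesis by (simp only: diff_ge_0_iff_ge)
      qed
      ultimately show "\<bar>u k\<bar> + \<bar>v k\<bar> + \<bar>b\<bar> + \<bar>\<delta> k\<bar> \<le> \<kappa> * (1 + ?C)" by linarith
    qed
    have tele: "cmod ((\<integral>\<omega>. cis (\<theta> * Y N \<omega>) \<partial>M) -
        of_real (exp (- (\<Sum>k\<in>{1..<N}. \<theta>\<^sup>2 * step_variance a b (c N (Suc k)) / 2))) * (\<integral>\<omega>. cis (\<theta> * Y 1 \<omega>) \<partial>M))
        \<le> (\<Sum>k\<in>{1..<N}. err k)"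
      by (rule telescoping_product_bound[where N = N]) (use step step_variance_nonneg N in auto)
    have z: "(\<integral>\<omega>. cis (\<theta> * Y N \<omega>) \<partial>M) = ?z N"
      by (simp add: Y_def last \<theta>_def)
    have Q: "(\<Sum>k\<in>{1..<N}. \<theta>\<^sup>2 * step_variance a b (c N (Suc k)) / 2) = Q N"
      by (simp add: Q_def \<theta>_def)
    have z1: "cmod ((\<integral>\<omega>. cis (\<theta> * Y 1 \<omega>) \<partial>M) - 1) \<le> (\<bar>a\<bar> + \<bar>b\<bar> + 1) * \<mu> N"
    proof -
      have Y1: "\<theta> * \<bar>Y 1 \<omega>\<bar> \<le> (\<bar>a\<bar> + \<bar>b\<bar> + 1) * \<mu> N" for \<omega>
      proof -
        have rs: "\<bar>root_sign col \<omega>\<bar> = 1" by (simp add: root_sign_def)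
        have "\<bar>Y 1 \<omega>\<bar> \<le> \<bar>a * root_sign col \<omega>\<bar> + \<bar>b * p\<bar> + \<bar>c N 1 * root_sign col \<omega>\<bar>"
          by (simp add: Y_def)
        also have "\<dots> \<le> \<bar>a\<bar> + \<bar>b\<bar> + \<bar>c N 1\<bar>"
          using p_nonneg p_le_1 by (simp add: abs_mult rs mult_left_le)
        also have "\<dots> \<le> (\<bar>a\<bar> + \<bar>b\<bar> + 1) * (1 + \<bar>c N 1\<bar>)" by (simp add: algebra_simps)
        also have "\<dots> \<le> (\<bar>a\<bar> + \<bar>b\<bar> + 1) * (\<mu> N * \<beta> N)" using \<mu>(1)[OF N, of 1] N by (intro mult_left_mono) auto
        finally show ?thesis using \<beta>[OF N] by (simp add: \<theta>_def field_simps)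
      qed
      have cY: "adapted 1 (\<lambda>\<omega>. cis (\<theta> * Y 1 \<omega>))" by (rule adapted_comp[OF Y, where h = "\<lambda>x. cis (\<theta> * x)"]) simp
      have "(\<integral>\<omega>. cis (\<theta> * Y 1 \<omega>) \<partial>M) - 1 = (\<integral>\<omega>. cis (\<theta> * Y 1 \<omega>) - 1 \<partial>M)"
        using integrable_adapted[OF cY] by (simp add: prob_space)
      also have "cmod \<dots> \<le> (\<integral>\<omega>. cmod (cis (\<theta> * Y 1 \<omega>) - 1) \<partial>M)" by (rule integral_norm_bound)
      also have "\<dots> \<le> (\<integral>\<omega>. (\<bar>a\<bar> + \<bar>b\<bar> + 1) * \<mu> N \<partial>M)"
      proof (rule integral_mono)
        show "integrable M (\<lambda>\<omega>. cmod (cis (\<theta> * Y 1 \<omega>) - 1))"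
          by (rule integrable_adapted[OF adapted_comp[OF cY, where h = "\<lambda>x. cmod (x - 1)"]])
        fix \<omega>
        have "cmod (cis (\<theta> * Y 1 \<omega>) - 1) \<le> \<bar>\<theta> * Y 1 \<omega>\<bar>"
          using iexp_approx1[of "\<theta> * Y 1 \<omega>" 0] by (simp add: cis_conv_exp)
        then show "cmod (cis (\<theta> * Y 1 \<omega>) - 1) \<le> (\<bar>a\<bar> + \<bar>b\<bar> + 1) * \<mu> N"
          using Y1[of \<omega>] \<theta> by (simp add: abs_mult)
      qed simp
      finally show ?thesis by (simp add: prob_space)
    qed
    have "(\<Sum>k\<in>{1..<N}. err k) \<le> (\<Sum>k\<in>{1..<N}. \<kappa> ^ 3 * \<mu> N * A N k + \<kappa>\<^sup>2 * (A N k * r k) + \<kappa> ^ 4 * (\<mu> N)\<^sup>2 * A N k)"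
    proof (rule sum_mono)
      fix k assume k: "k \<in> {1..<N}"
      have x: "\<theta> * (\<kappa> * (1 + \<bar>c N (Suc k)\<bar>)) = \<kappa> * X N k" by (simp add: \<theta>_def X_def)
      have X: "0 \<le> X N k" "X N k \<le> \<mu> N" using Xmu[OF N, of k] k by auto
      have AX: "A N k = (X N k)\<^sup>2" using N k by (simp add: A_def)
      have "(\<kappa> * X N k) ^ 3 = \<kappa> ^ 3 * (X N k * A N k)" by (simp add: AX power_mult_distrib power2_eq_square power3_eq_cube)
      also have "\<dots> \<le> \<kappa> ^ 3 * (\<mu> N * A N k)"
        using X \<kappa> A0 by (intro mult_left_mono mult_right_mono) auto
      finally have 3: "(\<kappa> * X N k) ^ 3 \<le> \<kappa> ^ 3 * \<mu> N * A N k" by (simp add: mult.assoc)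
      have "(\<kappa> * X N k) ^ 4 = \<kappa> ^ 4 * ((X N k)\<^sup>2 * A N k)" by (simp add: AX power_mult_distrib power2_eq_square power4_eq_xxxx)
      also have "\<dots> \<le> \<kappa> ^ 4 * ((\<mu> N)\<^sup>2 * A N k)"
        using X \<kappa> A0 by (intro mult_left_mono mult_right_mono power_mono) auto
      finally have 4: "(\<kappa> * X N k) ^ 4 \<le> \<kappa> ^ 4 * (\<mu> N)\<^sup>2 * A N k" by (simp add: mult.assoc)
      have "(\<kappa> * X N k)\<^sup>2 * r k = \<kappa>\<^sup>2 * (A N k * r k)" by (simp add: AX power_mult_distrib)
      with 3 4 show "err k \<le> \<kappa> ^ 3 * \<mu> N * A N k + \<kappa>\<^sup>2 * (A N k * r k) + \<kappa> ^ 4 * (\<mu> N)\<^sup>2 * A N k"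
        unfolding err_def x by linarith
    qed
    also have "\<dots> = \<kappa> ^ 3 * \<mu> N * (\<Sum>k\<in>{1..<N}. A N k) + \<kappa>\<^sup>2 * (\<Sum>k\<in>{1..<N}. A N k * r k)
        + \<kappa> ^ 4 * (\<mu> N)\<^sup>2 * (\<Sum>k\<in>{1..<N}. A N k)"
      by (simp only: sum.distrib sum_distrib_left)
    also have "\<dots> \<le> \<kappa> ^ 3 * \<mu> N * S + \<kappa>\<^sup>2 * (\<Sum>k\<in>{1..<N}. A N k * r k) + \<kappa> ^ 4 * (\<mu> N)\<^sup>2 * S"
      using A_row[OF N] \<kappa> Xmu[OF N, of 1] N by (intro add_mono mult_left_mono) auto
    finally have err: "(\<Sum>k\<in>{1..<N}. err k) \<le> \<kappa> ^ 3 * \<mu> N * S + \<kappa>\<^sup>2 * (\<Sum>k\<in>{1..<N}. A N k * r k) + \<kappa> ^ 4 * (\<mu> N)\<^sup>2 * S" .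
    have Q0: "Q N \<ge> 0" unfolding Q_def by (intro sum_nonneg) (simp add: step_variance_nonneg)
    have "?z N - of_real (exp (- Q N)) = (?z N - of_real (exp (- Q N)) * (\<integral>\<omega>. cis (\<theta> * Y 1 \<omega>) \<partial>M))
        + of_real (exp (- Q N)) * ((\<integral>\<omega>. cis (\<theta> * Y 1 \<omega>) \<partial>M) - 1)"
      by (simp add: algebra_simps)
    also have "cmod \<dots> \<le> (\<Sum>k\<in>{1..<N}. err k) + 1 * ((\<bar>a\<bar> + \<bar>b\<bar> + 1) * \<mu> N)"
    proof (rule norm_triangle_le[OF add_mono])
      show "cmod (?z N - of_real (exp (- Q N)) * (\<integral>\<omega>. cis (\<theta> * Y 1 \<omega>) \<partial>M)) \<le> (\<Sum>k\<in>{1..<N}. err k)"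
        using tele unfolding z Q .
      have "cmod (of_real (exp (- Q N)) * ((\<integral>\<omega>. cis (\<theta> * Y 1 \<omega>) \<partial>M) - 1)) =
          exp (- Q N) * cmod ((\<integral>\<omega>. cis (\<theta> * Y 1 \<omega>) \<partial>M) - 1)" by (simp add: norm_mult)
      also have "\<dots> \<le> 1 * ((\<bar>a\<bar> + \<bar>b\<bar> + 1) * \<mu> N)" using Q0 z1 by (intro mult_mono) auto
      finally show "cmod (of_real (exp (- Q N)) * ((\<integral>\<omega>. cis (\<theta> * Y 1 \<omega>) \<partial>M) - 1)) \<le> 1 * ((\<bar>a\<bar> + \<bar>b\<bar> + 1) * \<mu> N)" .
    qed
    finally show ?thesis using err unfolding EB_def by linarith
  qed
  have A_col: "(\<lambda>N. A N k) \<longlonglongrightarrow> 0" for k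
  proof (rule tendsto_sandwich[OF _ _ tendsto_const])
    show "(\<lambda>N. (\<mu> N)\<^sup>2) \<longlonglongrightarrow> 0" using tendsto_power[OF \<mu>(2), of 2] by simp
    show "eventually (\<lambda>N. A N k \<le> (\<mu> N)\<^sup>2) sequentially"
      using eventually_ge_at_top[of "k + 2"]
    proof eventually_elim
      case (elim N)
      then show ?case using Xmu[of N k] by (auto simp: A_def intro: power_mono)
    qed
  qed (simp add: A0)
  have "(\<lambda>N. \<Sum>k\<in>{1..<N}. A N k * r k) \<longlonglongrightarrow> 0"
  proof (rule toeplitz_null[OF A0 A_col])
    show "eventually (\<lambda>N. (\<Sum>k\<in>{1..<N}. A N k) \<le> S) sequentially"
      using eventually_ge_at_top[of 2] by eventually_elim (rule A_row)
    show "r \<longlonglongrightarrow> 0" unfolding r_def[abs_def] by (rule mean_abs_drift_null[OF p1])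
  qed
  then have "EB \<longlonglongrightarrow> \<kappa> ^ 3 * 0 * S + \<kappa>\<^sup>2 * 0 + \<kappa> ^ 4 * 0\<^sup>2 * S + (\<bar>a\<bar> + \<bar>b\<bar> + 1) * 0"
    unfolding EB_def[abs_def] by (intro tendsto_intros \<mu>(2))
  then have EB: "EB \<longlonglongrightarrow> 0" by simp
  have close: "(\<lambda>N. ?z N - of_real (exp (- Q N))) \<longlonglongrightarrow> 0"
    by (rule Lim_null_comparison[OF _ EB]) (use bound in \<open>auto simp: eventually_at_top_linorder\<close>)
  have "(\<lambda>N. complex_of_real (exp (- Q N))) \<longlonglongrightarrow> of_real (exp (- V / 2))"
  proof -
    have "Q N = (\<Sum>k\<in>{1..<N}. step_variance a b (c N (Suc k))) / (\<beta> N)\<^sup>2 / 2" for N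
      unfolding Q_def sum_divide_distrib by (intro sum.cong) (auto simp: power_divide)
    then have "(\<lambda>N. - Q N) \<longlonglongrightarrow> - V / 2" using tendsto_minus[OF tendsto_divide[OF V tendsto_const[of 2]]] by simp
    then show ?thesis by (intro tendsto_of_real tendsto_exp)
  qed
  from tendsto_add[OF close this] show ?thesis by simp
qed

end

lemma harmonic_log: "(\<lambda>N. (\<Sum>k\<in>{1..<N}. 1 / real k) / ln (real N)) \<longlonglongrightarrow> 1"
proof -
  have ln_inf: "filterlim (\<lambda>N. ln (real N)) at_top sequentially"
    by (rule filterlim_compose[OF ln_at_top filterlim_real_sequentially])
  have 1: "(\<lambda>N. (harm N - ln (real N) - 1 / real N) / ln (real N)) \<longlonglongrightarrow> 0"
    by (rule tendsto_divide_0[OF tendsto_diff[OF euler_mascheroni_LIMSEQ lim_1_over_n]])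
      (rule filterlim_at_top_imp_at_infinity[OF ln_inf])
  have "(\<lambda>N. (harm N - ln (real N) - 1 / real N) / ln (real N) + 1) \<longlonglongrightarrow> 0 + 1"
    by (intro tendsto_add 1 tendsto_const)
  moreover have "eventually (\<lambda>N. (\<Sum>k\<in>{1..<N}. 1 / real k) / ln (real N) =
      (harm N - ln (real N) - 1 / real N) / ln (real N) + 1) sequentially"
    using eventually_ge_at_top[of 2]
  proof eventually_elim
    case (elim N)
    have "{1..N} = insert N {1..<N}" using elim by auto
    then have "harm N = (\<Sum>k\<in>{1..<N}. 1 / real k) + 1 / real N"
      by (simp add: harm_def inverse_eq_divide)
    moreover have "ln (real N) \<noteq> 0" using elim by simp
    ultimately show ?case by (simp add: field_simps)
  qed
  ultimately show ?thesis by (simp add: tendsto_cong)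
qed

text \<open>
  A sequence asymptotic to \<open>l / k\<close> has partial sums asymptotic to \<open>l * ln N\<close>.
\<close>

lemma log_average:
  fixes u :: "nat \<Rightarrow> real"
  assumes u: "(\<lambda>k. real k * u k) \<longlonglongrightarrow> l"
  shows "(\<lambda>N. (\<Sum>k\<in>{1..<N}. u k) / ln (real N)) \<longlonglongrightarrow> l"
proof -
  define A where "A N k = (if N \<ge> 2 then (1 / real k) / ln (real N) else 0)" for N k
  have ln_inf: "filterlim (\<lambda>N. ln (real N)) at_top sequentially"
    by (rule filterlim_compose[OF ln_at_top filterlim_real_sequentially])
  have "(\<lambda>N. \<Sum>k\<in>{1..<N}. A N k * (real k * u k - l)) \<longlonglongrightarrow> 0"
  proof (rule toeplitz_null[where S = 2])
    show "0 \<le> A N k" for N k by (simp add: A_def)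
    show "(\<lambda>N. A N k) \<longlonglongrightarrow> 0" for k
    proof -
      have "(\<lambda>N. (1 / real k) / ln (real N)) \<longlonglongrightarrow> 0"
        by (rule tendsto_divide_0[OF tendsto_const filterlim_at_top_imp_at_infinity[OF ln_inf]])
      moreover have "eventually (\<lambda>N. A N k = (1 / real k) / ln (real N)) sequentially"
        using eventually_ge_at_top[of 2] by eventually_elim (simp add: A_def)
      ultimately show ?thesis by (simp add: tendsto_cong)
    qed
    show "eventually (\<lambda>N. (\<Sum>k\<in>{1..<N}. A N k) \<le> 2) sequentially"
      using order_tendstoD(2)[OF harmonic_log, of 2, simplified] eventually_ge_at_top[of 2]
    proof eventually_elim
      case (elim N)
      have "(\<Sum>k\<in>{1..<N}. A N k) = (\<Sum>k\<in>{1..<N}. 1 / real k) / ln (real N)"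
        unfolding sum_divide_distrib using elim by (intro sum.cong) (auto simp: A_def)
      then show ?case using elim by simp
    qed
    show "(\<lambda>k. real k * u k - l) \<longlonglongrightarrow> 0" using LIM_zero[OF u] .
  qed
  then have "(\<lambda>N. (\<Sum>k\<in>{1..<N}. A N k * (real k * u k - l)) + l * ((\<Sum>k\<in>{1..<N}. 1 / real k) / ln (real N))) \<longlonglongrightarrow> 0 + l * 1"
    by (intro tendsto_add tendsto_mult tendsto_const harmonic_log)
  moreover have "eventually (\<lambda>N. (\<Sum>k\<in>{1..<N}. u k) / ln (real N) =
      (\<Sum>k\<in>{1..<N}. A N k * (real k * u k - l)) + l * ((\<Sum>k\<in>{1..<N}. 1 / real k) / ln (real N))) sequentially"
    using eventually_ge_at_top[of 2]
  proof eventually_elim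
    case (elim N)
    have "A N k * (real k * u k - l) + l * ((1 / real k) / ln (real N)) = u k / ln (real N)" if "k \<in> {1..<N}" for k
      using elim that by (simp add: A_def field_simps)
    then show ?case
      unfolding sum_divide_distrib sum_distrib_left sum.distrib[symmetric] by (intro sum.cong) auto
  qed
  ultimately show ?thesis by (simp add: tendsto_cong)
qed

lemma sum_inverse_weight_le_growth:
  assumes \<alpha>: "\<alpha> > - 1" and y: "y \<ge> 0" and N: "N \<ge> 1"
  shows "1 + y * (\<Sum>k\<in>{1..<N}. 1 / total_weight \<alpha> k) \<le> growth \<alpha> y N"
  using N
proof (induction N rule: nat_induct_at_least)
  case base
  show ?case by simp
next
  case (Suc N)
  have w: "total_weight \<alpha> N \<ge> 1" by (rule total_weight_ge_1[OF \<alpha> Suc.hyps])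
  have "growth \<alpha> y N * (y / total_weight \<alpha> N) \<ge> 1 * (y / total_weight \<alpha> N)"
    using growth_ge_1[OF \<alpha> y, of N] w y by (intro mult_right_mono) auto
  then show ?case using Suc by (simp add: growth_Suc algebra_simps)
qed

context pa_process
begin

lemma step_variance_expand:
  "step_variance a b c = step_var * c\<^sup>2 - 2 * a * (1 - p) * (\<alpha> - 1) * c + ((1 - p) * a\<^sup>2 + b\<^sup>2 * (p * (1 - p)))"
  by (simp add: step_variance_def step_var_eq power2_eq_square algebra_simps)

text \<open>
  Multiplying the compensating coefficients by the total weights makes their backward recursion
  telescope, which yields their sum without solving the recursion.
\<close>

lemma sum_compensator:
  fixes c :: "nat \<Rightarrow> real"
  assumes last: "c N = 0" and N: "N \<ge> 1"
    and rec: "\<And>k. 1 \<le> k \<Longrightarrow> k < N \<Longrightarrow> c k = c (Suc k) + (\<xi> * c (Suc k) - a * (1 - p)) / w k"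
  shows "2 * (1 - p) * (\<Sum>k\<in>{1..<N}. c (Suc k)) = - c 1 - a * (1 - p) * (real N - 1)"
proof -
  have "w (Suc k) * c (Suc k) - w k * c k = 2 * (1 - p) * c (Suc k) + a * (1 - p)" if k: "k \<in> {1..<N}" for k
  proof -
    have w: "w k \<ge> 1" using k by (intro w_ge_1) auto
    then have "w k * c k = w k * c (Suc k) + (\<xi> * c (Suc k) - a * (1 - p))"
      using rec[of k] k by (simp add: field_simps)
    then show ?thesis by (simp add: total_weight_Suc \<xi>_def algebra_simps)
  qed
  then have "(\<Sum>k\<in>{1..<N}. w (Suc k) * c (Suc k) - w k * c k) =
      (\<Sum>k\<in>{1..<N}. 2 * (1 - p) * c (Suc k) + a * (1 - p))" by (rule sum.cong[OF refl])
  moreover have "(\<Sum>k\<in>{1..<N}. w (Suc k) * c (Suc k) - w k * c k) = w N * c N - w 1 * c 1"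
    using sum_Suc_diff'[OF N, of "\<lambda>k. w k * c k"] .
  moreover have "(\<Sum>k\<in>{1..<N}. 2 * (1 - p) * c (Suc k) + a * (1 - p)) =
      2 * (1 - p) * (\<Sum>k\<in>{1..<N}. c (Suc k)) + a * (1 - p) * (real N - 1)"
    using N by (simp only: sum.distrib sum_distrib_left[symmetric] sum_constant card_atLeastLessThan)
      (simp add: of_nat_diff)
  ultimately show ?thesis using last by simp
qed

lemma sum_compensator_sq:
  fixes c :: "nat \<Rightarrow> real"
  assumes last: "c N = 0" and N: "N \<ge> 1"
    and rec: "\<And>k. 1 \<le> k \<Longrightarrow> k < N \<Longrightarrow> c k = c (Suc k) + (\<xi> * c (Suc k) - a * (1 - p)) / w k"
  shows "(3 - \<alpha> - 4 * p) * (\<Sum>k\<in>{1..<N}. (c (Suc k))\<^sup>2) =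
    - (c 1)\<^sup>2 - 2 * a * (1 - p) * (\<Sum>k\<in>{1..<N}. c (Suc k))
      + (\<Sum>k\<in>{1..<N}. (\<xi> * c (Suc k) - a * (1 - p))\<^sup>2 / w k)"
proof -
  have "w (Suc k) * (c (Suc k))\<^sup>2 - w k * (c k)\<^sup>2 =
      (3 - \<alpha> - 4 * p) * (c (Suc k))\<^sup>2 + 2 * a * (1 - p) * c (Suc k) - (\<xi> * c (Suc k) - a * (1 - p))\<^sup>2 / w k"
    if k: "k \<in> {1..<N}" for k
  proof -
    have w: "w k \<ge> 1" using k by (intro w_ge_1) auto
    define d where "d = \<xi> * c (Suc k) - a * (1 - p)"
    have "w k * (c k)\<^sup>2 = w k * (c (Suc k) + d / w k)\<^sup>2" using rec[of k] k by (simp add: d_def)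
    also have "\<dots> = w k * (c (Suc k))\<^sup>2 + 2 * c (Suc k) * d + d\<^sup>2 / w k"
      using w by (simp add: power2_eq_square field_simps)
    finally have "w (Suc k) * (c (Suc k))\<^sup>2 - w k * (c k)\<^sup>2 =
        (1 + \<alpha>) * (c (Suc k))\<^sup>2 - 2 * c (Suc k) * d - d\<^sup>2 / w k"
      by (simp add: total_weight_Suc algebra_simps)
    then show ?thesis unfolding d_def[symmetric]
      by (simp add: d_def \<xi>_def power2_eq_square algebra_simps)
  qed
  then have "(\<Sum>k\<in>{1..<N}. w (Suc k) * (c (Suc k))\<^sup>2 - w k * (c k)\<^sup>2) =
      (\<Sum>k\<in>{1..<N}. (3 - \<alpha> - 4 * p) * (c (Suc k))\<^sup>2 + 2 * a * (1 - p) * c (Suc k)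
        - (\<xi> * c (Suc k) - a * (1 - p))\<^sup>2 / w k)" by (rule sum.cong[OF refl])
  moreover have "(\<Sum>k\<in>{1..<N}. w (Suc k) * (c (Suc k))\<^sup>2 - w k * (c k)\<^sup>2) = w N * (c N)\<^sup>2 - w 1 * (c 1)\<^sup>2"
    using sum_Suc_diff'[OF N, of "\<lambda>k. w k * (c k)\<^sup>2"] .
  ultimately show ?thesis
    using last by (simp add: sum.distrib sum_subtractf sum_distrib_left)
qed

lemma sum_step_variance:
  assumes "N \<ge> 1"
  shows "(\<Sum>k\<in>{1..<N}. step_variance a b (c (Suc k))) =
    step_var * (\<Sum>k\<in>{1..<N}. (c (Suc k))\<^sup>2) - 2 * a * (1 - p) * (\<alpha> - 1) * (\<Sum>k\<in>{1..<N}. c (Suc k))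
      + ((1 - p) * a\<^sup>2 + b\<^sup>2 * (p * (1 - p))) * (real N - 1)"
  using assms unfolding step_variance_expand
  by (simp only: sum.distrib sum_subtractf sum_distrib_left[symmetric] sum_constant card_atLeastLessThan)
    (simp add: of_nat_diff algebra_simps)

lemma sum_one_plus_abs_sq_le:
  fixes c :: "nat \<Rightarrow> real"
  assumes "N \<ge> 1"
  shows "(\<Sum>k\<in>{1..<N}. (1 + \<bar>c (Suc k)\<bar>)\<^sup>2) \<le> 2 * real N + 2 * (\<Sum>k\<in>{1..<N}. (c (Suc k))\<^sup>2)"
proof -
  have "(\<Sum>k\<in>{1..<N}. (1 + \<bar>c (Suc k)\<bar>)\<^sup>2) \<le> (\<Sum>k\<in>{1..<N}. 2 + 2 * (c (Suc k))\<^sup>2)"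
  proof (rule sum_mono)
    fix k
    have "0 \<le> (1 - \<bar>c (Suc k)\<bar>)\<^sup>2" by simp
    then show "(1 + \<bar>c (Suc k)\<bar>)\<^sup>2 \<le> 2 + 2 * (c (Suc k))\<^sup>2" by (simp add: power2_eq_square algebra_simps)
  qed
  also have "\<dots> \<le> 2 * real N + 2 * (\<Sum>k\<in>{1..<N}. (c (Suc k))\<^sup>2)"
    using assms by (simp add: sum.distrib sum_distrib_left of_nat_diff)
  finally show ?thesis .
qed

text \<open>The coefficients obtained by running the recursion of the central limit criterion backwards from time \<open>N\<close>.\<close>

primrec compensator_rev :: "real \<Rightarrow> nat \<Rightarrow> nat \<Rightarrow> real" where
  "compensator_rev a N 0 = 0"
| "compensator_rev a N (Suc j) =
     compensator_rev a N j + (\<xi> * compensator_rev a N j - a * (1 - p)) / w (N - Suc j)"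

definition compensator :: "real \<Rightarrow> nat \<Rightarrow> nat \<Rightarrow> real" where
  "compensator a N k = compensator_rev a N (N - k)"

lemma compensator_last [simp]: "compensator a N N = 0"
  by (simp add: compensator_def)

lemma compensator_rec:
  assumes "k < N"
  shows "compensator a N k =
    compensator a N (Suc k) + (\<xi> * compensator a N (Suc k) - a * (1 - p)) / w k"
proof -
  have "N - k = Suc (N - Suc k)" "N - Suc (N - Suc k) = k" using assms by auto
  then show ?thesis by (simp add: compensator_def)
qed

text \<open>
  The backward recursion amplifies the coefficients by at most the factors of \<open>growth \<alpha> y\<close>; the
  positive \<open>y\<close> also covers the case \<open>\<xi> \<le> 0\<close>, and the inhomogeneous term is absorbed into the
  additive constant \<open>\<bar>a\<bar> / y\<close>.
\<close>

lemma compensator_bound: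
  assumes y: "y > 0" "\<xi> \<le> y" and k: "1 \<le> k" "k \<le> N"
  shows "\<bar>compensator a N k\<bar> \<le> \<bar>a\<bar> / y * growth \<alpha> y N"
proof -
  define q where "q = \<bar>a\<bar> / y"
  have q: "q \<ge> 0" "q * y = \<bar>a\<bar>" using y by (auto simp: q_def)
  let ?c = "compensator a N"
  have "(\<bar>?c k\<bar> + q) * growth \<alpha> y k \<le> q * growth \<alpha> y N"
    using k(2,1)
  proof (induction k rule: inc_induct)
    case base
    show ?case by simp
  next
    case (step k)
    have w: "w k \<ge> 1" by (rule w_ge_1[OF step.prems])
    have G: "growth \<alpha> y k \<ge> 1" by (rule growth_ge_1[OF alpha_gt]) (use y in simp)
    have "\<bar>1 + \<xi> / w k\<bar> \<le> 1 + y / w k"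
    proof (rule abs_leI)
      show "1 + \<xi> / w k \<le> 1 + y / w k" using y w by (simp add: divide_right_mono)
      have "- \<xi> \<le> 2" using alpha_gt p_nonneg by (simp add: \<xi>_def)
      then have "- \<xi> / w k \<le> 2 / 1" using w by (intro frac_le) auto
      moreover have "0 \<le> y / w k" using y w by simp
      ultimately show "- (1 + \<xi> / w k) \<le> 1 + y / w k" by simp
    qed
    then have 1: "\<bar>?c (Suc k) * (1 + \<xi> / w k)\<bar> \<le> \<bar>?c (Suc k)\<bar> * (1 + y / w k)"
      unfolding abs_mult by (rule mult_left_mono) simp
    have 2: "\<bar>a * (1 - p) / w k\<bar> \<le> q * (y / w k)"
    proof -
      have "\<bar>a * (1 - p)\<bar> \<le> \<bar>a\<bar>" unfolding abs_mult using p_nonneg p_le_1 by (intro mult_left_le) auto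
      then show ?thesis using w q(2) by (simp add: abs_divide divide_right_mono)
    qed
    have "?c k = ?c (Suc k) * (1 + \<xi> / w k) - a * (1 - p) / w k"
      using compensator_rec[OF step.hyps(2), of a]
      by (simp add: distrib_left diff_divide_distrib mult.commute)
    then have "\<bar>?c k\<bar> \<le> \<bar>?c (Suc k)\<bar> * (1 + y / w k) + q * (y / w k)"
      using abs_triangle_ineq4[of "?c (Suc k) * (1 + \<xi> / w k)" "a * (1 - p) / w k"] 1 2 by linarith
    then have "\<bar>?c k\<bar> + q \<le> (\<bar>?c (Suc k)\<bar> + q) * (1 + y / w k)" by (simp add: algebra_simps)
    then have "(\<bar>?c k\<bar> + q) * growth \<alpha> y k \<le> (\<bar>?c (Suc k)\<bar> + q) * (1 + y / w k) * growth \<alpha> y k"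
      using G by (intro mult_right_mono) auto
    also have "\<dots> = (\<bar>?c (Suc k)\<bar> + q) * growth \<alpha> y (Suc k)" by (simp add: growth_Suc[OF step.prems])
    also have "\<dots> \<le> q * growth \<alpha> y N" using step.IH step.prems by simp
    finally show ?case .
  qed
  moreover have "\<bar>?c k\<bar> * 1 \<le> (\<bar>?c k\<bar> + q) * growth \<alpha> y k"
    using q growth_ge_1[OF alpha_gt, of y k] y by (intro mult_mono) auto
  ultimately show ?thesis by (simp add: q_def)
qed

text \<open>
  Choosing \<open>y\<close> strictly between \<open>max \<xi> 0\<close> and \<open>(1 + \<alpha>) / 2\<close> makes all coefficients of smaller order than
  \<open>sqrt N\<close>. The telescoped identities then show that their sum is \<open>- a N / 2\<close> and the sum of their squares
  \<open>a\<^sup>2 (1 - p) N / (3 - \<alpha> - 4 p)\<close> to leading order.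
\<close>

lemma clt_subcritical:
  assumes sub: "4 * p < 3 - \<alpha>"
  shows "(\<lambda>N. \<integral>\<omega>. cis ((a * walk 0 (- 1) N \<omega> + b * (1 + flips N \<omega> - (1 - p) * real N)) / sqrt (real N)) \<partial>M)
    \<longlonglongrightarrow> of_real (exp (- (a\<^sup>2 * ((1 - p) * (1 + \<alpha>) / (3 - \<alpha> - 4 * p)) + b\<^sup>2 * (p * (1 - p))) / 2))"
proof -
  define q where "q = 3 - \<alpha> - 4 * p"
  have q: "q > 0" using sub by (simp add: q_def)
  have p1: "p < 1" using sub alpha_gt by simp
  define y where "y = (max \<xi> 0 + (1 + \<alpha>) / 2) / 2"
  have y: "y > 0" "\<xi> \<le> y" "y < (1 + \<alpha>) / 2"
  proof -
    have x: "\<xi> < (1 + \<alpha>) / 2" using sub by (simp add: \<xi>_def)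
    have g: "0 < (1 + \<alpha>) / 2" using alpha_gt by simp
    have m: "max \<xi> 0 < (1 + \<alpha>) / 2" "\<xi> \<le> max \<xi> 0" "0 \<le> max \<xi> 0" using x g by auto
    show "y > 0" "\<xi> \<le> y" "y < (1 + \<alpha>) / 2" unfolding y_def using m g by argo+
  qed
  define e where "e = y / (1 + \<alpha>)"
  have e: "0 \<le> e" "e < 1 / 2" using y alpha_gt by (auto simp: e_def field_simps)
  \<comment> \<open>A positive rate so small that the logarithmic sum of \<open>1 / w k\<close>, bounded by the power \<open>e'\<close> of \<open>N\<close>,
    leaves the error terms of smaller order than \<open>N\<close>.\<close>
  define y' where "y' = ((1 + \<alpha>) - 2 * y) / 2"
  define e' where "e' = y' / (1 + \<alpha>)"
  have y': "y' > 0" using y by (simp add: y'_def)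
  have ee': "2 * e + e' < 1"
  proof -
    have "2 * e + e' = (2 * y + y') / (1 + \<alpha>)" by (simp add: e_def e'_def add_divide_distrib)
    moreover have "2 * y + y' < 1 + \<alpha>" using y(3) unfolding y'_def by argo
    ultimately show ?thesis using alpha_gt by simp
  qed
  have powr_e_sq: "(real N powr e)\<^sup>2 = real N powr (2 * e)" for N
    by (simp add: power2_eq_square powr_add[symmetric])
  obtain C where C: "C > 0" "\<And>n. n \<ge> 1 \<Longrightarrow> growth \<alpha> y n \<le> C * real n powr e"
    using growth_bound[OF alpha_gt, of y] y unfolding e_def by auto
  obtain C' where C': "C' > 0" "\<And>n. n \<ge> 1 \<Longrightarrow> growth \<alpha> y' n \<le> C' * real n powr e'"
    using growth_bound[OF alpha_gt, of y'] y' unfolding e'_def by auto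
  let ?c = "compensator a"
  define B where "B = 1 + \<bar>a\<bar> / y * C"
  have B: "B > 0" using y C by (simp add: B_def add_pos_nonneg)
  have cB: "1 + \<bar>?c N k\<bar> \<le> B * real N powr e" if "1 \<le> k" "k \<le> N" for N k
  proof -
    have N: "N \<ge> 1" using that by simp
    have "\<bar>?c N k\<bar> \<le> \<bar>a\<bar> / y * (C * real N powr e)"
      using compensator_bound[OF y(1,2) that, of a] C(2)[OF N] y
      by (elim order_trans) (intro mult_left_mono, auto)
    moreover have "1 \<le> real N powr e" using N e by (simp add: ge_one_powr_ge_zero)
    ultimately show ?thesis by (simp add: B_def distrib_right)
  qed
  define s1 where "s1 N = (\<Sum>k\<in>{1..<N}. ?c N (Suc k))" for N
  define s2 where "s2 N = (\<Sum>k\<in>{1..<N}. (?c N (Suc k))\<^sup>2)" for N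
  define T where "T N = (\<Sum>k\<in>{1..<N}. (\<xi> * ?c N (Suc k) - a * (1 - p))\<^sup>2 / w k)" for N
  have pow0: "(\<lambda>N. real N powr s) \<longlonglongrightarrow> 0" if "s < 0" for s
    using that by (intro tendsto_neg_powr filterlim_real_sequentially)
  have c1: "(\<lambda>N. ?c N 1 / real N) \<longlonglongrightarrow> 0"
  proof (rule Lim_null_comparison)
    show "eventually (\<lambda>N. norm (?c N 1 / real N) \<le> B * real N powr (e - 1)) sequentially"
      using eventually_ge_at_top[of 1]
    proof eventually_elim
      case (elim N)
      then show ?case using cB[of 1 N] by (simp add: powr_diff divide_right_mono)
    qed
    show "(\<lambda>N. B * real N powr (e - 1)) \<longlonglongrightarrow> 0" using e by (intro tendsto_mult_right_zero pow0) simp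
  qed
  have c1_sq: "(\<lambda>N. (?c N 1)\<^sup>2 / real N) \<longlonglongrightarrow> 0"
  proof (rule Lim_null_comparison)
    show "eventually (\<lambda>N. norm ((?c N 1)\<^sup>2 / real N) \<le> B\<^sup>2 * real N powr (2 * e - 1)) sequentially"
      using eventually_ge_at_top[of 1]
    proof eventually_elim
      case (elim N)
      have "\<bar>?c N 1\<bar>\<^sup>2 \<le> (B * real N powr e)\<^sup>2" using cB[of 1 N] elim by (intro power_mono) auto
      also have "\<dots> = B\<^sup>2 * real N powr (2 * e)" by (simp only: power_mult_distrib powr_e_sq)
      finally show ?case using elim by (simp add: powr_diff divide_right_mono)
    qed
    show "(\<lambda>N. B\<^sup>2 * real N powr (2 * e - 1)) \<longlonglongrightarrow> 0" using e by (intro tendsto_mult_right_zero pow0) simp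
  qed
  have TN: "(\<lambda>N. T N / real N) \<longlonglongrightarrow> 0"
  proof (rule Lim_null_comparison)
    define K where "K = (\<bar>\<xi>\<bar> + \<bar>a\<bar>)\<^sup>2 * B\<^sup>2 * C' / y'"
    show "eventually (\<lambda>N. norm (T N / real N) \<le> K * real N powr (2 * e + e' - 1)) sequentially"
      using eventually_ge_at_top[of 1]
    proof eventually_elim
      case (elim N)
      have T0: "T N \<ge> 0" unfolding T_def
      proof (rule sum_nonneg)
        fix k assume "k \<in> {1..<N}"
        then have "w k \<ge> 1" by (intro w_ge_1) auto
        then show "0 \<le> (\<xi> * ?c N (Suc k) - a * (1 - p))\<^sup>2 / w k" by simp
      qed
      have "T N \<le> (\<Sum>k\<in>{1..<N}. ((\<bar>\<xi>\<bar> + \<bar>a\<bar>)\<^sup>2 * B\<^sup>2 * real N powr (2 * e)) * (1 / w k))"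
        unfolding T_def
      proof (rule sum_mono)
        fix k assume k: "k \<in> {1..<N}"
        have w: "w k \<ge> 1" using k by (intro w_ge_1) auto
        have "\<bar>\<xi> * ?c N (Suc k) - a * (1 - p)\<bar> \<le> \<bar>\<xi>\<bar> * \<bar>?c N (Suc k)\<bar> + \<bar>a\<bar> * \<bar>1 - p\<bar>"
          using abs_triangle_ineq4[of "\<xi> * ?c N (Suc k)" "a * (1 - p)"] by (simp add: abs_mult)
        also have "\<dots> \<le> \<bar>\<xi>\<bar> * (1 + \<bar>?c N (Suc k)\<bar>) + \<bar>a\<bar> * (1 + \<bar>?c N (Suc k)\<bar>)"
          using p_nonneg p_le_1 by (intro add_mono mult_left_mono) auto
        also have "\<dots> = (\<bar>\<xi>\<bar> + \<bar>a\<bar>) * (1 + \<bar>?c N (Suc k)\<bar>)" by (simp add: algebra_simps)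
        also have "\<dots> \<le> (\<bar>\<xi>\<bar> + \<bar>a\<bar>) * (B * real N powr e)"
          using cB[of "Suc k" N] k by (intro mult_left_mono) auto
        finally have "\<bar>\<xi> * ?c N (Suc k) - a * (1 - p)\<bar>\<^sup>2 \<le> ((\<bar>\<xi>\<bar> + \<bar>a\<bar>) * (B * real N powr e))\<^sup>2"
          by (rule power_mono) simp
        also have "\<dots> = (\<bar>\<xi>\<bar> + \<bar>a\<bar>)\<^sup>2 * B\<^sup>2 * real N powr (2 * e)"
          by (simp only: power_mult_distrib powr_e_sq mult.assoc)
        finally show "(\<xi> * ?c N (Suc k) - a * (1 - p))\<^sup>2 / w k \<le> ((\<bar>\<xi>\<bar> + \<bar>a\<bar>)\<^sup>2 * B\<^sup>2 * real N powr (2 * e)) * (1 / w k)"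
          using w by (simp add: divide_right_mono)
      qed
      also have "\<dots> = ((\<bar>\<xi>\<bar> + \<bar>a\<bar>)\<^sup>2 * B\<^sup>2 * real N powr (2 * e)) * (\<Sum>k\<in>{1..<N}. 1 / w k)"
        by (simp add: sum_distrib_left)
      also have "\<dots> \<le> ((\<bar>\<xi>\<bar> + \<bar>a\<bar>)\<^sup>2 * B\<^sup>2 * real N powr (2 * e)) * (C' * real N powr e' / y')"
      proof (rule mult_left_mono)
        have "y' * (\<Sum>k\<in>{1..<N}. 1 / w k) \<le> C' * real N powr e'"
          using sum_inverse_weight_le_growth[OF alpha_gt, of y' N] y' C'(2)[OF elim] elim by simp
        then show "(\<Sum>k\<in>{1..<N}. 1 / w k) \<le> C' * real N powr e' / y'" using y' by (simp add: field_simps)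
      qed simp
      also have "\<dots> = K * (real N powr (2 * e) * real N powr e')" by (simp add: K_def)
      also have "real N powr (2 * e) * real N powr e' = real N powr (2 * e + e')" by (simp add: powr_add)
      finally have "T N / real N \<le> K * real N powr (2 * e + e') / real N" by (rule divide_right_mono) simp
      also have "\<dots> = K * real N powr (2 * e + e' - 1)" using elim by (simp add: powr_diff)
      finally show ?case using T0 by simp
    qed
    show "(\<lambda>N. K * real N powr (2 * e + e' - 1)) \<longlonglongrightarrow> 0" using ee' by (intro tendsto_mult_right_zero pow0) simp
  qed
  have N1: "(\<lambda>N. (real N - 1) / real N) \<longlonglongrightarrow> 1"
    by real_asymp
  have div1: "(- (c / n) - A * (m / n)) / d = (- c - A * m) / d / n" for c n A m d :: real
    by (simp add: diff_divide_distrib) (simp add: mult.commute)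
  have div2: "(- (c / n) - A * (m / n) + t / n) / d = (- c - A * m + t) / d / n" for c n A m d t :: real
    by (simp add: diff_divide_distrib add_divide_distrib) (simp add: mult.commute)
  have div3: "A * (c / n) - A' * (m / n) + A'' * (t / n) = (A * c - A' * m + A'' * t) / n"
    for A A' A'' c m n t :: real
    by (simp add: diff_divide_distrib add_divide_distrib)
  have s1_lim: "(\<lambda>N. s1 N / real N) \<longlonglongrightarrow> - a / 2"
  proof -
    have "(\<lambda>N. (- (?c N 1 / real N) - a * (1 - p) * ((real N - 1) / real N)) / (2 * (1 - p)))
        \<longlonglongrightarrow> (- 0 - a * (1 - p) * 1) / (2 * (1 - p))"
      using p1 by (intro tendsto_intros c1 N1) auto
    also have "(- 0 - a * (1 - p) * 1) / (2 * (1 - p)) = - a / 2" using p1 by (simp add: divide_simps)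
    finally show ?thesis
    proof (rule Lim_transform_eventually)
      show "eventually (\<lambda>N. (- (?c N 1 / real N) - a * (1 - p) * ((real N - 1) / real N)) / (2 * (1 - p)) = s1 N / real N) sequentially"
        using eventually_ge_at_top[of 1]
      proof eventually_elim
        case (elim N)
        have "2 * (1 - p) * s1 N = - ?c N 1 - a * (1 - p) * (real N - 1)"
          unfolding s1_def by (rule sum_compensator) (use elim compensator_rec in auto)
        then have "s1 N = (- ?c N 1 - a * (1 - p) * (real N - 1)) / (2 * (1 - p))" using p1 by (simp add: field_simps)
        then show ?case by (simp only: div1)
      qed
    qed
  qed
  have s2_lim: "(\<lambda>N. s2 N / real N) \<longlonglongrightarrow> a\<^sup>2 * (1 - p) / q"
  proof -
    have "(\<lambda>N. (- ((?c N 1)\<^sup>2 / real N) - 2 * a * (1 - p) * (s1 N / real N) + T N / real N) / q)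
        \<longlonglongrightarrow> (- 0 - 2 * a * (1 - p) * (- a / 2) + 0) / q"
      using q by (intro tendsto_intros c1_sq s1_lim TN) auto
    also have "(- 0 - 2 * a * (1 - p) * (- a / 2) + 0) / q = a\<^sup>2 * (1 - p) / q" by (simp add: power2_eq_square)
    finally show ?thesis
    proof (rule Lim_transform_eventually)
      show "eventually (\<lambda>N. (- ((?c N 1)\<^sup>2 / real N) - 2 * a * (1 - p) * (s1 N / real N) + T N / real N) / q = s2 N / real N) sequentially"
        using eventually_ge_at_top[of 1]
      proof eventually_elim
        case (elim N)
        have "q * s2 N = - (?c N 1)\<^sup>2 - 2 * a * (1 - p) * s1 N + T N"
          unfolding s1_def s2_def T_def q_def by (rule sum_compensator_sq) (use elim compensator_rec in auto)
        then have "s2 N = (- (?c N 1)\<^sup>2 - 2 * a * (1 - p) * s1 N + T N) / q" using q by (simp add: field_simps)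
        then show ?case by (simp only: div2)
      qed
    qed
  qed
  obtain K where "\<forall>N. norm (s2 N / real N) \<le> K"
    using convergent_imp_Bseq[OF convergentI[OF s2_lim]] by (rule BseqE)
  then have K: "\<And>N. \<bar>s2 N / real N\<bar> \<le> K" by simp
  let ?V = "a\<^sup>2 * ((1 - p) * (1 + \<alpha>) / (3 - \<alpha> - 4 * p)) + b\<^sup>2 * (p * (1 - p))"
  have "(\<lambda>N. \<integral>\<omega>. cis ((a * walk 0 (- 1) N \<omega> + b * (1 + flips N \<omega> - (1 - p) * real N)) / sqrt (real N)) \<partial>M)
    \<longlonglongrightarrow> of_real (exp (- ?V / 2))"
  proof (rule clt_criterion[where c = ?c and \<mu> = "\<lambda>N. B * real N powr (e - 1 / 2)" and S = "2 + 2 * K"])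
    show "p < 1" by (rule p1)
    show "?c N k = ?c N (Suc k) + (\<xi> * ?c N (Suc k) - a * (1 - p)) / w k" if "1 \<le> k" "k < N" for N k
      by (rule compensator_rec[OF that(2)])
    show "0 < sqrt (real N)" if "2 \<le> N" for N using that by simp
    show "1 + \<bar>?c N k\<bar> \<le> B * real N powr (e - 1 / 2) * sqrt (real N)" if "2 \<le> N" "1 \<le> k" "k \<le> N" for N k
    proof -
      have "real N powr (e - 1 / 2) * sqrt (real N) = real N powr e"
        using that by (simp add: powr_half_sqrt[symmetric] powr_add[symmetric])
      then show ?thesis using cB[OF that(2,3)] by (simp add: mult.assoc)
    qed
    show "(\<lambda>N. B * real N powr (e - 1 / 2)) \<longlonglongrightarrow> 0" using e by (intro tendsto_mult_right_zero pow0) simp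
    show "(\<Sum>k\<in>{1..<N}. (1 + \<bar>?c N (Suc k)\<bar>)\<^sup>2) \<le> (2 + 2 * K) * (sqrt (real N))\<^sup>2" if N: "2 \<le> N" for N
    proof -
      have "s2 N \<le> K * real N" using K[of N] N by (simp add: abs_le_iff field_simps)
      then show ?thesis
        using sum_one_plus_abs_sq_le[of N "?c N"] N unfolding s2_def[symmetric] by (simp add: algebra_simps)
    qed
    have "(\<lambda>N. step_var * (s2 N / real N) - 2 * a * (1 - p) * (\<alpha> - 1) * (s1 N / real N)
          + ((1 - p) * a\<^sup>2 + b\<^sup>2 * (p * (1 - p))) * ((real N - 1) / real N))
        \<longlonglongrightarrow> step_var * (a\<^sup>2 * (1 - p) / q) - 2 * a * (1 - p) * (\<alpha> - 1) * (- a / 2)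
          + ((1 - p) * a\<^sup>2 + b\<^sup>2 * (p * (1 - p))) * 1"
      by (intro tendsto_intros s1_lim s2_lim N1)
    also have "step_var * (a\<^sup>2 * (1 - p) / q) - 2 * a * (1 - p) * (\<alpha> - 1) * (- a / 2)
          + ((1 - p) * a\<^sup>2 + b\<^sup>2 * (p * (1 - p))) * 1 = ?V"
    proof -
      have "step_var / q + \<alpha> = (1 + \<alpha>) / q"
        using q by (simp add: field_simps) (simp add: step_var_def q_def power2_eq_square algebra_simps)
      then have r: "step_var / q = (1 + \<alpha>) / q - \<alpha>" by simp
      define z where "z = (1 + \<alpha>) / q"
      have "step_var * (a\<^sup>2 * (1 - p) / q) = (step_var / q) * (a\<^sup>2 * (1 - p))" by simp
      also have "\<dots> = (z - \<alpha>) * (a\<^sup>2 * (1 - p))" unfolding r z_def ..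
      finally have "step_var * (a\<^sup>2 * (1 - p) / q) = (z - \<alpha>) * (a\<^sup>2 * (1 - p))" .
      moreover have "(1 - p) * (1 + \<alpha>) / (3 - \<alpha> - 4 * p) = (1 - p) * z" by (simp add: z_def q_def)
      ultimately show ?thesis by (simp only:) (simp add: power2_eq_square algebra_simps)
    qed
    finally show "(\<lambda>N. (\<Sum>k\<in>{1..<N}. step_variance a b (?c N (Suc k))) / (sqrt (real N))\<^sup>2) \<longlonglongrightarrow> ?V"
    proof (rule Lim_transform_eventually)
      show "eventually (\<lambda>N. step_var * (s2 N / real N) - 2 * a * (1 - p) * (\<alpha> - 1) * (s1 N / real N)
          + ((1 - p) * a\<^sup>2 + b\<^sup>2 * (p * (1 - p))) * ((real N - 1) / real N) =
          (\<Sum>k\<in>{1..<N}. step_variance a b (?c N (Suc k))) / (sqrt (real N))\<^sup>2) sequentially"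
        using eventually_ge_at_top[of 1]
      proof eventually_elim
        case (elim N)
        show ?case
          unfolding sum_step_variance[OF elim, of a b "?c N"] s1_def[symmetric] s2_def[symmetric] div3
          by simp
      qed
    qed
  qed simp
  then show ?thesis .
qed

text \<open>
  Here the telescoped identity for the squares degenerates, but \<open>\<xi>\<close> is positive and the recursion has the
  explicit solution \<open>c N k = (a / 2) (1 - growth N / growth k)\<close>. Since \<open>growth k\<close> is asymptotic to a multiple
  of \<open>sqrt k\<close>, the sum of squares is asymptotic to \<open>(a\<^sup>2 / 4) N ln N\<close>, whereas the sum of the coefficients and
  the flips are negligible on this scale.
\<close>

lemma clt_critical:
  assumes crit: "4 * p = 3 - \<alpha>"
  shows "(\<lambda>N. \<integral>\<omega>. cis ((a * walk 0 (- 1) N \<omega> + b * (1 + flips N \<omega> - (1 - p) * real N)) / sqrt (real N * ln (real N))) \<partial>M)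
    \<longlonglongrightarrow> of_real (exp (- (a\<^sup>2 * ((1 + \<alpha>) / 4)) / 2))"
proof -
  have p1: "p < 1" and onep: "1 - p = (1 + \<alpha>) / 4" using crit alpha_gt by auto
  have x: "\<xi> = (1 + \<alpha>) / 2" using crit by (simp add: \<xi>_def)
  have x0: "\<xi> > 0" using alpha_gt by (simp add: x)
  define G where "G = growth \<alpha> \<xi>"
  have G1: "G n \<ge> 1" for n unfolding G_def by (rule growth_ge_1[OF alpha_gt]) (use x0 in simp)
  define L where "L = Gamma (1 / (1 + \<alpha>)) * rGamma ((1 + \<xi>) / (1 + \<alpha>))"
  have L0: "L > 0"
  proof -
    have "Gamma (1 / (1 + \<alpha>)) > 0" "Gamma ((1 + \<xi>) / (1 + \<alpha>)) > 0"
      using alpha_gt x0 by (auto intro!: Gamma_real_pos divide_pos_pos add_pos_pos)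
    then show ?thesis by (simp add: L_def rGamma_inverse_Gamma)
  qed
  have half: "\<xi> / (1 + \<alpha>) = 1 / 2" using alpha_gt by (simp add: x)
  have Glim: "(\<lambda>n. G n / sqrt (real n)) \<longlonglongrightarrow> L"
    using growth_asymptotics[OF alpha_gt, of \<xi>] unfolding half by (simp add: G_def L_def powr_half_sqrt)
  have Gsq: "(\<lambda>n. (G n)\<^sup>2 / real n) \<longlonglongrightarrow> L\<^sup>2"
    using tendsto_power[OF Glim, of 2] by (simp add: power_divide)
  obtain C where C: "C > 0" "\<And>n. n \<ge> 1 \<Longrightarrow> G n \<le> C * real n powr (1 / 2)"
    using growth_bound[OF alpha_gt, of \<xi>] x0 unfolding half G_def by auto
  define c where "c N k = a / 2 * (1 - G N / G k)" for N k
  have rec: "c N k = c N (Suc k) + (\<xi> * c N (Suc k) - a * (1 - p)) / w k" if k: "1 \<le> k" for N k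
  proof -
    have w: "w k \<ge> 1" by (rule w_ge_1[OF k])
    have f0: "1 + \<xi> / w k > 0" using w x0 by (simp add: add_pos_nonneg)
    have Gk: "G k = G (Suc k) / (1 + \<xi> / w k)"
      using f0 by (simp add: G_def growth_Suc[OF k])
    define P where "P = G N / G (Suc k)"
    have P: "G N / G k = P * (1 + \<xi> / w k)" unfolding Gk P_def by simp
    have ap: "a * (1 - p) = a / 2 * \<xi>" unfolding onep x by simp
    have "\<xi> * (h * (1 - P)) - h * \<xi> = - (h * P * \<xi>)" for h by (simp add: algebra_simps)
    from this[of "a / 2"] have "\<xi> * (a / 2 * (1 - P)) - a / 2 * \<xi> = - (a / 2 * P * \<xi>)" .
    moreover have "a / 2 * (1 - P * (1 + \<xi> / w k)) = a / 2 * (1 - P) + - (a / 2 * P * \<xi>) / w k"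
      by (simp add: algebra_simps)
    ultimately show ?thesis unfolding c_def P ap P_def[symmetric] by simp
  qed
  define B where "B = (1 + \<bar>a\<bar>) * C"
  have B0: "B \<ge> 0" using C by (simp add: B_def)
  have cB: "1 + \<bar>c N k\<bar> \<le> B * sqrt (real N)" if "N \<ge> 1" for N k
  proof -
    have "0 \<le> G N / G k" "G N / G k \<le> G N / 1"
      using G1[of N] G1[of k] by (auto intro!: divide_left_mono simp del: div_by_1)
    then have "\<bar>1 - G N / G k\<bar> \<le> 2 * G N" using G1[of N] by (simp add: abs_le_iff)
    then have "\<bar>c N k\<bar> \<le> \<bar>a\<bar> / 2 * (2 * G N)" unfolding c_def abs_mult by (intro mult_mono) auto
    then have "1 + \<bar>c N k\<bar> \<le> (1 + \<bar>a\<bar>) * G N" using G1[of N] by (simp add: algebra_simps)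
    also have "\<dots> \<le> (1 + \<bar>a\<bar>) * (C * real N powr (1 / 2))" using C(2)[OF that] by (intro mult_left_mono) auto
    finally show ?thesis by (simp add: B_def powr_half_sqrt mult.assoc)
  qed
  define \<beta> where "\<beta> N = sqrt (real N * ln (real N))" for N
  have ln0: "ln (real N) > 0" if "N \<ge> 2" for N using that by simp
  have \<beta>sq: "(\<beta> N)\<^sup>2 = real N * ln (real N)" if "N \<ge> 2" for N
    using ln0[OF that] by (simp add: \<beta>_def)
  have ln_inf: "filterlim (\<lambda>N. ln (real N)) at_top sequentially"
    by (rule filterlim_compose[OF ln_at_top filterlim_real_sequentially])
  have inv_ln: "(\<lambda>N. 1 / ln (real N)) \<longlonglongrightarrow> 0"
    by (rule tendsto_divide_0[OF tendsto_const filterlim_at_top_imp_at_infinity[OF ln_inf]])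
  have inv_sqrt_ln: "(\<lambda>N. 1 / sqrt (ln (real N))) \<longlonglongrightarrow> 0"
    using tendsto_real_sqrt[OF inv_ln] by (simp add: real_sqrt_divide)
  have N1: "(\<lambda>N. (real N - 1) / (real N * ln (real N))) \<longlonglongrightarrow> 0"
  proof -
    have "(\<lambda>N. (real N - 1) / real N) \<longlonglongrightarrow> 1" by real_asymp
    from tendsto_mult[OF this inv_ln]
    show ?thesis by (simp only: times_divide_times_eq mult_1_right mult_zero_right)
  qed
  define s1 where "s1 N = (\<Sum>k\<in>{1..<N}. c N (Suc k))" for N
  define s2 where "s2 N = (\<Sum>k\<in>{1..<N}. (c N (Suc k))\<^sup>2)" for N
  define PS where "PS N = (\<Sum>k\<in>{1..<N}. 1 / (G (Suc k))\<^sup>2)" for N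
  have s1_lim: "(\<lambda>N. s1 N / (real N * ln (real N))) \<longlonglongrightarrow> 0"
  proof (rule Lim_null_comparison)
    define K where "K = (B + \<bar>a\<bar>) / (2 * (1 - p))"
    show "eventually (\<lambda>N. norm (s1 N / (real N * ln (real N))) \<le> K * (1 / ln (real N))) sequentially"
      using eventually_ge_at_top[of 2]
    proof eventually_elim
      case (elim N)
      have "2 * (1 - p) * s1 N = - c N 1 - a * (1 - p) * (real N - 1)"
        unfolding s1_def
      proof (rule sum_compensator)
        show "c N N = 0" using G1[of N] by (simp add: c_def)
        show "N \<ge> 1" using elim by simp
        show "c N k = c N (Suc k) + (\<xi> * c N (Suc k) - a * (1 - p)) / w k" if "1 \<le> k" "k < N" for k
          by (rule rec[OF that(1)])
      qed
      then have "\<bar>2 * (1 - p) * s1 N\<bar> \<le> \<bar>c N 1\<bar> + \<bar>a\<bar> * ((1 - p) * (real N - 1))"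
        using elim p1 abs_triangle_ineq4[of "- c N 1" "a * (1 - p) * (real N - 1)"] by (simp add: abs_mult)
      also have "\<bar>c N 1\<bar> \<le> B * real N"
      proof -
        have "\<bar>c N 1\<bar> \<le> B * sqrt (real N)" using cB[of N 1] elim by simp
        also have "\<dots> \<le> B * real N" using B0 elim
          by (intro mult_left_mono real_le_lsqrt) (auto simp: power2_eq_square)
        finally show ?thesis .
      qed
      also have "\<bar>a\<bar> * ((1 - p) * (real N - 1)) \<le> \<bar>a\<bar> * (1 * real N)"
        using elim p_nonneg p1 by (intro mult_left_mono mult_mono) auto
      finally have "2 * (1 - p) * \<bar>s1 N\<bar> \<le> (B + \<bar>a\<bar>) * real N" using p1 by (simp add: abs_mult algebra_simps)
      then have "\<bar>s1 N\<bar> \<le> K * real N" using p1 by (simp add: K_def field_simps)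
      then have "\<bar>s1 N\<bar> / (real N * ln (real N)) \<le> K * real N / (real N * ln (real N))"
        using ln0[OF elim] by (intro divide_right_mono) auto
      then show ?case using ln0[OF elim] elim by (simp add: abs_mult)
    qed
    show "(\<lambda>N. K * (1 / ln (real N))) \<longlonglongrightarrow> 0" by (rule tendsto_mult_right_zero[OF inv_ln])
  qed
  have PS_lim: "(\<lambda>N. PS N / ln (real N)) \<longlonglongrightarrow> 1 / L\<^sup>2"
    unfolding PS_def
  proof (rule log_average)
    have "(\<lambda>k. real k / real (Suc k) * (1 / ((G (Suc k))\<^sup>2 / real (Suc k)))) \<longlonglongrightarrow> 1 * (1 / L\<^sup>2)"
      using L0 by (intro tendsto_intros LIMSEQ_n_over_Suc_n LIMSEQ_Suc[OF Gsq]) auto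
    moreover have "real k / real (Suc k) * (1 / ((G (Suc k))\<^sup>2 / real (Suc k))) = real k * (1 / (G (Suc k))\<^sup>2)" for k
      by simp
    ultimately show "(\<lambda>k. real k * (1 / (G (Suc k))\<^sup>2)) \<longlonglongrightarrow> 1 / L\<^sup>2" by (simp only: mult_1_left)
  qed
  have s2_lim: "(\<lambda>N. s2 N / (real N * ln (real N))) \<longlonglongrightarrow> a\<^sup>2 / 4"
  proof -
    have "(\<lambda>N. a\<^sup>2 / 4 * ((G N)\<^sup>2 / real N * (PS N / ln (real N)) - (real N - 1) / (real N * ln (real N)))
        + a * (s1 N / (real N * ln (real N)))) \<longlonglongrightarrow> a\<^sup>2 / 4 * (L\<^sup>2 * (1 / L\<^sup>2) - 0) + a * 0"
      by (intro tendsto_intros Gsq PS_lim N1 s1_lim)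
    also have "a\<^sup>2 / 4 * (L\<^sup>2 * (1 / L\<^sup>2) - 0) + a * 0 = a\<^sup>2 / 4" using L0 by simp
    finally show ?thesis
    proof (rule Lim_transform_eventually)
      show "eventually (\<lambda>N. a\<^sup>2 / 4 * ((G N)\<^sup>2 / real N * (PS N / ln (real N)) - (real N - 1) / (real N * ln (real N)))
        + a * (s1 N / (real N * ln (real N))) = s2 N / (real N * ln (real N))) sequentially"
        using eventually_ge_at_top[of 2]
      proof eventually_elim
        case (elim N)
        have "(c N (Suc k))\<^sup>2 = a\<^sup>2 / 4 * (G N)\<^sup>2 * (1 / (G (Suc k))\<^sup>2) - a\<^sup>2 / 4 + a * c N (Suc k)" for k
          by (simp add: c_def power2_eq_square algebra_simps add_divide_distrib)
        then have "s2 N = (\<Sum>k\<in>{1..<N}. a\<^sup>2 / 4 * (G N)\<^sup>2 * (1 / (G (Suc k))\<^sup>2) - a\<^sup>2 / 4 + a * c N (Suc k))"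
          unfolding s2_def by (intro sum.cong) auto
        also have "\<dots> = a\<^sup>2 / 4 * (G N)\<^sup>2 * PS N - a\<^sup>2 / 4 * (real N - 1) + a * s1 N"
          using elim by (simp only: sum.distrib sum_subtractf sum_distrib_left[symmetric] s1_def PS_def sum_constant card_atLeastLessThan)
            (simp add: of_nat_diff)
        finally have s2: "s2 N = a\<^sup>2 / 4 * (G N)\<^sup>2 * PS N - a\<^sup>2 / 4 * (real N - 1) + a * s1 N" .
        have "A * (g / n * (P / l) - m / (n * l)) + a * (s / (n * l)) = (A * g * P - A * m + a * s) / (n * l)"
          for A g n P l m s :: real
          by (simp add: add_divide_distrib diff_divide_distrib right_diff_distrib)
        then show ?case unfolding s2 .
      qed
    qed
  qed
  obtain K where "\<forall>N. norm (s2 N / (real N * ln (real N))) \<le> K"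
    using convergent_imp_Bseq[OF convergentI[OF s2_lim]] by (rule BseqE)
  then have K: "\<And>N. \<bar>s2 N / (real N * ln (real N))\<bar> \<le> K" by simp
  let ?V = "a\<^sup>2 * ((1 + \<alpha>) / 4)"
  have "(\<lambda>N. \<integral>\<omega>. cis ((a * walk 0 (- 1) N \<omega> + b * (1 + flips N \<omega> - (1 - p) * real N)) / \<beta> N) \<partial>M)
    \<longlonglongrightarrow> of_real (exp (- ?V / 2))"
  proof (rule clt_criterion[where c = c and \<mu> = "\<lambda>N. B * (1 / sqrt (ln (real N)))" and S = "2 * (1 / ln 2) + 2 * K"])
    show "p < 1" by (rule p1)
    show "c N N = 0" for N using G1[of N] by (simp add: c_def)
    show "c N k = c N (Suc k) + (\<xi> * c N (Suc k) - a * (1 - p)) / w k" if "1 \<le> k" "k < N" for N k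
      by (rule rec[OF that(1)])
    show "0 < \<beta> N" if "2 \<le> N" for N using that ln0[OF that] by (simp add: \<beta>_def)
    show "1 + \<bar>c N k\<bar> \<le> B * (1 / sqrt (ln (real N))) * \<beta> N" if "2 \<le> N" "1 \<le> k" "k \<le> N" for N k
    proof -
      have "B * (1 / sqrt (ln (real N))) * \<beta> N = B * sqrt (real N)"
        using ln0[OF that(1)] by (simp add: \<beta>_def real_sqrt_mult)
      then show ?thesis using cB[of N k] that by simp
    qed
    show "(\<lambda>N. B * (1 / sqrt (ln (real N)))) \<longlonglongrightarrow> 0" by (rule tendsto_mult_right_zero[OF inv_sqrt_ln])
    show "(\<Sum>k\<in>{1..<N}. (1 + \<bar>c N (Suc k)\<bar>)\<^sup>2) \<le> (2 * (1 / ln 2) + 2 * K) * (\<beta> N)\<^sup>2" if N: "2 \<le> N" for N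
    proof -
      have l: "ln (real N) \<ge> ln 2" "ln (real N) > 0" "ln (2::real) > 0" using N by auto
      have "s2 N \<le> K * (real N * ln (real N))"
        using K[of N] N l by (simp add: abs_le_iff divide_le_eq mult_pos_pos)
      moreover have "real N \<le> (1 / ln 2) * (real N * ln (real N))"
      proof -
        have "real N * ln 2 \<le> real N * ln (real N)" using l by (intro mult_left_mono) auto
        then show ?thesis using l by (simp add: field_simps)
      qed
      ultimately have "2 * real N + 2 * s2 N \<le> (2 * (1 / ln 2) + 2 * K) * (real N * ln (real N))"
        unfolding distrib_right mult.assoc by linarith
      then show ?thesis
        using sum_one_plus_abs_sq_le[of N "c N"] N unfolding s2_def[symmetric] \<beta>sq[OF N] by linarith
    qed
    have "(\<lambda>N. step_var * (s2 N / (real N * ln (real N))) - 2 * a * (1 - p) * (\<alpha> - 1) * (s1 N / (real N * ln (real N)))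
          + ((1 - p) * a\<^sup>2 + b\<^sup>2 * (p * (1 - p))) * ((real N - 1) / (real N * ln (real N))))
        \<longlonglongrightarrow> step_var * (a\<^sup>2 / 4) - 2 * a * (1 - p) * (\<alpha> - 1) * 0
          + ((1 - p) * a\<^sup>2 + b\<^sup>2 * (p * (1 - p))) * 0"
      by (intro tendsto_intros s1_lim s2_lim N1)
    also have "step_var * (a\<^sup>2 / 4) - 2 * a * (1 - p) * (\<alpha> - 1) * 0
          + ((1 - p) * a\<^sup>2 + b\<^sup>2 * (p * (1 - p))) * 0 = ?V"
    proof -
      have "2 * (2 * p - 1) = 1 - \<alpha>" using crit by simp
      moreover have "step_var = \<alpha>\<^sup>2 + 1 + \<alpha> * (2 * (2 * p - 1))" by (simp add: step_var_def)
      ultimately have "step_var = \<alpha>\<^sup>2 + 1 + \<alpha> * (1 - \<alpha>)" by (simp only:)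
      then have "step_var = 1 + \<alpha>" by (simp add: power2_eq_square algebra_simps)
      then show ?thesis by simp
    qed
    finally show "(\<lambda>N. (\<Sum>k\<in>{1..<N}. step_variance a b (c N (Suc k))) / (\<beta> N)\<^sup>2) \<longlonglongrightarrow> ?V"
    proof (rule Lim_transform_eventually)
      have div3: "A * (c / n) - A' * (m / n) + A'' * (t / n) = (A * c - A' * m + A'' * t) / n"
        for A A' A'' c m n t :: real
        by (simp add: diff_divide_distrib add_divide_distrib)
      show "eventually (\<lambda>N. step_var * (s2 N / (real N * ln (real N))) - 2 * a * (1 - p) * (\<alpha> - 1) * (s1 N / (real N * ln (real N)))
          + ((1 - p) * a\<^sup>2 + b\<^sup>2 * (p * (1 - p))) * ((real N - 1) / (real N * ln (real N))) =
          (\<Sum>k\<in>{1..<N}. step_variance a b (c N (Suc k))) / (\<beta> N)\<^sup>2) sequentially"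
        using eventually_ge_at_top[of 2]
      proof eventually_elim
        case (elim N)
        then have N: "N \<ge> 1" by simp
        show ?case
          by (simp only: sum_step_variance[OF N, of a b "c N"] s1_def s2_def div3 \<beta>sq[OF elim])
      qed
    qed
  qed
  then show ?thesis by (simp only: \<beta>_def)
qed

end

section \<open>Mean-square convergence\<close>

context prob_space
begin

definition L2 :: "('a \<Rightarrow> real) \<Rightarrow> bool" where
  "L2 f \<longleftrightarrow> f \<in> borel_measurable M \<and> integrable M (\<lambda>\<omega>. (f \<omega>)\<^sup>2)"

definition L2_tendsto :: "(nat \<Rightarrow> 'a \<Rightarrow> real) \<Rightarrow> ('a \<Rightarrow> real) \<Rightarrow> bool" where
  "L2_tendsto X Z \<longleftrightarrow> (\<forall>n. L2 (X n)) \<and> L2 Z \<and> (\<lambda>n. \<integral>\<omega>. (X n \<omega> - Z \<omega>)\<^sup>2 \<partial>M) \<longlonglongrightarrow> 0"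

lemma L2_measurable: "L2 f \<Longrightarrow> f \<in> borel_measurable M"
  and L2_square: "L2 f \<Longrightarrow> integrable M (\<lambda>\<omega>. (f \<omega>)\<^sup>2)"
  by (simp_all add: L2_def)

lemma L2_integrable: "L2 f \<Longrightarrow> integrable M f"
  by (rule square_integrable_imp_integrable) (simp_all add: L2_def)

lemma L2_const [simp]: "L2 (\<lambda>_. c)"
  by (simp add: L2_def)

lemma sq_sum_le: "((x::real) + y)\<^sup>2 \<le> 2 * x\<^sup>2 + 2 * y\<^sup>2"
proof -
  have "0 \<le> (x - y)\<^sup>2" by simp
  then show ?thesis by (simp add: power2_eq_square algebra_simps)
qed

lemma L2_add:
  assumes "L2 f" "L2 g"
  shows "L2 (\<lambda>\<omega>. f \<omega> + g \<omega>)"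
proof -
  note [measurable] = L2_measurable[OF assms(1)] L2_measurable[OF assms(2)]
  have "integrable M (\<lambda>\<omega>. (f \<omega> + g \<omega>)\<^sup>2)"
  proof (rule Bochner_Integration.integrable_bound)
    show "integrable M (\<lambda>\<omega>. 2 * (f \<omega>)\<^sup>2 + 2 * (g \<omega>)\<^sup>2)"
      by (intro Bochner_Integration.integrable_add integrable_mult_right L2_square assms)
  qed (auto simp: sq_sum_le)
  then show ?thesis by (simp add: L2_def)
qed

lemma L2_scale: "L2 f \<Longrightarrow> L2 (\<lambda>\<omega>. c * f \<omega>)"
  unfolding L2_def power_mult_distrib by auto

lemma L2_diff: "L2 f \<Longrightarrow> L2 g \<Longrightarrow> L2 (\<lambda>\<omega>. f \<omega> - g \<omega>)"
  using L2_add[of f "\<lambda>\<omega>. - 1 * g \<omega>"] L2_scale[of g "- 1"] by simp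

lemma L2_sq_sum_le:
  assumes "L2 f" "L2 g"
  shows "(\<integral>\<omega>. (f \<omega> + g \<omega>)\<^sup>2 \<partial>M) \<le> 2 * (\<integral>\<omega>. (f \<omega>)\<^sup>2 \<partial>M) + 2 * (\<integral>\<omega>. (g \<omega>)\<^sup>2 \<partial>M)"
proof -
  have "(\<integral>\<omega>. (f \<omega> + g \<omega>)\<^sup>2 \<partial>M) \<le> (\<integral>\<omega>. 2 * (f \<omega>)\<^sup>2 + 2 * (g \<omega>)\<^sup>2 \<partial>M)"
    by (intro integral_mono L2_square L2_add assms Bochner_Integration.integrable_add integrable_mult_right)
      (rule sq_sum_le)
  also have "\<dots> = 2 * (\<integral>\<omega>. (f \<omega>)\<^sup>2 \<partial>M) + 2 * (\<integral>\<omega>. (g \<omega>)\<^sup>2 \<partial>M)"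
    using L2_square[OF assms(1)] L2_square[OF assms(2)] by simp
  finally show ?thesis .
qed

lemma abs_mean_sq_le:
  assumes "L2 f"
  shows "(\<integral>\<omega>. \<bar>f \<omega>\<bar> \<partial>M)\<^sup>2 \<le> (\<integral>\<omega>. (f \<omega>)\<^sup>2 \<partial>M)"
proof -
  have "integrable M (\<lambda>\<omega>. \<bar>f \<omega>\<bar>)" "integrable M (\<lambda>\<omega>. \<bar>f \<omega>\<bar>\<^sup>2)"
    using L2_integrable[OF assms] L2_square[OF assms] by auto
  from variance_eq[OF this] variance_positive[of "\<lambda>\<omega>. \<bar>f \<omega>\<bar>"] show ?thesis by simp
qed

lemma L2_tendsto_abs_mean:
  assumes "L2_tendsto X Z"
  shows "(\<lambda>n. \<integral>\<omega>. \<bar>X n \<omega> - Z \<omega>\<bar> \<partial>M) \<longlonglongrightarrow> 0"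
proof -
  have X: "L2 (X n)" and Z: "L2 Z" and lim: "(\<lambda>n. \<integral>\<omega>. (X n \<omega> - Z \<omega>)\<^sup>2 \<partial>M) \<longlonglongrightarrow> 0" for n
    using assms by (auto simp: L2_tendsto_def)
  have "(\<lambda>n. (\<integral>\<omega>. \<bar>X n \<omega> - Z \<omega>\<bar> \<partial>M)\<^sup>2) \<longlonglongrightarrow> 0"
    by (rule tendsto_sandwich[OF _ _ tendsto_const lim])
      (simp_all add: abs_mean_sq_le[OF L2_diff[OF X Z]])
  from tendsto_real_sqrt[OF this] show ?thesis by simp
qed

lemma L2_tendsto_null:
  assumes "\<And>n. L2 (X n)" "(\<lambda>n. \<integral>\<omega>. (X n \<omega>)\<^sup>2 \<partial>M) \<longlonglongrightarrow> 0"
  shows "L2_tendsto X (\<lambda>_. 0)"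
  using assms by (simp add: L2_tendsto_def)

lemma L2_tendsto_add:
  assumes "L2_tendsto X Z" "L2_tendsto Y U"
  shows "L2_tendsto (\<lambda>n \<omega>. X n \<omega> + Y n \<omega>) (\<lambda>\<omega>. Z \<omega> + U \<omega>)"
proof -
  have L: "L2 (X n)" "L2 Z" "L2 (Y n)" "L2 U" for n using assms by (auto simp: L2_tendsto_def)
  have lim: "(\<lambda>n. 2 * (\<integral>\<omega>. (X n \<omega> - Z \<omega>)\<^sup>2 \<partial>M) + 2 * (\<integral>\<omega>. (Y n \<omega> - U \<omega>)\<^sup>2 \<partial>M)) \<longlonglongrightarrow> 2 * 0 + 2 * 0"
    using assms by (intro tendsto_intros) (auto simp: L2_tendsto_def)
  have "(\<lambda>n. \<integral>\<omega>. ((X n \<omega> + Y n \<omega>) - (Z \<omega> + U \<omega>))\<^sup>2 \<partial>M) \<longlonglongrightarrow> 0"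
  proof (rule tendsto_sandwich[OF _ _ tendsto_const lim[simplified]])
    have "(\<integral>\<omega>. ((X n \<omega> + Y n \<omega>) - (Z \<omega> + U \<omega>))\<^sup>2 \<partial>M) \<le>
        2 * (\<integral>\<omega>. (X n \<omega> - Z \<omega>)\<^sup>2 \<partial>M) + 2 * (\<integral>\<omega>. (Y n \<omega> - U \<omega>)\<^sup>2 \<partial>M)" for n
      using L2_sq_sum_le[OF L2_diff[OF L(1,2)] L2_diff[OF L(3,4)], of n n] by (simp add: algebra_simps)
    then show "eventually (\<lambda>n. (\<integral>\<omega>. ((X n \<omega> + Y n \<omega>) - (Z \<omega> + U \<omega>))\<^sup>2 \<partial>M) \<le>
        2 * (\<integral>\<omega>. (X n \<omega> - Z \<omega>)\<^sup>2 \<partial>M) + 2 * (\<integral>\<omega>. (Y n \<omega> - U \<omega>)\<^sup>2 \<partial>M)) sequentially" by simp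
  qed simp
  then show ?thesis using L by (auto simp: L2_tendsto_def intro: L2_add)
qed

lemma L2_tendsto_scale:
  assumes XZ: "L2_tendsto X Z" and c: "c \<longlonglongrightarrow> l"
  shows "L2_tendsto (\<lambda>n \<omega>. c n * X n \<omega>) (\<lambda>\<omega>. l * Z \<omega>)"
proof -
  have L: "L2 (X n)" "L2 Z" for n using XZ by (auto simp: L2_tendsto_def)
  have lim: "(\<lambda>n. 2 * ((c n)\<^sup>2 * (\<integral>\<omega>. (X n \<omega> - Z \<omega>)\<^sup>2 \<partial>M)) + 2 * ((c n - l)\<^sup>2 * (\<integral>\<omega>. (Z \<omega>)\<^sup>2 \<partial>M)))
      \<longlonglongrightarrow> 2 * (l\<^sup>2 * 0) + 2 * ((l - l)\<^sup>2 * (\<integral>\<omega>. (Z \<omega>)\<^sup>2 \<partial>M))"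
    using XZ c by (intro tendsto_intros) (auto simp: L2_tendsto_def)
  then have lim: "(\<lambda>n. 2 * ((c n)\<^sup>2 * (\<integral>\<omega>. (X n \<omega> - Z \<omega>)\<^sup>2 \<partial>M)) + 2 * ((c n - l)\<^sup>2 * (\<integral>\<omega>. (Z \<omega>)\<^sup>2 \<partial>M))) \<longlonglongrightarrow> 0"
    by (simp only: diff_self power_zero_numeral mult_zero_left mult_zero_right add_0_right)
  have "(\<lambda>n. \<integral>\<omega>. (c n * X n \<omega> - l * Z \<omega>)\<^sup>2 \<partial>M) \<longlonglongrightarrow> 0"
  proof (rule tendsto_sandwich[OF _ _ tendsto_const lim])
    have "(\<integral>\<omega>. (c n * X n \<omega> - l * Z \<omega>)\<^sup>2 \<partial>M) \<le>
        2 * ((c n)\<^sup>2 * (\<integral>\<omega>. (X n \<omega> - Z \<omega>)\<^sup>2 \<partial>M)) + 2 * ((c n - l)\<^sup>2 * (\<integral>\<omega>. (Z \<omega>)\<^sup>2 \<partial>M))" for n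
      using L2_sq_sum_le[OF L2_scale[OF L2_diff[OF L(1) L(2)], of "c n"] L2_scale[OF L(2), of "c n - l"], of n]
      by (simp add: power_mult_distrib) (simp add: algebra_simps)
    then show "eventually (\<lambda>n. (\<integral>\<omega>. (c n * X n \<omega> - l * Z \<omega>)\<^sup>2 \<partial>M) \<le>
        2 * ((c n)\<^sup>2 * (\<integral>\<omega>. (X n \<omega> - Z \<omega>)\<^sup>2 \<partial>M)) + 2 * ((c n - l)\<^sup>2 * (\<integral>\<omega>. (Z \<omega>)\<^sup>2 \<partial>M))) sequentially" by simp
  qed simp
  then show ?thesis using L by (auto simp: L2_tendsto_def intro: L2_scale)
qed

lemma L2_tendsto_second_moment:
  assumes XZ: "L2_tendsto X Z"
  shows "(\<lambda>n. \<integral>\<omega>. (X n \<omega>)\<^sup>2 \<partial>M) \<longlonglongrightarrow> (\<integral>\<omega>. (Z \<omega>)\<^sup>2 \<partial>M)"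
proof (rule LIMSEQ_I)
  fix \<epsilon> :: real assume \<epsilon>: "\<epsilon> > 0"
  have L: "L2 (X n)" "L2 Z" and lim: "(\<lambda>n. \<integral>\<omega>. (X n \<omega> - Z \<omega>)\<^sup>2 \<partial>M) \<longlonglongrightarrow> 0" for n
    using XZ by (auto simp: L2_tendsto_def)
  define S where "S = (\<integral>\<omega>. (Z \<omega>)\<^sup>2 \<partial>M)"
  have S: "S \<ge> 0" by (simp add: S_def)
  \<comment> \<open>The weight \<open>\<tau>\<close> balances the two terms in \<open>\<bar>2 z d\<bar> \<le> \<tau> z\<^sup>2 + d\<^sup>2 / \<tau>\<close>.\<close>
  define \<tau> where "\<tau> = \<epsilon> / (2 * (S + 1))"
  have \<tau>: "\<tau> > 0" using \<epsilon> S by (simp add: \<tau>_def)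
  have \<tau>S: "\<tau> * S < \<epsilon> / 2"
  proof -
    have "\<tau> * S < \<tau> * (S + 1)" using \<tau> by simp
    also have "\<dots> = \<epsilon> / 2" using S by (simp add: \<tau>_def field_simps)
    finally show ?thesis .
  qed
  have "(\<lambda>n. (1 + 1 / \<tau>) * (\<integral>\<omega>. (X n \<omega> - Z \<omega>)\<^sup>2 \<partial>M)) \<longlonglongrightarrow> 0"
    by (rule tendsto_mult_right_zero[OF lim])
  then have "eventually (\<lambda>n. (1 + 1 / \<tau>) * (\<integral>\<omega>. (X n \<omega> - Z \<omega>)\<^sup>2 \<partial>M) < \<epsilon> / 2) sequentially"
    using \<epsilon> by (intro order_tendstoD(2)) auto
  then have "eventually (\<lambda>n. norm ((\<integral>\<omega>. (X n \<omega>)\<^sup>2 \<partial>M) - (\<integral>\<omega>. (Z \<omega>)\<^sup>2 \<partial>M)) < \<epsilon>) sequentially"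
  proof eventually_elim
    case (elim n)
    have "\<bar>(\<integral>\<omega>. (X n \<omega>)\<^sup>2 \<partial>M) - (\<integral>\<omega>. (Z \<omega>)\<^sup>2 \<partial>M)\<bar> = \<bar>\<integral>\<omega>. (X n \<omega>)\<^sup>2 - (Z \<omega>)\<^sup>2 \<partial>M\<bar>"
      using L2_square[OF L(1)] L2_square[OF L(2)] by simp
    also have "\<dots> \<le> (\<integral>\<omega>. \<bar>(X n \<omega>)\<^sup>2 - (Z \<omega>)\<^sup>2\<bar> \<partial>M)" by (rule integral_abs_bound)
    also have "\<dots> \<le> (\<integral>\<omega>. (1 + 1 / \<tau>) * (X n \<omega> - Z \<omega>)\<^sup>2 + \<tau> * (Z \<omega>)\<^sup>2 \<partial>M)"
    proof (rule integral_mono)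
      show "integrable M (\<lambda>\<omega>. \<bar>(X n \<omega>)\<^sup>2 - (Z \<omega>)\<^sup>2\<bar>)"
        by (intro integrable_abs Bochner_Integration.integrable_diff L2_square L)
      show "integrable M (\<lambda>\<omega>. (1 + 1 / \<tau>) * (X n \<omega> - Z \<omega>)\<^sup>2 + \<tau> * (Z \<omega>)\<^sup>2)"
        by (intro Bochner_Integration.integrable_add integrable_mult_right L2_square L2_diff L)
      fix \<omega>
      have "\<bar>x\<^sup>2 - z\<^sup>2\<bar> \<le> (1 + 1 / \<tau>) * (x - z)\<^sup>2 + \<tau> * z\<^sup>2" for x z
      proof -
        define d where "d = x - z"
        have "0 \<le> (\<tau> * z - d)\<^sup>2 / \<tau>" "0 \<le> (\<tau> * z + d)\<^sup>2 / \<tau>" using \<tau> by simp_all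
        then have "2 * z * d \<le> \<tau> * z\<^sup>2 + 1 / \<tau> * d\<^sup>2" "- (2 * z * d) \<le> \<tau> * z\<^sup>2 + 1 / \<tau> * d\<^sup>2"
          using \<tau> by (simp_all add: power2_eq_square algebra_simps add_divide_distrib diff_divide_distrib)
        then have "\<bar>2 * z * d\<bar> \<le> \<tau> * z\<^sup>2 + 1 / \<tau> * d\<^sup>2" by (rule abs_leI)
        moreover have "x\<^sup>2 - z\<^sup>2 = d\<^sup>2 + 2 * z * d" by (simp add: d_def power2_eq_square algebra_simps)
        moreover have "(1 + 1 / \<tau>) * d\<^sup>2 = d\<^sup>2 + 1 / \<tau> * d\<^sup>2" by (simp add: algebra_simps)
        moreover have "\<bar>d\<^sup>2 + 2 * z * d\<bar> \<le> d\<^sup>2 + \<bar>2 * z * d\<bar>"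
          using abs_triangle_ineq[of "d\<^sup>2" "2 * z * d"] by simp
        ultimately show ?thesis unfolding d_def[symmetric] by linarith
      qed
      then show "\<bar>(X n \<omega>)\<^sup>2 - (Z \<omega>)\<^sup>2\<bar> \<le> (1 + 1 / \<tau>) * (X n \<omega> - Z \<omega>)\<^sup>2 + \<tau> * (Z \<omega>)\<^sup>2" .
    qed
    also have "\<dots> = (1 + 1 / \<tau>) * (\<integral>\<omega>. (X n \<omega> - Z \<omega>)\<^sup>2 \<partial>M) + \<tau> * S"
      using L2_square[OF L2_diff[OF L]] L2_square[OF L(2)] unfolding S_def
      by (subst Bochner_Integration.integral_add) (auto simp del: times_divide_eq_left)
    finally show ?case using elim \<tau>S unfolding real_norm_def by linarith
  qed
  then show "\<exists>N. \<forall>n\<ge>N. norm ((\<integral>\<omega>. (X n \<omega>)\<^sup>2 \<partial>M) - (\<integral>\<omega>. (Z \<omega>)\<^sup>2 \<partial>M)) < \<epsilon>"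
    by (simp add: eventually_sequentially)
qed

text \<open>
  Completeness of \<open>L\<^sup>2\<close>: a subsequence converges almost surely, and Fatou's lemma identifies its limit
  as the limit in mean square.
\<close>

lemma L2_complete:
  assumes X: "\<And>n. L2 (X n)"
    and Cauchy: "\<And>\<epsilon>. \<epsilon> > 0 \<Longrightarrow> \<exists>N. \<forall>m\<ge>N. \<forall>n\<ge>N. (\<integral>\<omega>. (X m \<omega> - X n \<omega>)\<^sup>2 \<partial>M) \<le> \<epsilon>"
  obtains Z where "L2_tendsto X Z"
proof -
  note [measurable] = L2_measurable[OF X]
  have "\<exists>N. \<forall>i\<ge>N. \<forall>j\<ge>N. (\<integral>\<omega>. norm (X i \<omega> - X j \<omega>) \<partial>M) < e" if e: "e > 0" for e
  proof -
    from Cauchy[of "(e / 2)\<^sup>2"] e obtain N where N: "\<And>m n. m \<ge> N \<Longrightarrow> n \<ge> N \<Longrightarrow> (\<integral>\<omega>. (X m \<omega> - X n \<omega>)\<^sup>2 \<partial>M) \<le> (e / 2)\<^sup>2"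
      by auto
    have "(\<integral>\<omega>. norm (X i \<omega> - X j \<omega>) \<partial>M) < e" if "i \<ge> N" "j \<ge> N" for i j
    proof -
      have "(\<integral>\<omega>. \<bar>X i \<omega> - X j \<omega>\<bar> \<partial>M)\<^sup>2 \<le> (e / 2)\<^sup>2"
        using abs_mean_sq_le[OF L2_diff[OF X X], of i j] N[OF that] by linarith
      then have "(\<integral>\<omega>. \<bar>X i \<omega> - X j \<omega>\<bar> \<partial>M) \<le> e / 2"
        by (rule power2_le_imp_le) (use e in simp)
      then show ?thesis using e by simp
    qed
    then show ?thesis by blast
  qed
  from cauchy_L1_AE_cauchy_subseq[OF L2_integrable[OF X] this] obtain r
    where r: "strict_mono r" "AE \<omega> in M. Cauchy (\<lambda>i. X (r i) \<omega>)" by blast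
  define Z where "Z \<omega> = lim (\<lambda>i. X (r i) \<omega>)" for \<omega>
  have Z [measurable]: "Z \<in> borel_measurable M" unfolding Z_def[abs_def] by measurable
  have lim: "AE \<omega> in M. (\<lambda>i. X (r i) \<omega>) \<longlonglongrightarrow> Z \<omega>"
    using r(2)
  proof eventually_elim
    case (elim \<omega>)
    then have "convergent (\<lambda>i. X (r i) \<omega>)" by (rule Cauchy_convergent)
    then show ?case unfolding Z_def by (simp only: convergent_LIMSEQ_iff)
  qed
  have fatou: "(\<integral>\<^sup>+\<omega>. ennreal ((X n \<omega> - Z \<omega>)\<^sup>2) \<partial>M) \<le> ennreal \<epsilon>"
    if \<epsilon>: "\<epsilon> \<ge> 0" and N: "\<And>m. m \<ge> N \<Longrightarrow> (\<integral>\<omega>. (X n \<omega> - X m \<omega>)\<^sup>2 \<partial>M) \<le> \<epsilon>" for n N \<epsilon>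
  proof -
    have "(\<integral>\<^sup>+\<omega>. ennreal ((X n \<omega> - Z \<omega>)\<^sup>2) \<partial>M) =
        (\<integral>\<^sup>+\<omega>. liminf (\<lambda>i. ennreal ((X n \<omega> - X (r i) \<omega>)\<^sup>2)) \<partial>M)"
    proof (rule nn_integral_cong_AE)
      show "AE \<omega> in M. ennreal ((X n \<omega> - Z \<omega>)\<^sup>2) = liminf (\<lambda>i. ennreal ((X n \<omega> - X (r i) \<omega>)\<^sup>2))"
        using lim
      proof eventually_elim
        case (elim \<omega>)
        have "(\<lambda>i. ennreal ((X n \<omega> - X (r i) \<omega>)\<^sup>2)) \<longlonglongrightarrow> ennreal ((X n \<omega> - Z \<omega>)\<^sup>2)"
          by (intro tendsto_ennrealI tendsto_intros elim)
        from lim_imp_Liminf[OF _ this] show ?case by simp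
      qed
    qed
    also have "\<dots> \<le> liminf (\<lambda>i. \<integral>\<^sup>+\<omega>. ennreal ((X n \<omega> - X (r i) \<omega>)\<^sup>2) \<partial>M)"
      by (rule nn_integral_liminf) measurable
    also have "\<dots> \<le> ennreal \<epsilon>"
    proof (rule Liminf_le)
      show "eventually (\<lambda>i. (\<integral>\<^sup>+\<omega>. ennreal ((X n \<omega> - X (r i) \<omega>)\<^sup>2) \<partial>M) \<le> ennreal \<epsilon>) sequentially"
        using eventually_ge_at_top[of N]
      proof eventually_elim
        case (elim i)
        have "N \<le> r i" using elim strict_mono_imp_increasing[OF r(1), of i] by simp
        from N[OF this] show ?case
          by (subst nn_integral_eq_integral[OF L2_square[OF L2_diff[OF X X]]]) (auto simp: ennreal_leI)
      qed
    qed simp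
    finally show ?thesis .
  qed
  have L2d: "L2 (\<lambda>\<omega>. X n \<omega> - Z \<omega>)" and dle: "(\<integral>\<omega>. (X n \<omega> - Z \<omega>)\<^sup>2 \<partial>M) \<le> \<epsilon>"
    if \<epsilon>: "\<epsilon> \<ge> 0" and N: "\<And>m. m \<ge> N \<Longrightarrow> (\<integral>\<omega>. (X n \<omega> - X m \<omega>)\<^sup>2 \<partial>M) \<le> \<epsilon>" for n N \<epsilon>
  proof -
    have f: "(\<integral>\<^sup>+\<omega>. ennreal ((X n \<omega> - Z \<omega>)\<^sup>2) \<partial>M) \<le> ennreal \<epsilon>" by (rule fatou[OF that])
    then have "(\<integral>\<^sup>+\<omega>. ennreal ((X n \<omega> - Z \<omega>)\<^sup>2) \<partial>M) < \<infinity>"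
      by (rule le_less_trans) simp
    then have i: "integrable M (\<lambda>\<omega>. (X n \<omega> - Z \<omega>)\<^sup>2)" by (intro integrableI_nonneg) auto
    then show "L2 (\<lambda>\<omega>. X n \<omega> - Z \<omega>)" by (simp add: L2_def)
    show "(\<integral>\<omega>. (X n \<omega> - Z \<omega>)\<^sup>2 \<partial>M) \<le> \<epsilon>"
      using f \<epsilon> by (subst (asm) nn_integral_eq_integral[OF i]) auto
  qed
  from Cauchy[of 1] obtain N where "\<forall>m\<ge>N. \<forall>n\<ge>N. (\<integral>\<omega>. (X m \<omega> - X n \<omega>)\<^sup>2 \<partial>M) \<le> 1" by auto
  then have "L2 (\<lambda>\<omega>. X N \<omega> - Z \<omega>)" by (intro L2d[of 1 N]) auto
  from L2_diff[OF X[of N] this] have "L2 Z" by simp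
  moreover have "(\<lambda>n. \<integral>\<omega>. (X n \<omega> - Z \<omega>)\<^sup>2 \<partial>M) \<longlonglongrightarrow> 0"
  proof (rule LIMSEQ_I)
    fix \<epsilon> :: real assume \<epsilon>: "\<epsilon> > 0"
    from Cauchy[of "\<epsilon> / 2"] \<epsilon> obtain N where N: "\<forall>m\<ge>N. \<forall>n\<ge>N. (\<integral>\<omega>. (X m \<omega> - X n \<omega>)\<^sup>2 \<partial>M) \<le> \<epsilon> / 2" by auto
    have "norm ((\<integral>\<omega>. (X n \<omega> - Z \<omega>)\<^sup>2 \<partial>M) - 0) < \<epsilon>" if "n \<ge> N" for n
    proof -
      have "(\<integral>\<omega>. (X n \<omega> - Z \<omega>)\<^sup>2 \<partial>M) \<le> \<epsilon> / 2" by (rule dle[of _ N]) (use \<epsilon> N that in auto)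
      then show ?thesis using \<epsilon> by simp
    qed
    then show "\<exists>N. \<forall>n\<ge>N. norm ((\<integral>\<omega>. (X n \<omega> - Z \<omega>)\<^sup>2 \<partial>M) - 0) < \<epsilon>" by blast
  qed
  ultimately show ?thesis using X by (intro that[of Z]) (simp add: L2_tendsto_def)
qed

lemma L2_tendsto_cf:
  assumes "L2_tendsto X Z"
  shows "(\<lambda>n. \<integral>\<omega>. cis (X n \<omega>) \<partial>M) \<longlonglongrightarrow> (\<integral>\<omega>. cis (Z \<omega>) \<partial>M)"
proof -
  have L: "L2 (X n)" "L2 Z" for n using assms by (auto simp: L2_tendsto_def)
  note [measurable] = L2_measurable[OF L(1)] L2_measurable[OF L(2)]
  have close: "cmod ((\<integral>\<omega>. cis (X n \<omega>) \<partial>M) - (\<integral>\<omega>. cis (Z \<omega>) \<partial>M)) \<le> (\<integral>\<omega>. \<bar>X n \<omega> - Z \<omega>\<bar> \<partial>M)" for n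
  proof -
    have i: "integrable M (\<lambda>\<omega>. cis (X n \<omega>))" "integrable M (\<lambda>\<omega>. cis (Z \<omega>))"
      by (intro integrable_cis; measurable)+
    have "cmod ((\<integral>\<omega>. cis (X n \<omega>) \<partial>M) - (\<integral>\<omega>. cis (Z \<omega>) \<partial>M)) = cmod (\<integral>\<omega>. cis (X n \<omega>) - cis (Z \<omega>) \<partial>M)"
      using i by simp
    also have "\<dots> \<le> (\<integral>\<omega>. cmod (cis (X n \<omega>) - cis (Z \<omega>)) \<partial>M)" by (rule integral_norm_bound)
    also have "\<dots> \<le> (\<integral>\<omega>. \<bar>X n \<omega> - Z \<omega>\<bar> \<partial>M)"
    proof (rule integral_mono)
      show "integrable M (\<lambda>\<omega>. cmod (cis (X n \<omega>) - cis (Z \<omega>)))" using i by auto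
      show "integrable M (\<lambda>\<omega>. \<bar>X n \<omega> - Z \<omega>\<bar>)" using L2_integrable[OF L2_diff[OF L]] by auto
      fix \<omega>
      have "cis (X n \<omega>) - cis (Z \<omega>) = cis (Z \<omega>) * (cis (X n \<omega> - Z \<omega>) - 1)"
        by (simp add: right_diff_distrib cis_mult)
      then have "cmod (cis (X n \<omega>) - cis (Z \<omega>)) = cmod (cis (X n \<omega> - Z \<omega>) - 1)" by (simp add: norm_mult)
      also have "\<dots> \<le> \<bar>X n \<omega> - Z \<omega>\<bar>"
        using iexp_approx1[of "X n \<omega> - Z \<omega>" 0] by (simp add: cis_conv_exp)
      finally show "cmod (cis (X n \<omega>) - cis (Z \<omega>)) \<le> \<bar>X n \<omega> - Z \<omega>\<bar>" .
    qed
    finally show ?thesis .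
  qed
  have "(\<lambda>n. (\<integral>\<omega>. cis (X n \<omega>) \<partial>M) - (\<integral>\<omega>. cis (Z \<omega>) \<partial>M)) \<longlonglongrightarrow> 0"
    by (rule Lim_null_comparison[OF always_eventually L2_tendsto_abs_mean[OF assms]]) (simp add: close)
  then show ?thesis by (rule LIM_zero_cancel)
qed

end

section \<open>The supercritical limit\<close>

context pa_process
begin

lemma adapted_L2: "adapted n F \<Longrightarrow> L2 F"
  unfolding L2_def
  by (intro conjI adapted_measurable integrable_adapted adapted_comp[where h = "\<lambda>x. x\<^sup>2"])

lemma L2_walk: "n \<ge> 1 \<Longrightarrow> L2 (walk u v n)"
  by (rule adapted_L2[OF adapted_walk])

text \<open>
  A multiple of the total weight is a particular solution of the recursion for the second moment, and
  \<open>growth \<alpha> (2 * \<xi>)\<close> solves the homogeneous one.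
\<close>

lemma imbalance_sq_eq:
  assumes n: "n \<ge> 1" and q: "3 - \<alpha> - 4 * p \<noteq> 0"
  shows "imbalance_sq n = step_var / (3 - \<alpha> - 4 * p) * w n
    + (1 - step_var / (3 - \<alpha> - 4 * p)) * growth \<alpha> (2 * \<xi>) n"
  using n
proof (induction n rule: nat_induct_at_least)
  case base
  show ?case by simp
next
  case (Suc n)
  define c where "c = step_var / (3 - \<alpha> - 4 * p)"
  have w: "w n \<ge> 1" by (rule w_ge_1[OF Suc.hyps])
  have "c * (3 - \<alpha> - 4 * p) = step_var" using q by (simp add: c_def)
  then have c: "step_var = c * (1 + \<alpha>) - c * (2 * \<xi>)" by (simp add: \<xi>_def algebra_simps)
  have "imbalance_sq (Suc n) = (c * w n + (1 - c) * growth \<alpha> (2 * \<xi>) n) * (1 + 2 * \<xi> / w n) + step_var"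
    using imbalance_sq_Suc[OF Suc.hyps] Suc.IH by (simp add: c_def)
  also have "\<dots> = c * (w n + (1 + \<alpha>)) + (1 - c) * (growth \<alpha> (2 * \<xi>) n * (1 + 2 * \<xi> / w n))"
    unfolding c using w by (simp add: field_simps)
  finally show ?case by (simp add: total_weight_Suc growth_Suc[OF Suc.hyps] c_def)
qed

text \<open>
  The colours are symmetric, so the first moment becomes informative only after multiplication by the
  sign of the root.
\<close>

lemma mean_root_imbalance:
  assumes "n \<ge> 1"
  shows "(\<integral>\<omega>. root_sign col \<omega> * imbalance n \<omega> \<partial>M) = growth \<alpha> \<xi> n"
  using assms
proof (induction n rule: nat_induct_at_least)
  case base
  have "root_sign col \<omega> * root_sign col \<omega> = 1" for \<omega> by (simp add: root_sign_def)
  then show ?case by (simp add: prob_space)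
next
  case (Suc n)
  let ?B = "root_sign col"
  have B: "adapted n ?B" by (rule adapted_root_sign[OF Suc.hyps])
  have BD: "adapted n (\<lambda>\<omega>. ?B \<omega> * imbalance n \<omega>)"
    by (rule adapted_comp2[OF B adapted_walk[OF Suc.hyps], where h = "(*)"])
  have Bs: "adapted (Suc n) (\<lambda>\<omega>. ?B \<omega> * (parent_sign n \<omega> * ((1 + \<alpha>) + (- 2) * flip n \<omega>)))"
    using adapted_mono[OF B, of "Suc n"] Suc.hyps
    by (intro adapted_comp2[where h = "(*)"] adapted_parent_sign adapted_comp[OF adapted_flip, where h = "\<lambda>x. (1 + \<alpha>) + (- 2) * x"]) auto
  have "(\<integral>\<omega>. ?B \<omega> * imbalance (Suc n) \<omega> \<partial>M) =
      (\<integral>\<omega>. ?B \<omega> * imbalance n \<omega> + ?B \<omega> * (parent_sign n \<omega> * ((1 + \<alpha>) + (- 2) * flip n \<omega>)) \<partial>M)"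
    unfolding walk_Suc[OF Suc.hyps] distrib_left ..
  also have "\<dots> = (\<integral>\<omega>. ?B \<omega> * imbalance n \<omega> \<partial>M)
      + (\<integral>\<omega>. ?B \<omega> * (parent_sign n \<omega> * ((1 + \<alpha>) + (- 2) * flip n \<omega>)) \<partial>M)"
    by (rule Bochner_Integration.integral_add[OF integrable_adapted[OF BD] integrable_adapted[OF Bs]])
  also have "(\<integral>\<omega>. ?B \<omega> * (parent_sign n \<omega> * ((1 + \<alpha>) + (- 2) * flip n \<omega>)) \<partial>M) =
      ((1 + \<alpha>) + (- 2) * (1 - p)) * (\<integral>\<omega>. ?B \<omega> * drift n \<omega> \<partial>M)"
    by (rule mean_step[OF Suc.hyps B])
  also have "(\<integral>\<omega>. ?B \<omega> * drift n \<omega> \<partial>M) = (\<integral>\<omega>. ?B \<omega> * imbalance n \<omega> \<partial>M) / w n"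
    by (simp add: drift_def)
  also have "(1 + \<alpha>) + (- 2) * (1 - p) = \<xi>" by (simp add: \<xi>_def)
  finally show ?case using Suc.IH by (simp add: growth_Suc[OF Suc.hyps] algebra_simps)
qed

lemma xi_supercritical:
  assumes "4 * p > 3 - \<alpha>"
  shows "\<xi> > 0" "\<xi> / (1 + \<alpha>) > 1 / 2"
proof -
  have "\<xi> > (1 + \<alpha>) / 2" using assms by (simp add: \<xi>_def)
  then show "\<xi> / (1 + \<alpha>) > 1 / 2" using alpha_gt by (simp add: field_simps)
  show "\<xi> > 0" using \<open>\<xi> > (1 + \<alpha>) / 2\<close> alpha_gt by simp
qed

text \<open>
  The imbalance divided by its growth factor is a martingale with increments of variance at most
  \<open>step_var / growth\<^sup>2\<close>; above the critical value these variances are summable.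
\<close>

lemma normalised_imbalance_increment:
  assumes \<xi>: "\<xi> > 0" and m: "1 \<le> m" "m \<le> n"
  defines "V \<equiv> \<lambda>n \<omega>. imbalance n \<omega> / growth \<alpha> \<xi> n"
  shows "(\<integral>\<omega>. (V n \<omega> - V m \<omega>)\<^sup>2 \<partial>M) \<le> step_var * (\<Sum>k\<in>{m..<n}. 1 / (growth \<alpha> \<xi> (Suc k))\<^sup>2)"
  using m(2)
proof (induction n rule: dec_induct)
  case base
  show ?case by simp
next
  case (step n)
  then have n: "n \<ge> 1" using m by simp
  define G where "G = growth \<alpha> \<xi> (Suc n)"
  have G1: "G \<ge> 1" unfolding G_def by (rule growth_ge_1[OF alpha_gt]) (use \<xi> in simp)
  have w: "w n \<ge> 1" by (rule w_ge_1[OF n])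
  have f: "1 + \<xi> / w n > 0" using \<xi> w by (simp add: add_pos_nonneg)
  have aV: "adapted k (V k)" if "k \<ge> 1" for k
    unfolding V_def by (rule adapted_comp[OF adapted_walk[OF that], where h = "\<lambda>x. x / growth \<alpha> \<xi> k"])
  define \<kappa> where "\<kappa> = \<xi> / G"
  define H where "H \<omega> = V n \<omega> - V m \<omega>" for \<omega>
  define F where "F \<omega> = H \<omega> - \<kappa> * drift n \<omega>" for \<omega>
  have aH: "adapted n H" unfolding H_def[abs_def]
    by (rule adapted_comp2[OF aV[OF n] adapted_mono[OF aV[OF m(1)] step.hyps(1)], where h = "(-)"])
  have aF: "adapted n F" unfolding F_def[abs_def]
    by (rule adapted_comp2[OF aH adapted_drift[OF n], where h = "\<lambda>x y. x - \<kappa> * y"])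
  have "V (Suc n) \<omega> - V m \<omega> = F \<omega> + parent_sign n \<omega> * ((1 + \<alpha>) / G + (- 2 / G) * flip n \<omega>)" for \<omega>
  proof -
    have "V n \<omega> = imbalance n \<omega> / G * (1 + \<xi> / w n)"
      using f by (simp add: V_def G_def growth_Suc[OF n])
    also have "\<dots> = imbalance n \<omega> / G + \<kappa> * drift n \<omega>"
      by (simp add: \<kappa>_def drift_def distrib_left)
    finally have "imbalance n \<omega> / G = V n \<omega> - \<kappa> * drift n \<omega>" by simp
    moreover have "V (Suc n) \<omega> = imbalance n \<omega> / G + parent_sign n \<omega> * ((1 + \<alpha>) / G + (- 2 / G) * flip n \<omega>)"
      unfolding V_def G_def[symmetric] walk_Suc[OF n]
      by (simp add: add_divide_distrib diff_divide_distrib algebra_simps)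
    ultimately show ?thesis by (simp add: F_def H_def)
  qed
  then have "(\<integral>\<omega>. (V (Suc n) \<omega> - V m \<omega>)\<^sup>2 \<partial>M) =
      (\<integral>\<omega>. (F \<omega> + parent_sign n \<omega> * ((1 + \<alpha>) / G + (- 2 / G) * flip n \<omega>))\<^sup>2 \<partial>M)" by simp
  also have "\<dots> = (\<integral>\<omega>. (F \<omega>)\<^sup>2 \<partial>M) + 2 * \<kappa> * (\<integral>\<omega>. F \<omega> * drift n \<omega> \<partial>M) + step_var * (1 / G\<^sup>2)"
  proof -
    have 1: "(1 + \<alpha>) / G + (- 2 / G) * (1 - p) = \<kappa>"
      by (simp add: \<kappa>_def \<xi>_def add_divide_distrib diff_divide_distrib algebra_simps)
    have 2: "(1 + \<alpha>) / G + - 2 / G = (\<alpha> - 1) / G" by (simp add: add_divide_distrib diff_divide_distrib)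
    have 3: "p * ((1 + \<alpha>) / G)\<^sup>2 + (1 - p) * ((\<alpha> - 1) / G)\<^sup>2 = step_var * (1 / G\<^sup>2)"
      unfolding step_var_eq power_divide by (simp add: add_divide_distrib)
    show ?thesis
      unfolding second_moment_step[OF n aF] 1 2 3 ..
  qed
  also have "(\<integral>\<omega>. (F \<omega>)\<^sup>2 \<partial>M) + 2 * \<kappa> * (\<integral>\<omega>. F \<omega> * drift n \<omega> \<partial>M) \<le> (\<integral>\<omega>. (H \<omega>)\<^sup>2 \<partial>M)"
  proof -
    have iF: "integrable M (\<lambda>\<omega>. (F \<omega>)\<^sup>2)" by (rule integrable_adapted[OF adapted_comp[OF aF]])
    have iFd: "integrable M (\<lambda>\<omega>. 2 * \<kappa> * (F \<omega> * drift n \<omega>))"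
      by (rule integrable_adapted[OF adapted_comp2[OF aF adapted_drift[OF n], where h = "\<lambda>x y. 2 * \<kappa> * (x * y)"]])
    have "(\<integral>\<omega>. (F \<omega>)\<^sup>2 \<partial>M) + 2 * \<kappa> * (\<integral>\<omega>. F \<omega> * drift n \<omega> \<partial>M) =
        (\<integral>\<omega>. (F \<omega>)\<^sup>2 + 2 * \<kappa> * (F \<omega> * drift n \<omega>) \<partial>M)"
      using iF iFd by simp
    also have "\<dots> \<le> (\<integral>\<omega>. (H \<omega>)\<^sup>2 \<partial>M)"
    proof (rule integral_mono)
      show "integrable M (\<lambda>\<omega>. (F \<omega>)\<^sup>2 + 2 * \<kappa> * (F \<omega> * drift n \<omega>))" using iF iFd by (rule Bochner_Integration.integrable_add)
      show "integrable M (\<lambda>\<omega>. (H \<omega>)\<^sup>2)" by (rule integrable_adapted[OF adapted_comp[OF aH]])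
      fix \<omega>
      have "(F \<omega>)\<^sup>2 + 2 * \<kappa> * (F \<omega> * drift n \<omega>) = (H \<omega>)\<^sup>2 - (\<kappa> * drift n \<omega>)\<^sup>2"
        by (simp add: F_def power2_eq_square algebra_simps)
      then show "(F \<omega>)\<^sup>2 + 2 * \<kappa> * (F \<omega> * drift n \<omega>) \<le> (H \<omega>)\<^sup>2" by simp
    qed
    finally show ?thesis .
  qed
  finally have "(\<integral>\<omega>. (V (Suc n) \<omega> - V m \<omega>)\<^sup>2 \<partial>M) \<le> (\<integral>\<omega>. (V n \<omega> - V m \<omega>)\<^sup>2 \<partial>M) + step_var * (1 / G\<^sup>2)"
    by (simp add: H_def)
  then show ?case using step.IH step.hyps by (simp add: G_def distrib_left)
qed

lemma normalised_imbalance_limit: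
  assumes sup: "4 * p > 3 - \<alpha>"
  obtains W where "L2_tendsto (\<lambda>n \<omega>. imbalance (Suc n) \<omega> / growth \<alpha> \<xi> (Suc n)) W"
proof -
  note \<xi> = xi_supercritical[OF sup]
  let ?r = "\<xi> / (1 + \<alpha>)"
  define L where "L = Gamma (1 / (1 + \<alpha>)) * rGamma ((1 + \<xi>) / (1 + \<alpha>))"
  have L0: "L > 0"
  proof -
    have "Gamma (1 / (1 + \<alpha>)) > 0" "Gamma ((1 + \<xi>) / (1 + \<alpha>)) > 0"
      using alpha_gt \<xi> by (auto intro!: Gamma_real_pos divide_pos_pos add_pos_pos)
    then show ?thesis by (simp add: L_def rGamma_inverse_Gamma)
  qed
  have "eventually (\<lambda>n. L / 2 < growth \<alpha> \<xi> n / real n powr ?r) sequentially"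
    by (rule order_tendstoD(1)[OF growth_asymptotics[OF alpha_gt, of \<xi>, folded L_def]]) (use L0 in simp)
  then have "eventually (\<lambda>n. norm (1 / (growth \<alpha> \<xi> n)\<^sup>2) \<le> 4 / L\<^sup>2 * real n powr (- 2 * ?r)) sequentially"
    using eventually_ge_at_top[of 1]
  proof eventually_elim
    case (elim n)
    let ?P = "real n powr ?r"
    have P: "?P > 0" using elim by simp
    have "L / 2 * ?P \<le> growth \<alpha> \<xi> n" using elim P by (simp add: field_simps)
    then have "(L / 2 * ?P)\<^sup>2 \<le> (growth \<alpha> \<xi> n)\<^sup>2" using L0 P by (intro power_mono) auto
    then have "1 / (growth \<alpha> \<xi> n)\<^sup>2 \<le> 1 / (L / 2 * ?P)\<^sup>2" using L0 P by (intro divide_left_mono mult_pos_pos) auto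
    also have "\<dots> = 4 / L\<^sup>2 * (1 / (?P * ?P))" by (simp add: power_mult_distrib power_divide power2_eq_square)
    also have "1 / (?P * ?P) = real n powr (- 2 * ?r)"
      by (simp add: powr_add[symmetric] powr_minus_divide)
    finally show ?case by simp
  qed
  then have "summable (\<lambda>n. 1 / (growth \<alpha> \<xi> n)\<^sup>2)"
  proof (rule summable_comparison_test_ev)
    show "summable (\<lambda>n. 4 / L\<^sup>2 * real n powr (- 2 * ?r))"
      using \<xi>(2) by (intro summable_mult) (simp add: summable_real_powr_iff mult.commute)
  qed
  then have s: "summable (\<lambda>k. 1 / (growth \<alpha> \<xi> (Suc k))\<^sup>2)" by (subst summable_Suc_iff)
  let ?X = "\<lambda>n \<omega>. imbalance (Suc n) \<omega> / growth \<alpha> \<xi> (Suc n)"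
  have "L2 (?X n)" for n
    using L2_scale[OF L2_walk[of "Suc n" "1 + \<alpha>" "- 2"], of "1 / growth \<alpha> \<xi> (Suc n)"] by simp
  moreover have "\<exists>N. \<forall>m\<ge>N. \<forall>n\<ge>N. (\<integral>\<omega>. (?X m \<omega> - ?X n \<omega>)\<^sup>2 \<partial>M) \<le> \<epsilon>" if \<epsilon>: "\<epsilon> > 0" for \<epsilon>
  proof -
    have "\<epsilon> / (step_var + 1) > 0" using \<epsilon> step_var_nonneg by simp
    with s[unfolded summable_Cauchy] obtain N where
      N: "\<And>m n. m \<ge> N \<Longrightarrow> norm (\<Sum>k\<in>{m..<n}. 1 / (growth \<alpha> \<xi> (Suc k))\<^sup>2) < \<epsilon> / (step_var + 1)" by blast
    have le: "(\<integral>\<omega>. (?X n \<omega> - ?X m \<omega>)\<^sup>2 \<partial>M) \<le> \<epsilon>" if "m \<ge> N" "m \<le> n" for m n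
    proof -
      have "(\<integral>\<omega>. (?X n \<omega> - ?X m \<omega>)\<^sup>2 \<partial>M) \<le> step_var * (\<Sum>k\<in>{Suc m..<Suc n}. 1 / (growth \<alpha> \<xi> (Suc k))\<^sup>2)"
        by (rule normalised_imbalance_increment[OF \<xi>(1)]) (use that in auto)
      also have "\<dots> \<le> step_var * (\<epsilon> / (step_var + 1))"
        using N[of "Suc m" "Suc n"] that step_var_nonneg by (intro mult_left_mono) auto
      also have "\<dots> \<le> \<epsilon>" using \<epsilon> step_var_nonneg by (simp add: field_simps)
      finally show ?thesis .
    qed
    have "(\<integral>\<omega>. (?X m \<omega> - ?X n \<omega>)\<^sup>2 \<partial>M) \<le> \<epsilon>" if "m \<ge> N" "n \<ge> N" for m n
    proof (cases "m \<le> n")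
      case True
      then show ?thesis using le[OF that(1) True] by (simp add: power2_commute)
    next
      case False
      then show ?thesis using le[OF that(2)] by simp
    qed
    then show ?thesis by blast
  qed
  ultimately show ?thesis using L2_complete[of ?X] that by blast
qed

text \<open>
  Fluctuations of order \<open>sqrt n\<close> are invisible on the scale \<open>n powr \<beta>\<close>.
\<close>

lemma scaled_null:
  assumes \<beta>: "\<beta> > 1 / 2" and F: "\<And>n. L2 (F n)"
    and le: "\<And>n. (\<integral>\<omega>. (F n \<omega>)\<^sup>2 \<partial>M) \<le> C * real (Suc n)"
  shows "L2_tendsto (\<lambda>n \<omega>. F n \<omega> / real (Suc n) powr \<beta>) (\<lambda>_. 0)"
proof (rule L2_tendsto_null)
  show "L2 (\<lambda>\<omega>. F n \<omega> / real (Suc n) powr \<beta>)" for n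
    using L2_scale[OF F[of n], of "1 / real (Suc n) powr \<beta>"] by simp
  have "(\<lambda>n. real n powr (1 - 2 * \<beta>)) \<longlonglongrightarrow> 0"
    using \<beta> by (intro tendsto_neg_powr filterlim_real_sequentially) auto
  from tendsto_mult_right_zero[OF LIMSEQ_Suc[OF this]]
  have lim: "(\<lambda>n. C * real (Suc n) powr (1 - 2 * \<beta>)) \<longlonglongrightarrow> 0" .
  show "(\<lambda>n. \<integral>\<omega>. (F n \<omega> / real (Suc n) powr \<beta>)\<^sup>2 \<partial>M) \<longlonglongrightarrow> 0"
  proof (rule tendsto_sandwich[OF _ _ tendsto_const lim])
    have "(\<integral>\<omega>. (F n \<omega> / real (Suc n) powr \<beta>)\<^sup>2 \<partial>M) \<le> C * real (Suc n) powr (1 - 2 * \<beta>)" for n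
    proof -
      let ?P = "real (Suc n) powr \<beta>"
      have "(\<integral>\<omega>. (F n \<omega> / ?P)\<^sup>2 \<partial>M) = (\<integral>\<omega>. (F n \<omega>)\<^sup>2 \<partial>M) / ?P\<^sup>2" by (simp add: power_divide)
      also have "\<dots> \<le> C * real (Suc n) / ?P\<^sup>2" using le by (rule divide_right_mono) simp
      also have "?P\<^sup>2 = real (Suc n) powr (2 * \<beta>)" by (simp add: power2_eq_square powr_add[symmetric])
      also have "C * real (Suc n) / real (Suc n) powr (2 * \<beta>) = C * real (Suc n) powr (1 - 2 * \<beta>)"
        by (simp add: powr_diff)
      finally show ?thesis .
    qed
    then show "eventually (\<lambda>n. (\<integral>\<omega>. (F n \<omega> / real (Suc n) powr \<beta>)\<^sup>2 \<partial>M) \<le> C * real (Suc n) powr (1 - 2 * \<beta>)) sequentially"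
      by simp
  qed simp
qed

text \<open>
  Every walk differs from a multiple of the imbalance by a martingale with bounded increments, whose
  second moment is linear and hence negligible above the critical value.
\<close>

lemma supercritical_limit:
  assumes sup: "4 * p > 3 - \<alpha>"
  obtains Z where "L2 Z"
    "(\<integral>\<omega>. Z \<omega> \<partial>M) = Gamma (1 / (1 + \<alpha>)) / Gamma ((2 * p + \<alpha>) / (1 + \<alpha>))"
    "(\<integral>\<omega>. (Z \<omega>)\<^sup>2 \<partial>M) = (Gamma (1 / (1 + \<alpha>)) * (1 + \<alpha>) * (4 * p + \<alpha> - 2)) /
       (Gamma ((4 * p + 2 * \<alpha> - 1) / (1 + \<alpha>)) * (4 * p + \<alpha> - 3))"
    "\<And>u v. L2_tendsto (\<lambda>n \<omega>. walk u v (Suc n) \<omega> / real (Suc n) powr (\<xi> / (1 + \<alpha>)))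
       (\<lambda>\<omega>. (u + v * (1 - p)) / \<xi> * (root_sign col \<omega> * Z \<omega>))"
proof -
  note \<xi> = xi_supercritical[OF sup]
  define \<beta> where "\<beta> = \<xi> / (1 + \<alpha>)"
  have \<beta>: "\<beta> > 1 / 2" using \<xi>(2) by (simp add: \<beta>_def)
  define L where "L = Gamma (1 / (1 + \<alpha>)) * rGamma ((1 + \<xi>) / (1 + \<alpha>))"
  obtain W where W: "L2_tendsto (\<lambda>n \<omega>. imbalance (Suc n) \<omega> / growth \<alpha> \<xi> (Suc n)) W"
    using normalised_imbalance_limit[OF sup] by blast
  define Z where "Z \<omega> = L * (root_sign col \<omega> * W \<omega>)" for \<omega>
  have B2: "root_sign col \<omega> * root_sign col \<omega> = 1" "\<bar>root_sign col \<omega>\<bar> = 1" for \<omega>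
    by (auto simp: root_sign_def)
  have Bm: "root_sign col \<in> borel_measurable M" by (rule adapted_measurable[OF adapted_root_sign[of 1]]) simp
  have LW: "L2 W" using W by (simp add: L2_tendsto_def)
  have LBW: "L2 (\<lambda>\<omega>. root_sign col \<omega> * W \<omega>)"
    using LW Bm by (auto simp: L2_def power_mult_distrib)
  have LZ: "L2 Z" unfolding Z_def[abs_def] by (rule L2_scale[OF LBW])
  have G1: "growth \<alpha> \<xi> n \<ge> 1" for n by (rule growth_ge_1[OF alpha_gt]) (use \<xi> in simp)
  have Glim: "(\<lambda>n. growth \<alpha> \<xi> (Suc n) / real (Suc n) powr \<beta>) \<longlonglongrightarrow> L"
    using LIMSEQ_Suc[OF growth_asymptotics[OF alpha_gt, of \<xi>]] by (simp only: L_def \<beta>_def)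
  have D: "L2_tendsto (\<lambda>n \<omega>. imbalance (Suc n) \<omega> / real (Suc n) powr \<beta>) (\<lambda>\<omega>. L * W \<omega>)"
  proof -
    have "growth \<alpha> \<xi> (Suc n) / real (Suc n) powr \<beta> * (imbalance (Suc n) \<omega> / growth \<alpha> \<xi> (Suc n)) =
        imbalance (Suc n) \<omega> / real (Suc n) powr \<beta>" for n \<omega>
      using G1[of "Suc n"] by simp
    then show ?thesis using L2_tendsto_scale[OF W Glim] by (simp only:)
  qed
  have LWZ: "L * W \<omega> = root_sign col \<omega> * Z \<omega>" for \<omega>
    using B2(1)[of \<omega>] by (simp add: Z_def mult.left_commute[of _ L] mult.assoc[symmetric])
  have "L2_tendsto (\<lambda>n \<omega>. walk u v (Suc n) \<omega> / real (Suc n) powr \<beta>)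
       (\<lambda>\<omega>. (u + v * (1 - p)) / \<xi> * (root_sign col \<omega> * Z \<omega>))" for u v
  proof -
    define m where "m = u + v * (1 - p)"
    \<comment> \<open>The combination of walk and imbalance with these step parameters has increments of conditional mean zero.\<close>
    define u' v' where "u' = \<xi> * u - m * (1 + \<alpha>)" and "v' = \<xi> * v + 2 * m"
    have uv': "u' + v' * (1 - p) = 0"
      by (simp add: u'_def v'_def m_def \<xi>_def algebra_simps)
    define F where "F n \<omega> = \<xi> * walk u v n \<omega> - m * imbalance n \<omega>" for n \<omega>
    have aF: "adapted n (F n)" if n: "n \<ge> 1" for n
      unfolding F_def[abs_def]
      by (rule adapted_comp2[OF adapted_walk[OF n] adapted_walk[OF n], where h = "\<lambda>x y. \<xi> * x - m * y"])
    have FSuc: "F (Suc k) \<omega> = F k \<omega> + parent_sign k \<omega> * (u' + v' * flip k \<omega>)" if "k \<ge> 1" for k \<omega>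
      unfolding F_def walk_Suc[OF that] u'_def v'_def by (simp add: algebra_simps)
    define s where "s = p * u'\<^sup>2 + (1 - p) * (u' + v')\<^sup>2"
    have s0: "s \<ge> 0" using p_nonneg p_le_1 by (simp add: s_def)
    have "(\<integral>\<omega>. (F (Suc n) \<omega>)\<^sup>2 \<partial>M) \<le> ((\<integral>\<omega>. (F 1 \<omega>)\<^sup>2 \<partial>M) + s) * real (Suc n)" for n
    proof -
      have "(\<integral>\<omega>. (F (Suc n) \<omega>)\<^sup>2 \<partial>M) = (\<integral>\<omega>. (F 1 \<omega>)\<^sup>2 \<partial>M) + s * (real (Suc n) - 1)"
        unfolding s_def by (rule martingale_second_moment[OF _ uv' aF FSuc]) auto
      also have "\<dots> \<le> (\<integral>\<omega>. (F 1 \<omega>)\<^sup>2 \<partial>M) * real (Suc n) + s * real (Suc n)"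
      proof (rule add_mono)
        have "(\<integral>\<omega>. (F 1 \<omega>)\<^sup>2 \<partial>M) * 1 \<le> (\<integral>\<omega>. (F 1 \<omega>)\<^sup>2 \<partial>M) * real (Suc n)"
          by (rule mult_left_mono) auto
        then show "(\<integral>\<omega>. (F 1 \<omega>)\<^sup>2 \<partial>M) \<le> (\<integral>\<omega>. (F 1 \<omega>)\<^sup>2 \<partial>M) * real (Suc n)" by simp
        show "s * (real (Suc n) - 1) \<le> s * real (Suc n)" using s0 by (intro mult_left_mono) auto
      qed
      finally show ?thesis by (simp add: distrib_right)
    qed
    from scaled_null[OF \<beta> adapted_L2[OF aF] this]
    have N: "L2_tendsto (\<lambda>n \<omega>. F (Suc n) \<omega> / real (Suc n) powr \<beta>) (\<lambda>_. 0)" by simp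
    from L2_tendsto_add[OF L2_tendsto_scale[OF N tendsto_const[of "1 / \<xi>"]] L2_tendsto_scale[OF D tendsto_const[of "m / \<xi>"]]]
    have "L2_tendsto (\<lambda>n \<omega>. 1 / \<xi> * (F (Suc n) \<omega> / real (Suc n) powr \<beta>) + m / \<xi> * (imbalance (Suc n) \<omega> / real (Suc n) powr \<beta>))
        (\<lambda>\<omega>. 1 / \<xi> * 0 + m / \<xi> * (L * W \<omega>))" .
    moreover have "1 / \<xi> * (F (Suc n) \<omega> / P) + m / \<xi> * (imbalance (Suc n) \<omega> / P) = walk u v (Suc n) \<omega> / P" for n \<omega> P
      using \<xi>(1) by (simp add: F_def diff_divide_distrib)
    ultimately show ?thesis by (simp only: LWZ mult_zero_right add_0_left m_def)
  qed
  moreover have "(\<integral>\<omega>. Z \<omega> \<partial>M) = Gamma (1 / (1 + \<alpha>)) / Gamma ((2 * p + \<alpha>) / (1 + \<alpha>))"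
  proof -
    let ?X = "\<lambda>n \<omega>. imbalance (Suc n) \<omega> / growth \<alpha> \<xi> (Suc n)"
    have LX: "L2 (?X n)" for n using W by (simp add: L2_tendsto_def)
    have iBX: "integrable M (\<lambda>\<omega>. root_sign col \<omega> * ?X n \<omega>)" for n
    proof (rule integrable_adapted)
      show "adapted (Suc n) (\<lambda>\<omega>. root_sign col \<omega> * ?X n \<omega>)"
        by (rule adapted_comp2[OF adapted_root_sign adapted_walk, where h = "\<lambda>x y. x * (y / growth \<alpha> \<xi> (Suc n))"]) auto
    qed
    have iBW: "integrable M (\<lambda>\<omega>. root_sign col \<omega> * W \<omega>)" by (rule L2_integrable[OF LBW])
    have one: "(\<integral>\<omega>. root_sign col \<omega> * ?X n \<omega> \<partial>M) = 1" for n
      using mean_root_imbalance[of "Suc n"] G1[of "Suc n"] by simp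
    have "(\<lambda>n. (\<integral>\<omega>. root_sign col \<omega> * ?X n \<omega> \<partial>M) - (\<integral>\<omega>. root_sign col \<omega> * W \<omega> \<partial>M)) \<longlonglongrightarrow> 0"
    proof (rule Lim_null_comparison[OF always_eventually L2_tendsto_abs_mean[OF W]], rule allI)
      fix n
      have "norm ((\<integral>\<omega>. root_sign col \<omega> * ?X n \<omega> \<partial>M) - (\<integral>\<omega>. root_sign col \<omega> * W \<omega> \<partial>M)) =
          \<bar>\<integral>\<omega>. root_sign col \<omega> * ?X n \<omega> - root_sign col \<omega> * W \<omega> \<partial>M\<bar>"
        by (simp only: Bochner_Integration.integral_diff[OF iBX iBW] real_norm_def)
      also have "\<dots> \<le> (\<integral>\<omega>. \<bar>root_sign col \<omega> * ?X n \<omega> - root_sign col \<omega> * W \<omega>\<bar> \<partial>M)"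
        by (rule integral_abs_bound)
      also have "\<dots> = (\<integral>\<omega>. \<bar>?X n \<omega> - W \<omega>\<bar> \<partial>M)"
        unfolding right_diff_distrib[symmetric] abs_mult B2(2) by simp
      finally show "norm ((\<integral>\<omega>. root_sign col \<omega> * ?X n \<omega> \<partial>M) - (\<integral>\<omega>. root_sign col \<omega> * W \<omega> \<partial>M)) \<le>
          (\<integral>\<omega>. \<bar>?X n \<omega> - W \<omega>\<bar> \<partial>M)" .
    qed
    then have "(\<lambda>n::nat. 1 - (\<integral>\<omega>. root_sign col \<omega> * W \<omega> \<partial>M)) \<longlonglongrightarrow> 0" by (simp only: one)
    then have "(\<integral>\<omega>. root_sign col \<omega> * W \<omega> \<partial>M) = 1" by (simp add: LIMSEQ_const_iff)
    then have "(\<integral>\<omega>. Z \<omega> \<partial>M) = L" by (simp add: Z_def)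
    moreover have "1 + \<xi> = 2 * p + \<alpha>" by (simp add: \<xi>_def)
    ultimately show ?thesis by (simp add: L_def rGamma_inverse_Gamma divide_inverse)
  qed
  moreover have "(\<integral>\<omega>. (Z \<omega>)\<^sup>2 \<partial>M) = (Gamma (1 / (1 + \<alpha>)) * (1 + \<alpha>) * (4 * p + \<alpha> - 2)) /
       (Gamma ((4 * p + 2 * \<alpha> - 1) / (1 + \<alpha>)) * (4 * p + \<alpha> - 3))"
  proof -
    define c where "c = step_var / (3 - \<alpha> - 4 * p)"
    have q: "3 - \<alpha> - 4 * p \<noteq> 0" using sup by simp
    let ?R = "Gamma (1 / (1 + \<alpha>)) * rGamma ((1 + 2 * \<xi>) / (1 + \<alpha>))"
    have Psq: "(real n powr \<beta>)\<^sup>2 = real n powr (2 * \<xi> / (1 + \<alpha>))" for n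
      by (simp add: power2_eq_square powr_add[symmetric] \<beta>_def)
    have "(\<lambda>n. c * (w n / real n powr (2 * \<xi> / (1 + \<alpha>))) + (1 - c) * (growth \<alpha> (2 * \<xi>) n / real n powr (2 * \<xi> / (1 + \<alpha>))))
        \<longlonglongrightarrow> c * 0 + (1 - c) * ?R"
    proof (intro tendsto_intros growth_asymptotics[OF alpha_gt])
      have e: "2 * \<xi> / (1 + \<alpha>) > 1" using \<xi>(2) by (simp add: mult.commute)
      then have "(\<lambda>n. (1 + \<alpha>) * real n powr (1 - 2 * \<xi> / (1 + \<alpha>)) - \<alpha> * real n powr (- (2 * \<xi> / (1 + \<alpha>)))) \<longlonglongrightarrow> (1 + \<alpha>) * 0 - \<alpha> * 0"
        by (intro tendsto_intros tendsto_neg_powr filterlim_real_sequentially) auto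
      then have lim: "(\<lambda>n. (1 + \<alpha>) * real n powr (1 - 2 * \<xi> / (1 + \<alpha>)) - \<alpha> * real n powr (- (2 * \<xi> / (1 + \<alpha>)))) \<longlonglongrightarrow> 0"
        by (simp only: mult_zero_right diff_self)
      show "(\<lambda>n. w n / real n powr (2 * \<xi> / (1 + \<alpha>))) \<longlonglongrightarrow> 0"
      proof (rule Lim_transform_eventually[OF lim])
        show "eventually (\<lambda>n. (1 + \<alpha>) * real n powr (1 - 2 * \<xi> / (1 + \<alpha>)) - \<alpha> * real n powr (- (2 * \<xi> / (1 + \<alpha>))) =
            w n / real n powr (2 * \<xi> / (1 + \<alpha>))) sequentially"
          using eventually_ge_at_top[of 1]
        proof eventually_elim
          case (elim n)
          then show ?case
            by (simp add: powr_diff powr_minus_divide total_weight_def diff_divide_distrib)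
        qed
      qed
    qed
    then have 1: "(\<lambda>n. c * (w n / real n powr (2 * \<xi> / (1 + \<alpha>))) + (1 - c) * (growth \<alpha> (2 * \<xi>) n / real n powr (2 * \<xi> / (1 + \<alpha>))))
        \<longlonglongrightarrow> (1 - c) * ?R" by (simp only: mult_zero_right add_0_left)
    have "(\<integral>\<omega>. (imbalance (Suc n) \<omega> / real (Suc n) powr \<beta>)\<^sup>2 \<partial>M) =
        c * (w (Suc n) / real (Suc n) powr (2 * \<xi> / (1 + \<alpha>))) + (1 - c) * (growth \<alpha> (2 * \<xi>) (Suc n) / real (Suc n) powr (2 * \<xi> / (1 + \<alpha>)))" for n
    proof -
      have "(\<integral>\<omega>. (imbalance (Suc n) \<omega> / real (Suc n) powr \<beta>)\<^sup>2 \<partial>M) = imbalance_sq (Suc n) / real (Suc n) powr (2 * \<xi> / (1 + \<alpha>))"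
        unfolding power_divide Psq by (simp add: imbalance_sq_def)
      also have "imbalance_sq (Suc n) = c * w (Suc n) + (1 - c) * growth \<alpha> (2 * \<xi>) (Suc n)"
        unfolding c_def by (rule imbalance_sq_eq[OF _ q]) simp
      finally show ?thesis by (simp add: add_divide_distrib)
    qed
    then have "(\<lambda>n. \<integral>\<omega>. (imbalance (Suc n) \<omega> / real (Suc n) powr \<beta>)\<^sup>2 \<partial>M) \<longlonglongrightarrow> (1 - c) * ?R"
      using LIMSEQ_Suc[OF 1] by (simp only:)
    moreover have "(\<lambda>n. \<integral>\<omega>. (imbalance (Suc n) \<omega> / real (Suc n) powr \<beta>)\<^sup>2 \<partial>M) \<longlonglongrightarrow> (\<integral>\<omega>. (L * W \<omega>)\<^sup>2 \<partial>M)"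
      by (rule L2_tendsto_second_moment[OF D])
    ultimately have "(\<integral>\<omega>. (L * W \<omega>)\<^sup>2 \<partial>M) = (1 - c) * ?R" using LIMSEQ_unique by blast
    moreover have "(L * W \<omega>)\<^sup>2 = (Z \<omega>)\<^sup>2" for \<omega> unfolding LWZ by (simp add: power_mult_distrib)
    ultimately have EZ2: "(\<integral>\<omega>. (Z \<omega>)\<^sup>2 \<partial>M) = (1 - c) * ?R" by simp
    have q': "4 * p + \<alpha> - 3 \<noteq> 0" using sup by simp
    have "1 - c = (1 + \<alpha>) * (4 * p + \<alpha> - 2) / (4 * p + \<alpha> - 3)"
    proof -
      have "c = - step_var / (4 * p + \<alpha> - 3)"
        unfolding c_def using q q' by (simp add: divide_simps) (simp add: algebra_simps)
      then have "1 - c = (4 * p + \<alpha> - 3 + step_var) / (4 * p + \<alpha> - 3)"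
        using q' by (simp add: add_divide_distrib)
      also have "4 * p + \<alpha> - 3 + step_var = (1 + \<alpha>) * (4 * p + \<alpha> - 2)"
        by (simp add: step_var_def power2_eq_square algebra_simps)
      finally show ?thesis .
    qed
    moreover have "1 + 2 * \<xi> = 4 * p + 2 * \<alpha> - 1" by (simp add: \<xi>_def)
    ultimately have "(\<integral>\<omega>. (Z \<omega>)\<^sup>2 \<partial>M) = (1 + \<alpha>) * (4 * p + \<alpha> - 2) / (4 * p + \<alpha> - 3) *
        (Gamma (1 / (1 + \<alpha>)) * rGamma ((4 * p + 2 * \<alpha> - 1) / (1 + \<alpha>)))"
      using EZ2 by (simp only:)
    then show ?thesis unfolding rGamma_inverse_Gamma by (simp add: divide_inverse mult_ac)
  qed
  ultimately show ?thesis using that LZ unfolding \<beta>_def by blast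
qed

end

section \<open>The limit theorems\<close>

context pa_process
begin

lemma conv_in_distr_of_cf:
  fixes X :: "nat \<Rightarrow> 'a \<Rightarrow> real^2"
  assumes "\<And>n. X n \<in> borel_measurable M" "prob_space N" "sets N = sets borel"
    and "\<And>t. (\<lambda>n. \<integral>\<omega>. cis (t \<bullet> X n \<omega>) \<partial>M) \<longlonglongrightarrow> (\<integral>x. cis (t \<bullet> x) \<partial>N)"
  shows "conv_in_distr M X N"
proof -
  interpret cf_convergence M N X
    unfolding cf_convergence_def cf_convergence_axioms_def using assms prob_space_axioms by blast
  show ?thesis by (rule conv_in_distr)
qed

abbreviation centred_clusters :: "nat \<Rightarrow> 'a \<Rightarrow> real^2" where
  "centred_clusters n \<omega> \<equiv> cluster_counts par col n \<omega> - real n *\<^sub>R vector [(1 - p) / 2, (1 - p) / 2]"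

text \<open>
  In the coordinates sum and difference of the two counts, a linear functional of the centred cluster
  numbers is a combination of the centred number of flips and a walk.
\<close>

lemma inner_centred_clusters:
  assumes "\<omega> \<in> space M" "n \<ge> 1"
  shows "t \<bullet> (c *\<^sub>R centred_clusters n \<omega>) =
    c * ((t $ 1 - t $ 2) / 2 * walk 0 (- 1) n \<omega> + (t $ 1 + t $ 2) / 2 * (1 + flips n \<omega> - (1 - p) * real n))"
  by (simp add: inner_real2 cluster_counts_process[OF assms] field_simps)

lemma inner_centred_vertices:
  assumes "n \<ge> 1"
  shows "t \<bullet> (c *\<^sub>R (vertex_counts par col n \<omega> - real n *\<^sub>R vector [1 / 2, 1 / 2])) =
    c * ((t $ 1 - t $ 2) / 2 * walk 1 (- 2) n \<omega>)"
  by (simp add: inner_real2 vertex_counts_process[OF assms] field_simps)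

lemma clusters_conv_normal:
  assumes kl: "k \<ge> 0" "l \<ge> 0"
    and lim: "\<And>a b. (\<lambda>n. \<integral>\<omega>. cis ((a * walk 0 (- 1) n \<omega> + b * (1 + flips n \<omega> - (1 - p) * real n)) / s n) \<partial>M)
      \<longlonglongrightarrow> of_real (exp (- (a\<^sup>2 * l + b\<^sup>2 * k) / 2))"
    and S: "S = vector [vector [(k + l) / 4, (k - l) / 4], vector [(k - l) / 4, (k + l) / 4]]"
  shows "\<exists>N. centred_normal S N \<and> conv_in_distr M (\<lambda>n \<omega>. (1 / s n) *\<^sub>R centred_clusters n \<omega>) N"
proof -
  obtain N where N: "centred_normal S N" using centred_normal_plane[OF kl] unfolding S by blast
  have "conv_in_distr M (\<lambda>n \<omega>. (1 / s n) *\<^sub>R centred_clusters n \<omega>) N"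
  proof (rule conv_in_distr_of_cf)
    show "(\<lambda>\<omega>. (1 / s n) *\<^sub>R centred_clusters n \<omega>) \<in> borel_measurable M" for n
      using cluster_counts_measurable[of n] by simp
    show "prob_space N" "sets N = sets borel" using N by (auto simp: centred_normal_def)
    fix t :: "real^2"
    let ?a = "(t $ 1 - t $ 2) / 2" and ?b = "(t $ 1 + t $ 2) / 2"
    have quad: "t \<bullet> (S *v t) = ?a\<^sup>2 * l + ?b\<^sup>2 * k"
      unfolding S by (simp add: inner_real2 matrix_vector_mult_def sum_2 power2_eq_square field_simps)
    show "(\<lambda>n. \<integral>\<omega>. cis (t \<bullet> ((1 / s n) *\<^sub>R centred_clusters n \<omega>)) \<partial>M) \<longlonglongrightarrow> (\<integral>x. cis (t \<bullet> x) \<partial>N)"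
      unfolding centred_normal_cf[OF N] quad
    proof (rule Lim_transform_eventually[OF lim])
      show "eventually (\<lambda>n. (\<integral>\<omega>. cis ((?a * walk 0 (- 1) n \<omega> + ?b * (1 + flips n \<omega> - (1 - p) * real n)) / s n) \<partial>M) =
          (\<integral>\<omega>. cis (t \<bullet> ((1 / s n) *\<^sub>R centred_clusters n \<omega>)) \<partial>M)) sequentially"
        using eventually_ge_at_top[of 1]
      proof eventually_elim
        case (elim n)
        then show ?case
          by (intro Bochner_Integration.integral_cong refl) (simp only: inner_centred_clusters mult_1_left times_divide_eq_left)
      qed
    qed
  qed
  with N show ?thesis by blast
qed

text \<open>
  The shift by one avoids time zero, where there is no tree.
\<close>

lemma conv_in_distr_of_L2:
  fixes X :: "nat \<Rightarrow> 'a \<Rightarrow> real^2"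
  assumes X: "\<And>n. X n \<in> borel_measurable M" and Y: "Y \<in> borel_measurable M"
    and lim: "\<And>t. \<exists>F. L2_tendsto F (\<lambda>\<omega>. t \<bullet> Y \<omega>) \<and> (\<forall>n. \<forall>\<omega>\<in>space M. F n \<omega> = t \<bullet> X (Suc n) \<omega>)"
  shows "conv_in_distr M X (distr M borel Y)"
proof (rule conv_in_distr_of_cf[OF X])
  show "prob_space (distr M borel Y)" by (rule prob_space_distr[OF Y])
  fix t :: "real^2"
  obtain F where F: "L2_tendsto F (\<lambda>\<omega>. t \<bullet> Y \<omega>)" "\<And>n \<omega>. \<omega> \<in> space M \<Longrightarrow> F n \<omega> = t \<bullet> X (Suc n) \<omega>"
    using lim[of t] by blast
  have "(\<integral>\<omega>. cis (F n \<omega>) \<partial>M) = (\<integral>\<omega>. cis (t \<bullet> X (Suc n) \<omega>) \<partial>M)" for n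
    by (rule Bochner_Integration.integral_cong[OF refl]) (simp only: F(2))
  with L2_tendsto_cf[OF F(1)]
  have "(\<lambda>n. \<integral>\<omega>. cis (t \<bullet> X (Suc n) \<omega>) \<partial>M) \<longlonglongrightarrow> (\<integral>\<omega>. cis (t \<bullet> Y \<omega>) \<partial>M)" by simp
  moreover have "(\<integral>x. cis (t \<bullet> x) \<partial>distr M borel Y) = (\<integral>\<omega>. cis (t \<bullet> Y \<omega>) \<partial>M)"
    by (rule integral_distr[OF Y]) (intro borel_measurable_continuous_onI continuous_intros)
  ultimately show "(\<lambda>n. \<integral>\<omega>. cis (t \<bullet> X n \<omega>) \<partial>M) \<longlonglongrightarrow> (\<integral>x. cis (t \<bullet> x) \<partial>distr M borel Y)"
    by (subst filterlim_sequentially_Suc[symmetric]) simp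
qed simp

lemma supercritical_convergence:
  assumes sup: "4 * p > 3 - \<alpha>"
  defines "\<beta> \<equiv> \<xi> / (1 + \<alpha>)"
  shows "\<exists>Z. Z \<in> borel_measurable M \<and> integrable M Z \<and>
    (\<integral>\<omega>. Z \<omega> \<partial>M) = Gamma (1 / (1 + \<alpha>)) / Gamma ((2 * p + \<alpha>) / (1 + \<alpha>)) \<and>
    integrable M (\<lambda>\<omega>. (Z \<omega>)\<^sup>2) \<and>
    (\<integral>\<omega>. (Z \<omega>)\<^sup>2 \<partial>M) = (Gamma (1 / (1 + \<alpha>)) * (1 + \<alpha>) * (4 * p + \<alpha> - 2)) /
      (Gamma ((4 * p + 2 * \<alpha> - 1) / (1 + \<alpha>)) * (4 * p + \<alpha> - 3)) \<and>
    conv_in_distr M (\<lambda>n \<omega>. (1 / real n powr \<beta>) *\<^sub>R centred_clusters n \<omega>)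
      (distr M borel (\<lambda>\<omega>. (root_sign col \<omega> * Z \<omega> / (2 * \<xi>)) *\<^sub>R vector [p - 1, 1 - p])) \<and>
    conv_in_distr M (\<lambda>n \<omega>. (1 / real n powr \<beta>) *\<^sub>R
        (vertex_counts par col n \<omega> - real n *\<^sub>R vector [1 / 2, 1 / 2]))
      (distr M borel (\<lambda>\<omega>. (root_sign col \<omega> * Z \<omega> / (2 * \<xi>)) *\<^sub>R vector [2 * p - 1, 1 - 2 * p]))"
proof -
  obtain Z where Z: "L2 Z"
    "(\<integral>\<omega>. Z \<omega> \<partial>M) = Gamma (1 / (1 + \<alpha>)) / Gamma ((2 * p + \<alpha>) / (1 + \<alpha>))"
    "(\<integral>\<omega>. (Z \<omega>)\<^sup>2 \<partial>M) = (Gamma (1 / (1 + \<alpha>)) * (1 + \<alpha>) * (4 * p + \<alpha> - 2)) /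
       (Gamma ((4 * p + 2 * \<alpha> - 1) / (1 + \<alpha>)) * (4 * p + \<alpha> - 3))"
    and walk: "\<And>u v. L2_tendsto (\<lambda>n \<omega>. walk u v (Suc n) \<omega> / real (Suc n) powr \<beta>)
       (\<lambda>\<omega>. (u + v * (1 - p)) / \<xi> * (root_sign col \<omega> * Z \<omega>))"
    using supercritical_limit[OF sup] unfolding \<beta>_def by blast
  have \<beta>: "\<beta> > 1 / 2" using xi_supercritical(2)[OF sup] by (simp add: \<beta>_def)
  note [measurable] = L2_measurable[OF Z(1)]
  have [measurable]: "root_sign col \<in> borel_measurable M"
    by (rule adapted_measurable[OF adapted_root_sign[of 1]]) simp
  have flips_null: "L2_tendsto (\<lambda>n \<omega>. (1 + flips (Suc n) \<omega> - (1 - p) * real (Suc n)) / real (Suc n) powr \<beta>) (\<lambda>_. 0)"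
  proof (rule scaled_null[OF \<beta>])
    show "L2 (\<lambda>\<omega>. 1 + flips (Suc n) \<omega> - (1 - p) * real (Suc n))" for n
      by (rule adapted_L2[OF adapted_comp[OF adapted_flips, where h = "\<lambda>x. 1 + x - (1 - p) * real (Suc n)"]]) simp
    have p: "p\<^sup>2 \<le> 1" "p * (1 - p) \<le> 1" using p_nonneg p_le_1 by (auto intro: power_le_one mult_le_one)
    show "(\<integral>\<omega>. (1 + flips (Suc n) \<omega> - (1 - p) * real (Suc n))\<^sup>2 \<partial>M) \<le> 1 * real (Suc n)" for n
    proof -
      have "p\<^sup>2 + p * (1 - p) * (real (Suc n) - 1) \<le> 1 + 1 * (real (Suc n) - 1)"
        using p by (intro add_mono mult_right_mono) auto
      then show ?thesis using flips_variance[of "Suc n"] by simp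
    qed
  qed
  have vec: "(\<lambda>\<omega>. (root_sign col \<omega> * Z \<omega> / (2 * \<xi>)) *\<^sub>R (x :: real^2)) \<in> borel_measurable M" for x
    by measurable
  have "conv_in_distr M (\<lambda>n \<omega>. (1 / real n powr \<beta>) *\<^sub>R centred_clusters n \<omega>)
      (distr M borel (\<lambda>\<omega>. (root_sign col \<omega> * Z \<omega> / (2 * \<xi>)) *\<^sub>R vector [p - 1, 1 - p]))"
  proof (rule conv_in_distr_of_L2[OF _ vec])
    show "(\<lambda>\<omega>. (1 / real n powr \<beta>) *\<^sub>R centred_clusters n \<omega>) \<in> borel_measurable M" for n
      using cluster_counts_measurable[of n] by simp
    fix t :: "real^2"
    let ?a = "(t $ 1 - t $ 2) / 2" and ?b = "(t $ 1 + t $ 2) / 2"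
    define F where "F n \<omega> = ?a * (walk 0 (- 1) (Suc n) \<omega> / real (Suc n) powr \<beta>) +
        ?b * ((1 + flips (Suc n) \<omega> - (1 - p) * real (Suc n)) / real (Suc n) powr \<beta>)" for n \<omega>
    have lim: "L2_tendsto F (\<lambda>\<omega>. ?a * ((0 + - 1 * (1 - p)) / \<xi> * (root_sign col \<omega> * Z \<omega>)) + ?b * 0)"
      unfolding F_def[abs_def]
      by (intro L2_tendsto_add L2_tendsto_scale[OF walk tendsto_const] L2_tendsto_scale[OF flips_null tendsto_const])
    have eq: "?a * ((0 + - 1 * (1 - p)) / \<xi> * (root_sign col \<omega> * Z \<omega>)) + ?b * 0 =
        t \<bullet> ((root_sign col \<omega> * Z \<omega> / (2 * \<xi>)) *\<^sub>R vector [p - 1, 1 - p])" for \<omega>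
      using xi_supercritical(1)[OF sup] by (simp add: inner_real2 field_simps)
    have F: "F n \<omega> = t \<bullet> ((1 / real (Suc n) powr \<beta>) *\<^sub>R centred_clusters (Suc n) \<omega>)" if "\<omega> \<in> space M" for n \<omega>
      unfolding F_def by (subst inner_centred_clusters[OF that]) (simp_all add: add_divide_distrib)
    show "\<exists>F. L2_tendsto F (\<lambda>\<omega>. t \<bullet> ((root_sign col \<omega> * Z \<omega> / (2 * \<xi>)) *\<^sub>R vector [p - 1, 1 - p])) \<and>
        (\<forall>n. \<forall>\<omega>\<in>space M. F n \<omega> = t \<bullet> ((1 / real (Suc n) powr \<beta>) *\<^sub>R centred_clusters (Suc n) \<omega>))"
      using lim F unfolding eq by blast
  qed
  moreover have "conv_in_distr M (\<lambda>n \<omega>. (1 / real n powr \<beta>) *\<^sub>R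
        (vertex_counts par col n \<omega> - real n *\<^sub>R vector [1 / 2, 1 / 2]))
      (distr M borel (\<lambda>\<omega>. (root_sign col \<omega> * Z \<omega> / (2 * \<xi>)) *\<^sub>R vector [2 * p - 1, 1 - 2 * p]))"
  proof (rule conv_in_distr_of_L2[OF _ vec])
    show "(\<lambda>\<omega>. (1 / real n powr \<beta>) *\<^sub>R (vertex_counts par col n \<omega> - real n *\<^sub>R vector [1 / 2, 1 / 2])) \<in> borel_measurable M" for n
      using vertex_counts_measurable[of n] by simp
    fix t :: "real^2"
    let ?a = "(t $ 1 - t $ 2) / 2"
    define F where "F n \<omega> = ?a * (walk 1 (- 2) (Suc n) \<omega> / real (Suc n) powr \<beta>)" for n \<omega>
    have lim: "L2_tendsto F (\<lambda>\<omega>. ?a * ((1 + - 2 * (1 - p)) / \<xi> * (root_sign col \<omega> * Z \<omega>)))"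
      unfolding F_def[abs_def] by (rule L2_tendsto_scale[OF walk tendsto_const])
    have eq: "?a * ((1 + - 2 * (1 - p)) / \<xi> * (root_sign col \<omega> * Z \<omega>)) =
        t \<bullet> ((root_sign col \<omega> * Z \<omega> / (2 * \<xi>)) *\<^sub>R vector [2 * p - 1, 1 - 2 * p])" for \<omega>
      using xi_supercritical(1)[OF sup] by (simp add: inner_real2 field_simps)
    have F: "F n \<omega> = t \<bullet> ((1 / real (Suc n) powr \<beta>) *\<^sub>R (vertex_counts par col (Suc n) \<omega> - real (Suc n) *\<^sub>R vector [1 / 2, 1 / 2]))" for n \<omega>
      unfolding F_def by (subst inner_centred_vertices) simp_all
    show "\<exists>F. L2_tendsto F (\<lambda>\<omega>. t \<bullet> ((root_sign col \<omega> * Z \<omega> / (2 * \<xi>)) *\<^sub>R vector [2 * p - 1, 1 - 2 * p])) \<and>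
        (\<forall>n. \<forall>\<omega>\<in>space M. F n \<omega> = t \<bullet> ((1 / real (Suc n) powr \<beta>) *\<^sub>R (vertex_counts par col (Suc n) \<omega> - real (Suc n) *\<^sub>R vector [1 / 2, 1 / 2])))"
      using lim F unfolding eq by blast
  qed
  ultimately show ?thesis
    using Z L2_measurable[OF Z(1)] L2_integrable[OF Z(1)] L2_square[OF Z(1)] by blast
qed

end

theorem theorem2p3:
  fixes M :: "'a measure" and \<alpha> p :: real
    and par :: "nat \<Rightarrow> 'a \<Rightarrow> nat" and col :: "nat \<Rightarrow> 'a \<Rightarrow> colour"
  assumes \<alpha>: "\<alpha> \<in> {0..} \<union> {- 1 / of_int d | d :: int. d \<ge> 2}"
    and p: "p \<in> {0..1}"
    and process: "pa_broadcast M \<alpha> p par col"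
  defines "\<mu> \<equiv> vector [(1 - p) / 2, (1 - p) / 2] :: real^2"
    and "\<beta> \<equiv> (2 * p + \<alpha> - 1) / (1 + \<alpha>)"
  shows
    "(AE \<omega> in M. (\<lambda>n. (1 / real n) *\<^sub>R cluster_counts par col n \<omega>) \<longlonglongrightarrow> \<mu>)
     \<and>
     (p < (3 - \<alpha>) / 4 \<longrightarrow>
       (\<exists>N. centred_normal
              (((1 - p) / (4 * (3 - \<alpha> - 4 * p))) *\<^sub>R
               vector [vector [(1 - p) * (\<alpha> + 4 * p + 1), 3 * p - 4 * p\<^sup>2 - \<alpha> * p - \<alpha> - 1],
                       vector [3 * p - 4 * p\<^sup>2 - \<alpha> * p - \<alpha> - 1, (1 - p) * (\<alpha> + 4 * p + 1)]]) N \<and>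
            conv_in_distr M
              (\<lambda>n \<omega>. (1 / sqrt (real n)) *\<^sub>R (cluster_counts par col n \<omega> - real n *\<^sub>R \<mu>)) N))
     \<and>
     (p = (3 - \<alpha>) / 4 \<longrightarrow>
       (\<exists>N. centred_normal
              (((\<alpha> + 1) / 16) *\<^sub>R vector [vector [1, - 1], vector [- 1, 1]]) N \<and>
            conv_in_distr M
              (\<lambda>n \<omega>. (1 / sqrt (real n * ln (real n))) *\<^sub>R
                 (cluster_counts par col n \<omega> - real n *\<^sub>R \<mu>)) N))
     \<and>
     (p > (3 - \<alpha>) / 4 \<longrightarrow>
       (\<exists>Z. Z \<in> borel_measurable M \<and>
            integrable M Z \<and>
            (\<integral>\<omega>. Z \<omega> \<partial>M) = Gamma (1 / (1 + \<alpha>)) / Gamma ((2 * p + \<alpha>) / (1 + \<alpha>)) \<and>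
            integrable M (\<lambda>\<omega>. (Z \<omega>)\<^sup>2) \<and>
            (\<integral>\<omega>. (Z \<omega>)\<^sup>2 \<partial>M) =
              (Gamma (1 / (1 + \<alpha>)) * (1 + \<alpha>) * (4 * p + \<alpha> - 2)) /
              (Gamma ((4 * p + 2 * \<alpha> - 1) / (1 + \<alpha>)) * (4 * p + \<alpha> - 3)) \<and>
            conv_in_distr M
              (\<lambda>n \<omega>. (1 / real n powr \<beta>) *\<^sub>R (cluster_counts par col n \<omega> - real n *\<^sub>R \<mu>))
              (distr M borel
                 (\<lambda>\<omega>. (root_sign col \<omega> * Z \<omega> / (2 * (2 * p + \<alpha> - 1))) *\<^sub>R vector [p - 1, 1 - p])) \<and>
            (p \<noteq> 1 / 2 \<longrightarrow>
             conv_in_distr M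
              (\<lambda>n \<omega>. (1 / real n powr \<beta>) *\<^sub>R
                 (vertex_counts par col n \<omega> - real n *\<^sub>R vector [1 / 2, 1 / 2]))
              (distr M borel
                 (\<lambda>\<omega>. (root_sign col \<omega> * Z \<omega> / (2 * (2 * p + \<alpha> - 1))) *\<^sub>R
                    vector [2 * p - 1, 1 - 2 * p])))))"
proof -
  have \<alpha>1: "\<alpha> > - 1"
  proof -
    have "- 1 < - 1 / real_of_int d" if "d \<ge> 2" for d using that by (simp add: field_simps)
    with \<alpha> show ?thesis by auto
  qed
  interpret pa_broadcast M \<alpha> p par col by (rule process)
  interpret pa_process M \<alpha> p par col
    by unfold_locales (use \<alpha>1 p in auto)
  have \<xi>: "\<xi> = 2 * p + \<alpha> - 1" by (simp add: \<xi>_def)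
  have \<beta>: "\<beta> = \<xi> / (1 + \<alpha>)" by (simp add: \<beta>_def \<xi>)
  have sup: "\<exists>Z. Z \<in> borel_measurable M \<and>
            integrable M Z \<and>
            (\<integral>\<omega>. Z \<omega> \<partial>M) = Gamma (1 / (1 + \<alpha>)) / Gamma ((2 * p + \<alpha>) / (1 + \<alpha>)) \<and>
            integrable M (\<lambda>\<omega>. (Z \<omega>)\<^sup>2) \<and>
            (\<integral>\<omega>. (Z \<omega>)\<^sup>2 \<partial>M) =
              (Gamma (1 / (1 + \<alpha>)) * (1 + \<alpha>) * (4 * p + \<alpha> - 2)) /
              (Gamma ((4 * p + 2 * \<alpha> - 1) / (1 + \<alpha>)) * (4 * p + \<alpha> - 3)) \<and>
            conv_in_distr M
              (\<lambda>n \<omega>. (1 / real n powr \<beta>) *\<^sub>R (cluster_counts par col n \<omega> - real n *\<^sub>R \<mu>))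
              (distr M borel
                 (\<lambda>\<omega>. (root_sign col \<omega> * Z \<omega> / (2 * (2 * p + \<alpha> - 1))) *\<^sub>R vector [p - 1, 1 - p])) \<and>
            (p \<noteq> 1 / 2 \<longrightarrow>
             conv_in_distr M
              (\<lambda>n \<omega>. (1 / real n powr \<beta>) *\<^sub>R
                 (vertex_counts par col n \<omega> - real n *\<^sub>R vector [1 / 2, 1 / 2]))
              (distr M borel
                 (\<lambda>\<omega>. (root_sign col \<omega> * Z \<omega> / (2 * (2 * p + \<alpha> - 1))) *\<^sub>R
                    vector [2 * p - 1, 1 - 2 * p])))"
    if "p > (3 - \<alpha>) / 4"
  proof -
    have "4 * p > 3 - \<alpha>" using that by simp
    from supercritical_convergence[OF this, folded \<beta>, unfolded \<xi>, folded \<mu>_def]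
    show ?thesis by blast
  qed
  show ?thesis
  proof (intro conjI impI)
    show "AE \<omega> in M. (\<lambda>n. (1 / real n) *\<^sub>R cluster_counts par col n \<omega>) \<longlonglongrightarrow> \<mu>"
      unfolding \<mu>_def by (rule strong_law)
  next
    assume "p < (3 - \<alpha>) / 4"
    then have sub: "4 * p < 3 - \<alpha>" by simp
    define q where "q = 3 - \<alpha> - 4 * p"
    have q: "q > 0" using sub by (simp add: q_def)
    show "\<exists>N. centred_normal
              (((1 - p) / (4 * (3 - \<alpha> - 4 * p))) *\<^sub>R
               vector [vector [(1 - p) * (\<alpha> + 4 * p + 1), 3 * p - 4 * p\<^sup>2 - \<alpha> * p - \<alpha> - 1],
                       vector [3 * p - 4 * p\<^sup>2 - \<alpha> * p - \<alpha> - 1, (1 - p) * (\<alpha> + 4 * p + 1)]]) N \<and>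
            conv_in_distr M
              (\<lambda>n \<omega>. (1 / sqrt (real n)) *\<^sub>R (cluster_counts par col n \<omega> - real n *\<^sub>R \<mu>)) N"
      unfolding \<mu>_def
    proof (rule clusters_conv_normal[OF _ _ clt_subcritical[OF sub]])
      show "0 \<le> p * (1 - p)" using p by simp
      show "0 \<le> (1 - p) * (1 + \<alpha>) / (3 - \<alpha> - 4 * p)" using p \<alpha>1 sub by simp
      have d: "(1 - p) / (4 * q) * ((1 - p) * (\<alpha> + 4 * p + 1)) = (p * (1 - p) + (1 - p) * (1 + \<alpha>) / q) / 4"
        and o: "(1 - p) / (4 * q) * (3 * p - 4 * p\<^sup>2 - \<alpha> * p - \<alpha> - 1) = (p * (1 - p) - (1 - p) * (1 + \<alpha>) / q) / 4"
      proof -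
        have 1: "p * (1 - p) + (1 - p) * (1 + \<alpha>) / q = (1 - p) * (p * q + (1 + \<alpha>)) / q"
          and 2: "p * (1 - p) - (1 - p) * (1 + \<alpha>) / q = (1 - p) * (p * q - (1 + \<alpha>)) / q"
          using q by (simp_all add: field_simps)
        have 3: "p * q + (1 + \<alpha>) = (1 - p) * (\<alpha> + 4 * p + 1)"
          and 4: "p * q - (1 + \<alpha>) = 3 * p - 4 * p\<^sup>2 - \<alpha> * p - \<alpha> - 1"
          by (simp_all add: q_def power2_eq_square algebra_simps)
        show "(1 - p) / (4 * q) * ((1 - p) * (\<alpha> + 4 * p + 1)) = (p * (1 - p) + (1 - p) * (1 + \<alpha>) / q) / 4"
          unfolding 1 3 by simp
        show "(1 - p) / (4 * q) * (3 * p - 4 * p\<^sup>2 - \<alpha> * p - \<alpha> - 1) = (p * (1 - p) - (1 - p) * (1 + \<alpha>) / q) / 4"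
          unfolding 2 4 by simp
      qed
      show "((1 - p) / (4 * (3 - \<alpha> - 4 * p))) *\<^sub>R
               vector [vector [(1 - p) * (\<alpha> + 4 * p + 1), 3 * p - 4 * p\<^sup>2 - \<alpha> * p - \<alpha> - 1],
                       vector [3 * p - 4 * p\<^sup>2 - \<alpha> * p - \<alpha> - 1, (1 - p) * (\<alpha> + 4 * p + 1)]] =
            (vector [vector [(p * (1 - p) + (1 - p) * (1 + \<alpha>) / (3 - \<alpha> - 4 * p)) / 4,
                       (p * (1 - p) - (1 - p) * (1 + \<alpha>) / (3 - \<alpha> - 4 * p)) / 4],
                     vector [(p * (1 - p) - (1 - p) * (1 + \<alpha>) / (3 - \<alpha> - 4 * p)) / 4,
                       (p * (1 - p) + (1 - p) * (1 + \<alpha>) / (3 - \<alpha> - 4 * p)) / 4]] :: real^2^2)"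
        unfolding q_def[symmetric] d[symmetric] o[symmetric] by (simp add: vec_eq_iff forall_2)
    qed
  next
    assume "p = (3 - \<alpha>) / 4"
    then have crit: "4 * p = 3 - \<alpha>" by simp
    show "\<exists>N. centred_normal
              (((\<alpha> + 1) / 16) *\<^sub>R vector [vector [1, - 1], vector [- 1, 1]]) N \<and>
            conv_in_distr M
              (\<lambda>n \<omega>. (1 / sqrt (real n * ln (real n))) *\<^sub>R
                 (cluster_counts par col n \<omega> - real n *\<^sub>R \<mu>)) N"
      unfolding \<mu>_def
    proof (rule clusters_conv_normal[where k = 0 and l = "(1 + \<alpha>) / 4"])
      show "0 \<le> (1 + \<alpha>) / 4" using \<alpha>1 by simp
      show "(\<lambda>n. \<integral>\<omega>. cis ((a * walk 0 (- 1) n \<omega> + b * (1 + flips n \<omega> - (1 - p) * real n)) / sqrt (real n * ln (real n))) \<partial>M)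
          \<longlonglongrightarrow> of_real (exp (- (a\<^sup>2 * ((1 + \<alpha>) / 4) + b\<^sup>2 * 0) / 2))" for a b
        using clt_critical[OF crit, of a b] by (simp only: mult_zero_right add_0_right)
    qed (simp_all add: vec_eq_iff forall_2 add_divide_distrib)
  qed (rule sup)
qed

end
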